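(* Let $W$ be a finite irreducible Weyl group of type $X_n$ with $X\in\{B,C,D,E,F,G\}$, with simple roots $\beta_1,\dots,\beta_n$, simple reflections $s_i=s_{\beta_i}$, $S=\{s_1,\dots,s_n\}$, highest root $\rho$, and let $\widetilde W$ be the corresponding affine Weyl group, with simple reflections $s_0=s_{\delta-\rho},s_1,\dots,s_n$. For each $i\in\{1,\dots,n\}$ let $y_i$ be the word in $s_0,\dots,s_n$ specified below (depending on the type). Then an infinite reduced word of $\widetilde W$ is minimal (for the limit weak order) if and only if, for some $i\in\{1,\dots,n\}$, it has a reduced expression of the form $$(\underline v\, y_i\, \underline u)^\infty=\underline v\,y_i\,\underline u\;\underline v\,y_i\,\underline u\;\underline v\,y_i\,\underline u\cdots$$ where $\underline u\,\underline v$ (concatenation of words) is a reduced expression of $w_0^{W_{S\setminus\{s_i\}}}w_0$. For even $k\ge 2$ put $B_k=(s_2s_1s_3s_2)(s_4s_3s_5s_4)\cdots(s_ks_{k-1}s_{k+1}s_k)$. In types $E,F,G$ a string of digits denotes the corresponding product of simple reflections (e.g. $0\,2\,4$ means $s_0s_2s_4$). (1) Type $B_n$: - $i$ even, $2\le i\le n$: $y_i=s_0(B_{i-2}s_0)(B_{i-4}s_0)\cdots(B_4s_0)(B_2s_0)$ (so $y_2=s_0$). - $i$ odd, $3\le i\le n$: $y_i=\big(s_0s_2s_3\cdots s_ns_{n-1}s_{n-2}\cdots s_i\,s_1s_2\cdots s_ns_{n-1}s_{n-2}\cdots s_i\big)^{\frac{i-1}{2}}\big(s_0s_2s_3\cdots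 s_ns_{n-1}s_{n-2}\cdots s_i\,s_1s_2\cdots s_{i-1}\big)(s_0B_{i-3})(s_0B_{i-5})\cdots(s_0B_2)\,s_0$ (the descending runs $s_{n-1}\cdots s_i$ are empty if $i=n$; for $i=3$ there are no factors $s_0B_k$). - $i=1$: $y_1=s_0s_2s_3\cdots s_n\cdots s_3s_2s_0$. (2) Type $C_n$, $1\le i\le n$: $y_i=s_0(s_1s_0)(s_2s_1s_0)\cdots(s_{i-1}s_{i-2}\cdots s_1s_0)$. (3) Type $D_n$: - $i=1$: $y_1=s_0s_2s_3\cdots s_{n-2}s_{n-1}s_ns_{n-2}\cdots s_3s_2s_0$. - $i$ even, $2\le i\le n-2$: $y_i=s_0(B_{i-2}s_0)\cdots(B_4s_0)(B_2s_0)$. - $i$ odd, $3\le i\le n-2$: $y_i=s_0\big(s_2s_3\cdots s_n\,s_1s_2\cdots s_n(s_{n-3}s_{n-2})(s_{n-4}s_{n-3})\cdots(s_{i-1}s_i)s_0\big)^{\frac{i-1}{2}}\big(s_2s_3\cdots s_ns_{n-2}s_{n-3}\cdots s_i\,s_1s_2\cdots s_{i-1}s_0\big)(B_{i-3}s_0)(B_{i-5}s_0)\cdots(B_2s_0)$. - $n$ odd: $y_{n-1}=s_0\big(s_2s_3\cdots s_{n-1}\,s_1s_2\cdots s_{n-2}s_ns_0\big)^{\frac{n+1}{2}}(B_{n-3}s_0)(B_{n-5}s_0)\cdots(B_2s_0)$ and $y_n=s_0\big(s_2s_3\cdots s_{n-2}s_n\,s_1s_2\cdots s_{n-2}s_{n-1}s_0\big)^{\frac{n+1}{2}}(B_{n-3}s_0)(B_{n-5}s_0)\cdots(B_2s_0)$.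 - $n$ even: $y_{n-1}=s_0s_2\cdots s_{n-2}s_n\,s_1s_2\cdots s_{n-2}s_0(B_{n-4}s_0)(B_{n-6}s_0)\cdots(B_2s_0)$ and $y_n=s_0s_2\cdots s_{n-2}s_{n-1}\,s_1s_2\cdots s_{n-2}s_0(B_{n-4}s_0)(B_{n-6}s_0)\cdots(B_2s_0)$. (4) Type $E_6$: - $y_1=0\,(2\,4\,5\,3\,4\,1\,2\,3\,4\,5\,6\,0)^2\,2\,4\,5\,3\,4\,2\,0$ - $y_2=0$ - $y_3=0\,(2\,4\,5\,6\,3\,4\,5\,2\,4\,1\,3\,4\,2\,5\,4\,6\,5\,0)^2(2\,4\,3\,5\,4\,2\,1\,3\,4\,6\,5\,4\,3\,2\,4\,0)(2\,4\,3\,5\,6\,4\,1\,5\,3\,4\,2\,0)$ - $y_4=0\,2\,4\,3\,5\,6\,4\,1\,5\,3\,4\,2\,0$ - $y_5=0\,(2\,4\,3\,1\,5\,4\,3\,2\,4\,6\,5\,4\,2\,3\,4\,1\,3\,0)^2(2\,4\,5\,3\,4\,2\,6\,5\,4\,1\,3\,4\,5\,2\,4\,0)(2\,4\,3\,5\,6\,4\,1\,5\,3\,4\,2\,0)$ - $y_6=0\,(2\,4\,3\,5\,4\,6\,2\,5\,4\,3\,1\,0)^2\,2\,4\,3\,5\,4\,2\,0$ (5) Type $E_7$: - $y_1=0$ - $y_2=0\,1\,3\,4\,2\,5\,4\,3\,1\,6\,5\,4\,2\,3\,4\,5\;7\,6\,5\,4\,3\,2\,1\,4\,3\,5\,4\,2\,0\,1\,3\,4\,2\,5\,4\,3\,1\,6\,5\;4\,2\,3\,4\,7\,5\,6\,0\,1\,3\,4\,5\,2\,4\,3\,1\,0$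 - $y_3=0\,1\,3\,4\,5\,2\,6\,4\,7\,5\,3\,6\,4\,5\,2\,4\,3\,1\,0$ - $y_4=0\,1\,3\,4\,2\,5\,4\,3\,1\,6\,5\,4\,3\,2\,4\,7\;6\,5\,4\,2\,3\,4\,1\,3\,0\,1\,3\,4\,5\,2\;6\,4\,7\,5\,3\,6\,4\,5\,2\,4\,3\,1\,0$ - $y_5=0\,1\,3\,4\,5\,6\,7\,2\,4\,3\,5\,1\,4\,2\,6\;3\,4\,5\,6\,7\,4\,3\,1\,2\,4\,5\,3\,6\,4\,5\,0\,1\,3\;4\,5\,6\,7\,2\,4\,3\,5\,1\,4\,2\,6\,3\,4\,5\,6\,4\,3\,1\;2\,4\,5\,3\,4\,0\,1\,3\,4\,2\,5\,4\,3\,1\,6\,5\,4\,3\,2\;4\,7\,6\,5\,4\,2\,3\,4\,1\,3\,0\,1\,3\,4\,5\,2\,6\,4\,7\;5\,3\,6\,4\,5\,2\,4\,3\,1\,0$ - $y_6=0\,1\,3\,4\,5\,2\,4\,3\,1\,0$ - $y_7=0\,1\,3\,4\,2\,5\,6\,4\,5\,3\,4\,1\,2\,3\,4\,5\,6\,0\;1\,3\,4\,5\,2\,4\,3\,1\,0$ (6) Type $E_8$: - $y_1=0\,8\,7\,6\,5\,4\,3\,2\,4\,5\,6\,7\,8\,0$ - $y_2=0\,8\,7\,6\,5\,4\,2\,3\,4\,5\,6\,7\,8\,1\,3\,4\,5\,2\;6\,4\,7\,5\,3\,6\,4\,5\,2\,4\,3\,1\,0\,8\,7\,6\,5\,4\,3\,2\,4\,5\,6\;7\,8\,0$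 - $y_3=0\,8\,7\,6\,5\,4\,3\,1\,2\,4\,3\,5\,4\,2\,6\,5\,4\,3\;1\,7\,6\,5\,4\,2\,3\,4\,5\,8\,7\,6\,5\,4\,3\,2\,1\,4\,3\,5\,4\,2\,0\;8\,7\,6\,5\,4\,2\,3\,4\,5\,6\,7\,8\,1\,3\,4\,5\,2\,6\,4\,7\,5\,3\,6\,4\;5\,2\,4\,3\,1\,0\,8\,7\,6\,5\,4\,3\,2\,4\,5\,6\,7\,8\,0$ - $y_4=0\,8\,7\,6\,5\,4\,3\,2\,4\,5\,6\,7\,8\,1\,3\,4\,2\,5\,4\,3\,1\,6\;5\,4\,3\,2\,4\,5\,6\,7\,8\,6\,5\,4\,2\,3\,4\,5\,6\,7\,1\,3\,4\,5\,2\,6\,4\;5\,0\,8\,7\,6\,5\,4\,2\,3\,4\,1\,3\,5\,6\,7\,8\,4\,5\,6\,7\,2\,4\,3\,5\,1\;4\,2\,6\,3\,4\,5\,6\,7\,8\,4\,3\,1\,2\,4\,5\,3\,6\,4\,7\,5\,6\,0\,8\,7\,6\;5\,4\,3\,2\,1\,4\,3\,5\,4\,6\,7\,8\,5\,6\,7\,2\,4\,5\,6\,3\,4\,2\,5\,4\,1\,3\;4\,5\,2\,6\,4\,7\,5\,8\,6\,7\,0\,8\,7\,6\,5\,4\,2\,3\,4\,1\,5\,3\,6\,4\,7\;5\,2\,6\,4\,5\,3\,4\,1\,3\,2\,4\,5\,6\,7\,8\,0$ - $y_5=0\,8\,7\,6\,5\,4\,2\,3\,4\,1\,3\,5\,6\,7\,8\,4\,5\,6\,7\,2\,4\,3\,5\,1\;4\,2\,6\,3\,4\,5\,6\,7\,8\,4\,3\,1\,2\,4\,5\,3\,6\,4\,7\,5\,6\,0\,8\,7\,6\,5\;4\,3\,2\,1\,4\,3\,5\,4\,6\,7\,8\,5\,6\,7\,2\,4\,5\,6\,3\,4\,2\,5\,4\,1\,3\,4\;5\,2\,6\,4\,7\,5\,8\,6\,7\,0\,8\,7\,6\,5\,4\,2\,3\,4\,1\,5\,3\,6\,4\,7\,5\;2\,6\,4\,5\,3\,4\,1\,3\,2\,4\,5\,6\,7\,8\,0$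 - $y_6=0\,8\,7\,6\,5\,4\,3\,2\,1\,4\,3\,5\,4\,6\,7\,8\,5\,6\,7\,2\,4\,5\;6\,3\,4\,2\,5\,4\,1\,3\,4\,5\,2\,6\,4\,7\,5\,8\,6\,7\,0\,8\,7\,6\,5\,4\;2\,3\,4\,1\,5\,3\,6\,4\,7\,5\,2\,6\,4\,5\,3\,4\,1\,3\,2\,4\,5\,6\,7\,8\,0$ - $y_7=0\,8\,7\,6\,5\,4\,2\,3\,4\,1\,5\,3\,6\,4\,7\,5\,2\,6\,4\,5\,3\,4\;1\,3\,2\,4\,5\,6\,7\,8\,0$ - $y_8=0$ (7) Type $F_4$: $y_1=0$; $y_2=0\,1\,2\,3\,4\,2\,3\,2\,1\,0$; $y_3=0\,1\,2\,3\,2\,1\,4\,3\,2\,3\,1\,2\,0\;1\,2\,3\,4\,2\,3\,2\,1\,0$; $y_4=0\,1\,2\,3\,2\,1\,0$. (8) Type $G_2$: $y_1=0\,2\,1\,2\,0$; $y_2=0$.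
   Context: Numbering of simple roots, with $\epsilon_j$ a standard basis (overall rescaling of a root system is irrelevant): $B_n$ ($n\ge2$): $\beta_j=\epsilon_j-\epsilon_{j+1}$ for $j<n$, $\beta_n=\epsilon_n$. $C_n$ ($n\ge 2$): $\beta_j=\epsilon_j-\epsilon_{j+1}$ for $j<n$, $\beta_n=2\epsilon_n$. $D_n$ ($n\ge4$): $\beta_j=\epsilon_j-\epsilon_{j+1}$ for $j<n$, $\beta_n=\epsilon_{n-1}+\epsilon_n$. $E_8$: $\beta_1=\frac12(\epsilon_1-\epsilon_2-\cdots-\epsilon_7+\epsilon_8)$, $\beta_2=\epsilon_1+\epsilon_2$, $\beta_j=\epsilon_{j-1}-\epsilon_{j-2}$ for $3\le j\le 8$; $E_7$ and $E_6$ use the first 7, resp. 6, of these. $F_4$: $\beta_1=\epsilon_2-\epsilon_3$, $\beta_2=\epsilon_3-\epsilon_4$, $\beta_3=\epsilon_4$, $\beta_4=\frac12(\epsilon_1-\epsilon_2-\epsilon_3-\epsilon_4)$. $G_2$: $\beta_1=\epsilon_1-\epsilon_2$ (short), $\beta_2=-2\epsilon_1+\epsilon_2+\epsilon_3$ (long). Affine Weyl group: $\Phi\subset V$ is the (crystallographic) root system of $W$ with positive system $\Phi^+$. Let $V'=V\oplus\mathbb R\delta$, extending the inner product by $(\delta,v)=0$ for all $v\in V'$. The positive roots of $\widetilde W$ are $\alpha+m\delta$ with $\alpha\in\Phi^+,m\ge0$ or $\alpha\in\Phi^-,m\ge1$; the negative roots are their negatives. $\widetilde W$ is generated by the reflections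 $s_\gamma(v)=v-2\frac{(v,\gamma)}{(\gamma,\gamma)}\gamma$ in these roots; it is a Coxeter group with simple roots $\beta_1,\dots,\beta_n,\delta-\rho$, where $\rho$ is the highest root of $\Phi^+$. $w_0$ is the longest element of $W$; for $J\subset S$, $W_J$ is the parabolic subgroup generated by $J$ and $w_0^{W_J}$ its longest element. For $w$ in a Coxeter group, the inversion set $\Phi_w$ is the set of positive roots $\alpha$ with $w^{-1}(\alpha)$ negative. An infinite sequence $r_1r_2r_3\cdots$ of simple reflections is an infinite reduced word if $r_1\cdots r_j$ is reduced for every $j\ge1$; its inversion set is $\bigcup_j\Phi_{r_1\cdots r_j}$. Two infinite reduced words are considered equal if their inversion sets are equal; a reduced expression of an infinite reduced word is any sequence representing it. The limit weak order on infinite reduced words is: $x\le y$ iff $\Phi_x\subset\Phi_y$. A minimal infinite reduced word is a minimal element of this order. *)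

theory Defs
  imports Complex_Main "HOL-Library.Function_Algebras"
begin

section \<open>Root systems\<close>

datatype series = TypeB | TypeC | TypeD | TypeE | TypeF | TypeG

fun admissible :: "series \<Rightarrow> nat \<Rightarrow> bool" where
  "admissible TypeB n \<longleftrightarrow> n \<ge> 2"
| "admissible TypeC n \<longleftrightarrow> n \<ge> 2"
| "admissible TypeD n \<longleftrightarrow> n \<ge> 4"
| "admissible TypeE n \<longleftrightarrow> n \<in> {6, 7, 8}"
| "admissible TypeF n \<longleftrightarrow> n = 4"
| "admissible TypeG n \<longleftrightarrow> n = 2"

text \<open>
  A vector of \<open>V' = V \<oplus> \<real>\<delta>\<close> is a function \<open>nat \<Rightarrow> real\<close>: coordinate \<open>0\<close> is the
  coefficient of \<open>\<delta>\<close>, and coordinates \<open>1, \<dots>, N\<close> (with \<open>N\<close> the dimension of the Euclidean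
  space containing the roots) are those with respect to the standard basis \<open>\<epsilon>\<^sub>1, \<dots>, \<epsilon>\<^sub>N\<close>.
  All roots vanish beyond coordinate \<open>N\<close>, so the reflections below leave those coordinates
  alone, and two products of reflections agree as functions iff they agree on \<open>V'\<close>.
\<close>

type_synonym vec = "nat \<Rightarrow> real"

definition scl :: "real \<Rightarrow> vec \<Rightarrow> vec" where
  "scl c v = (\<lambda>k. c * v k)"

definition eps :: "nat \<Rightarrow> vec" where
  "eps j = (\<lambda>k. if k = j then 1 else 0)"

definition delta :: vec where
  "delta = eps 0"

fun ambient_dim :: "series \<Rightarrow> nat \<Rightarrow> nat" where
  "ambient_dim TypeE n = 8"
| "ambient_dim TypeG n = 3"
| "ambient_dim X n = n"

text \<open>The sum omits coordinate \<open>0\<close>, so \<open>\<delta>\<close> is orthogonal to everything.\<close>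

definition inner_prod :: "series \<Rightarrow> nat \<Rightarrow> vec \<Rightarrow> vec \<Rightarrow> real" where
  "inner_prod X n v w = (\<Sum>j = 1..ambient_dim X n. v j * w j)"

definition reflection :: "series \<Rightarrow> nat \<Rightarrow> vec \<Rightarrow> vec \<Rightarrow> vec" where
  "reflection X n \<gamma> v = v - scl (2 * (inner_prod X n v \<gamma> / inner_prod X n \<gamma> \<gamma>)) \<gamma>"

fun simple_root :: "series \<Rightarrow> nat \<Rightarrow> nat \<Rightarrow> vec" where
  "simple_root TypeB n j = (if j < n then eps j - eps (j + 1) else eps n)"
| "simple_root TypeC n j = (if j < n then eps j - eps (j + 1) else scl 2 (eps n))"
| "simple_root TypeD n j = (if j < n then eps j - eps (j + 1) else eps (n - 1) + eps n)"
| "simple_root TypeE n j =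
    (if j = 1 then scl (1/2) (eps 1 - (\<Sum>k = 2..7. eps k) + eps 8)
     else if j = 2 then eps 1 + eps 2
     else eps (j - 1) - eps (j - 2))"
| "simple_root TypeF n j =
    (if j = 1 then eps 2 - eps 3
     else if j = 2 then eps 3 - eps 4
     else if j = 3 then eps 4
     else scl (1/2) (eps 1 - eps 2 - eps 3 - eps 4))"
| "simple_root TypeG n j =
    (if j = 1 then eps 1 - eps 2 else scl (-2) (eps 1) + eps 2 + eps 3)"

inductive_set roots :: "series \<Rightarrow> nat \<Rightarrow> vec set" for X n where
  simple: "j \<in> {1..n} \<Longrightarrow> simple_root X n j \<in> roots X n"
| reflect: "\<alpha> \<in> roots X n \<Longrightarrow> j \<in> {1..n} \<Longrightarrow>
    reflection X n (simple_root X n j) \<alpha> \<in> roots X n"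

definition nonneg_comb :: "series \<Rightarrow> nat \<Rightarrow> vec \<Rightarrow> bool" where
  "nonneg_comb X n v \<longleftrightarrow>
    (\<exists>c. (\<forall>j \<in> {1..n}. c j \<ge> 0) \<and> v = (\<Sum>j = 1..n. scl (c j) (simple_root X n j)))"

definition pos_roots :: "series \<Rightarrow> nat \<Rightarrow> vec set" where
  "pos_roots X n = {\<alpha> \<in> roots X n. nonneg_comb X n \<alpha>}"

definition neg_roots :: "series \<Rightarrow> nat \<Rightarrow> vec set" where
  "neg_roots X n = uminus ` pos_roots X n"

definition highest_root :: "series \<Rightarrow> nat \<Rightarrow> vec" where
  "highest_root X n =
    (THE \<rho>. \<rho> \<in> pos_roots X n \<and> (\<forall>\<alpha> \<in> pos_roots X n. nonneg_comb X n (\<rho> - \<alpha>)))"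


section \<open>The affine Weyl group\<close>

definition affine_pos_roots :: "series \<Rightarrow> nat \<Rightarrow> vec set" where
  "affine_pos_roots X n =
    {\<alpha> + scl (real m) delta | \<alpha> m. \<alpha> \<in> pos_roots X n} \<union>
    {\<alpha> + scl (real m) delta | \<alpha> m. \<alpha> \<in> neg_roots X n \<and> m \<ge> 1}"

definition affine_neg_roots :: "series \<Rightarrow> nat \<Rightarrow> vec set" where
  "affine_neg_roots X n = uminus ` affine_pos_roots X n"

definition affine_simple_root :: "series \<Rightarrow> nat \<Rightarrow> nat \<Rightarrow> vec" where
  "affine_simple_root X n j = (if j = 0 then delta - highest_root X n else simple_root X n j)"

definition simple_refl :: "series \<Rightarrow> nat \<Rightarrow> nat \<Rightarrow> vec \<Rightarrow> vec" where
  "simple_refl X n j = reflection X n (affine_simple_root X n j)"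

text \<open>
  Words are lists of indices of simple reflections; \<open>W\<close> is regarded as the subgroup of
  the affine Weyl group generated by \<open>s\<^sub>1, \<dots>, s\<^sub>n\<close>, and \<open>J \<subseteq> {0..n}\<close> stands for \<open>{s\<^sub>j | j \<in> J}\<close>.
\<close>

definition word_elt :: "series \<Rightarrow> nat \<Rightarrow> nat list \<Rightarrow> vec \<Rightarrow> vec" where
  "word_elt X n xs = foldr (\<lambda>j g. simple_refl X n j \<circ> g) xs id"

definition parabolic :: "series \<Rightarrow> nat \<Rightarrow> nat set \<Rightarrow> (vec \<Rightarrow> vec) set" where
  "parabolic X n J = {word_elt X n xs | xs. set xs \<subseteq> J}"

definition cox_length :: "series \<Rightarrow> nat \<Rightarrow> nat set \<Rightarrow> (vec \<Rightarrow> vec) \<Rightarrow> nat" where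
  "cox_length X n J w = (LEAST k. \<exists>xs. set xs \<subseteq> J \<and> word_elt X n xs = w \<and> length xs = k)"

definition reduced_expression ::
    "series \<Rightarrow> nat \<Rightarrow> nat set \<Rightarrow> nat list \<Rightarrow> (vec \<Rightarrow> vec) \<Rightarrow> bool" where
  "reduced_expression X n J xs w \<longleftrightarrow>
    set xs \<subseteq> J \<and> word_elt X n xs = w \<and> length xs = cox_length X n J w"

definition longest_element :: "series \<Rightarrow> nat \<Rightarrow> nat set \<Rightarrow> vec \<Rightarrow> vec" where
  "longest_element X n J =
    (THE w. w \<in> parabolic X n J \<and>
      (\<forall>w' \<in> parabolic X n J. cox_length X n J w' \<le> cox_length X n J w))"

definition inversions :: "series \<Rightarrow> nat \<Rightarrow> (vec \<Rightarrow> vec) \<Rightarrow> vec set" where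
  "inversions X n w = {\<alpha> \<in> affine_pos_roots X n. inv w \<alpha> \<in> affine_neg_roots X n}"


section \<open>Infinite reduced words and the limit weak order\<close>

text \<open>The sequence \<open>r\<^sub>1 r\<^sub>2 r\<^sub>3 \<dots>\<close> is indexed from \<open>0\<close>: \<open>r k\<close> is its letter number \<open>k + 1\<close>.\<close>

type_synonym inf_word = "nat \<Rightarrow> nat"

definition prefix_word :: "inf_word \<Rightarrow> nat \<Rightarrow> nat list" where
  "prefix_word r j = map r [0..<j]"

definition inf_reduced :: "series \<Rightarrow> nat \<Rightarrow> inf_word \<Rightarrow> bool" where
  "inf_reduced X n r \<longleftrightarrow>
    (\<forall>j \<ge> 1. reduced_expression X n {0..n} (prefix_word r j) (word_elt X n (prefix_word r j)))"

definition inf_inversions :: "series \<Rightarrow> nat \<Rightarrow> inf_word \<Rightarrow> vec set" where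
  "inf_inversions X n r = (\<Union>j \<in> {1..}. inversions X n (word_elt X n (prefix_word r j)))"

definition limit_le :: "series \<Rightarrow> nat \<Rightarrow> inf_word \<Rightarrow> inf_word \<Rightarrow> bool" where
  "limit_le X n x y \<longleftrightarrow> inf_inversions X n x \<subseteq> inf_inversions X n y"

definition limit_eq :: "series \<Rightarrow> nat \<Rightarrow> inf_word \<Rightarrow> inf_word \<Rightarrow> bool" where
  "limit_eq X n x y \<longleftrightarrow> inf_inversions X n x = inf_inversions X n y"

definition minimal_inf_reduced :: "series \<Rightarrow> nat \<Rightarrow> inf_word \<Rightarrow> bool" where
  "minimal_inf_reduced X n x \<longleftrightarrow>
    inf_reduced X n x \<and> (\<forall>y. inf_reduced X n y \<and> limit_le X n y x \<longrightarrow> limit_eq X n y x)"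

definition inf_reduced_expression :: "series \<Rightarrow> nat \<Rightarrow> inf_word \<Rightarrow> inf_word \<Rightarrow> bool" where
  "inf_reduced_expression X n z x \<longleftrightarrow> inf_reduced X n z \<and> limit_eq X n z x"

definition periodic_word :: "nat list \<Rightarrow> inf_word" where
  "periodic_word xs k = xs ! (k mod length xs)"


section \<open>The words \<open>y\<^sub>i\<close>\<close>

text \<open>\<open>up a b\<close> is \<open>s\<^sub>a s\<^bsub>a+1\<^esub> \<dots> s\<^sub>b\<close> and \<open>down a b\<close> is \<open>s\<^sub>a s\<^bsub>a-1\<^esub> \<dots> s\<^sub>b\<close>; both are empty when the
  run is.\<close>

definition up :: "nat \<Rightarrow> nat \<Rightarrow> nat list" where
  "up a b = [a..<b + 1]"

definition down :: "nat \<Rightarrow> nat \<Rightarrow> nat list" where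
  "down a b = rev [b..<a + 1]"

definition wpow :: "nat list \<Rightarrow> nat \<Rightarrow> nat list" where
  "wpow xs k = concat (replicate k xs)"

text \<open>\<open>B_word m\<close> is the word \<open>B\<^sub>k\<close> with \<open>k = 2m\<close>.\<close>

definition B_word :: "nat \<Rightarrow> nat list" where
  "B_word m = concat (map (\<lambda>l. [2*l, 2*l - 1, 2*l + 1, 2*l]) [1..<m + 1])"

text \<open>For \<open>k = 2m\<close>: \<open>(B\<^sub>k s\<^sub>0)(B\<^bsub>k-2\<^esub> s\<^sub>0) \<dots> (B\<^sub>2 s\<^sub>0)\<close> and \<open>(s\<^sub>0 B\<^sub>k)(s\<^sub>0 B\<^bsub>k-2\<^esub>) \<dots> (s\<^sub>0 B\<^sub>2)\<close>.\<close>

definition Bs0_prod :: "nat \<Rightarrow> nat list" where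
  "Bs0_prod m = concat (map (\<lambda>l. B_word l @ [0]) (rev [1..<m + 1]))"

definition s0B_prod :: "nat \<Rightarrow> nat list" where
  "s0B_prod m = concat (map (\<lambda>l. [0] @ B_word l) (rev [1..<m + 1]))"

definition y_B :: "nat \<Rightarrow> nat \<Rightarrow> nat list" where
  "y_B n i =
    (if i = 1 then [0] @ up 2 n @ down (n - 1) 2 @ [0]
     else if even i then [0] @ Bs0_prod ((i - 2) div 2)
     else
       wpow ([0] @ up 2 n @ down (n - 1) i @ up 1 n @ down (n - 1) i) ((i - 1) div 2) @
       ([0] @ up 2 n @ down (n - 1) i @ up 1 (i - 1)) @
       s0B_prod ((i - 3) div 2) @ [0])"

definition y_C :: "nat \<Rightarrow> nat list" where
  "y_C i = concat (map (\<lambda>j. down j 0) [0..<i])"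

definition y_D :: "nat \<Rightarrow> nat \<Rightarrow> nat list" where
  "y_D n i =
    (if i = 1 then [0] @ up 2 n @ down (n - 2) 2 @ [0]
     else if i \<le> n - 2 then
       (if even i then [0] @ Bs0_prod ((i - 2) div 2)
        else
          [0] @
          wpow (up 2 n @ up 1 n @ concat (map (\<lambda>l. [l, l + 1]) (down (n - 3) (i - 1))) @ [0])
            ((i - 1) div 2) @
          (up 2 n @ down (n - 2) i @ up 1 (i - 1) @ [0]) @
          Bs0_prod ((i - 3) div 2))
     else if odd n then
       (if i = n - 1 then
          [0] @ wpow (up 2 (n - 1) @ up 1 (n - 2) @ [n] @ [0]) ((n + 1) div 2) @
          Bs0_prod ((n - 3) div 2)
        else
          [0] @ wpow (up 2 (n - 2) @ [n] @ up 1 (n - 2) @ [n - 1] @ [0]) ((n + 1) div 2) @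
          Bs0_prod ((n - 3) div 2))
     else
       (if i = n - 1 then
          [0] @ up 2 (n - 2) @ [n] @ up 1 (n - 2) @ [0] @ Bs0_prod ((n - 4) div 2)
        else
          [0] @ up 2 (n - 2) @ [n - 1] @ up 1 (n - 2) @ [0] @ Bs0_prod ((n - 4) div 2)))"

definition y_E6 :: "nat \<Rightarrow> nat list" where
  "y_E6 i =
    (if i = 1 then
         [0] @ wpow [2, 4, 5, 3, 4, 1, 2, 3, 4, 5, 6, 0] 2 @ [2, 4, 5, 3, 4, 2,
         0]
     else if i = 2 then [0]
     else if i = 3 then
         [0] @ wpow [2, 4, 5, 6, 3, 4, 5, 2, 4, 1, 3, 4, 2, 5, 4, 6, 5, 0] 2 @
         [2, 4, 3, 5, 4, 2, 1, 3, 4, 6, 5, 4, 3, 2, 4, 0] @ [2, 4, 3, 5, 6, 4, 1,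
         5, 3, 4, 2, 0]
     else if i = 4 then [0, 2, 4, 3, 5, 6, 4, 1, 5, 3, 4, 2, 0]
     else if i = 5 then
         [0] @ wpow [2, 4, 3, 1, 5, 4, 3, 2, 4, 6, 5, 4, 2, 3, 4, 1, 3, 0] 2 @
         [2, 4, 5, 3, 4, 2, 6, 5, 4, 1, 3, 4, 5, 2, 4, 0] @ [2, 4, 3, 5, 6, 4, 1,
         5, 3, 4, 2, 0]
     else
         [0] @ wpow [2, 4, 3, 5, 4, 6, 2, 5, 4, 3, 1, 0] 2 @ [2, 4, 3, 5, 4, 2,
         0])"

definition y_E7 :: "nat \<Rightarrow> nat list" where
  "y_E7 i =
    (if i = 1 then [0]
     else if i = 2 then
         [0, 1, 3, 4, 2, 5, 4, 3, 1, 6, 5, 4, 2, 3, 4, 5, 7, 6, 5, 4, 3, 2, 1, 4,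
         3, 5, 4, 2, 0, 1, 3, 4, 2, 5, 4, 3, 1, 6, 5, 4, 2, 3, 4, 7, 5, 6, 0, 1,
         3, 4, 5, 2, 4, 3, 1, 0]
     else if i = 3 then [0, 1, 3, 4, 5, 2, 6, 4, 7, 5, 3, 6, 4, 5, 2, 4, 3, 1, 0]
     else if i = 4 then
         [0, 1, 3, 4, 2, 5, 4, 3, 1, 6, 5, 4, 3, 2, 4, 7, 6, 5, 4, 2, 3, 4, 1, 3,
         0, 1, 3, 4, 5, 2, 6, 4, 7, 5, 3, 6, 4, 5, 2, 4, 3, 1, 0]
     else if i = 5 then
         [0, 1, 3, 4, 5, 6, 7, 2, 4, 3, 5, 1, 4, 2, 6, 3, 4, 5, 6, 7, 4, 3, 1, 2,
         4, 5, 3, 6, 4, 5, 0, 1, 3, 4, 5, 6, 7, 2, 4, 3, 5, 1, 4, 2, 6, 3, 4, 5,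
         6, 4, 3, 1, 2, 4, 5, 3, 4, 0, 1, 3, 4, 2, 5, 4, 3, 1, 6, 5, 4, 3, 2, 4,
         7, 6, 5, 4, 2, 3, 4, 1, 3, 0, 1, 3, 4, 5, 2, 6, 4, 7, 5, 3, 6, 4, 5, 2,
         4, 3, 1, 0]
     else if i = 6 then [0, 1, 3, 4, 5, 2, 4, 3, 1, 0]
     else
         [0, 1, 3, 4, 2, 5, 6, 4, 5, 3, 4, 1, 2, 3, 4, 5, 6, 0, 1, 3, 4, 5, 2, 4,
         3, 1, 0])"

definition y_E8 :: "nat \<Rightarrow> nat list" where
  "y_E8 i =
    (if i = 1 then [0, 8, 7, 6, 5, 4, 3, 2, 4, 5, 6, 7, 8, 0]
     else if i = 2 then
         [0, 8, 7, 6, 5, 4, 2, 3, 4, 5, 6, 7, 8, 1, 3, 4, 5, 2, 6, 4, 7, 5, 3, 6,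
         4, 5, 2, 4, 3, 1, 0, 8, 7, 6, 5, 4, 3, 2, 4, 5, 6, 7, 8, 0]
     else if i = 3 then
         [0, 8, 7, 6, 5, 4, 3, 1, 2, 4, 3, 5, 4, 2, 6, 5, 4, 3, 1, 7, 6, 5, 4, 2,
         3, 4, 5, 8, 7, 6, 5, 4, 3, 2, 1, 4, 3, 5, 4, 2, 0, 8, 7, 6, 5, 4, 2, 3,
         4, 5, 6, 7, 8, 1, 3, 4, 5, 2, 6, 4, 7, 5, 3, 6, 4, 5, 2, 4, 3, 1, 0, 8,
         7, 6, 5, 4, 3, 2, 4, 5, 6, 7, 8, 0]
     else if i = 4 then
         [0, 8, 7, 6, 5, 4, 3, 2, 4, 5, 6, 7, 8, 1, 3, 4, 2, 5, 4, 3, 1, 6, 5, 4,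
         3, 2, 4, 5, 6, 7, 8, 6, 5, 4, 2, 3, 4, 5, 6, 7, 1, 3, 4, 5, 2, 6, 4, 5,
         0, 8, 7, 6, 5, 4, 2, 3, 4, 1, 3, 5, 6, 7, 8, 4, 5, 6, 7, 2, 4, 3, 5, 1,
         4, 2, 6, 3, 4, 5, 6, 7, 8, 4, 3, 1, 2, 4, 5, 3, 6, 4, 7, 5, 6, 0, 8, 7,
         6, 5, 4, 3, 2, 1, 4, 3, 5, 4, 6, 7, 8, 5, 6, 7, 2, 4, 5, 6, 3, 4, 2, 5,
         4, 1, 3, 4, 5, 2, 6, 4, 7, 5, 8, 6, 7, 0, 8, 7, 6, 5, 4, 2, 3, 4, 1, 5,
         3, 6, 4, 7, 5, 2, 6, 4, 5, 3, 4, 1, 3, 2, 4, 5, 6, 7, 8, 0]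
     else if i = 5 then
         [0, 8, 7, 6, 5, 4, 2, 3, 4, 1, 3, 5, 6, 7, 8, 4, 5, 6, 7, 2, 4, 3, 5, 1,
         4, 2, 6, 3, 4, 5, 6, 7, 8, 4, 3, 1, 2, 4, 5, 3, 6, 4, 7, 5, 6, 0, 8, 7,
         6, 5, 4, 3, 2, 1, 4, 3, 5, 4, 6, 7, 8, 5, 6, 7, 2, 4, 5, 6, 3, 4, 2, 5,
         4, 1, 3, 4, 5, 2, 6, 4, 7, 5, 8, 6, 7, 0, 8, 7, 6, 5, 4, 2, 3, 4, 1, 5,
         3, 6, 4, 7, 5, 2, 6, 4, 5, 3, 4, 1, 3, 2, 4, 5, 6, 7, 8, 0]
     else if i = 6 then
         [0, 8, 7, 6, 5, 4, 3, 2, 1, 4, 3, 5, 4, 6, 7, 8, 5, 6, 7, 2, 4, 5, 6, 3,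
         4, 2, 5, 4, 1, 3, 4, 5, 2, 6, 4, 7, 5, 8, 6, 7, 0, 8, 7, 6, 5, 4, 2, 3,
         4, 1, 5, 3, 6, 4, 7, 5, 2, 6, 4, 5, 3, 4, 1, 3, 2, 4, 5, 6, 7, 8, 0]
     else if i = 7 then
         [0, 8, 7, 6, 5, 4, 2, 3, 4, 1, 5, 3, 6, 4, 7, 5, 2, 6, 4, 5, 3, 4, 1, 3,
         2, 4, 5, 6, 7, 8, 0]
     else [0])"

definition y_F4 :: "nat \<Rightarrow> nat list" where
  "y_F4 i =
    (if i = 1 then [0]
     else if i = 2 then [0, 1, 2, 3, 4, 2, 3, 2, 1, 0]
     else if i = 3 then [0, 1, 2, 3, 2, 1, 4, 3, 2, 3, 1, 2, 0, 1, 2, 3, 4, 2, 3, 2, 1, 0]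
     else [0, 1, 2, 3, 2, 1, 0])"

definition y_G2 :: "nat \<Rightarrow> nat list" where
  "y_G2 i =
    (if i = 1 then [0, 2, 1, 2, 0]
     else [0])"

fun y_word :: "series \<Rightarrow> nat \<Rightarrow> nat \<Rightarrow> nat list" where
  "y_word TypeB n i = y_B n i"
| "y_word TypeC n i = y_C i"
| "y_word TypeD n i = y_D n i"
| "y_word TypeE n i = (if n = 6 then y_E6 i else if n = 7 then y_E7 i else y_E8 i)"
| "y_word TypeF n i = y_F4 i"
| "y_word TypeG n i = y_G2 i"

end

theory Submission
  imports Defs "HOL-Library.FuncSet" "HOL-Library.Infinite_Set"
begin

text \<open>
  For a vector \<open>v\<close> of \<open>V\<close> let \<open>N v\<close> be the set of positive affine roots whose finite part pairs
  negatively with \<open>v\<close>. The minimal inversion sets of infinite reduced words are the sets \<open>N (w \<omega>\<^sub>k)\<close>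
  with \<open>w \<in> W\<close> and \<open>\<omega>\<^sub>k\<close> a fundamental coweight: every infinite inversion set contains one of them,
  and none of them properly contains another. Conversely, if \<open>y q\<close> is a translation by a negative
  multiple of \<open>\<omega>\<^sub>k\<close> with \<open>l(y q) = l(y) + l(q)\<close>, \<open>q \<in> W\<close>, and \<open>q = u v\<close> is a reduced factorisation, then
  \<open>(v y u)\<^sup>\<infinity>\<close> is reduced with inversion set \<open>N (v \<omega>\<^sub>k)\<close>, and every \<open>w \<omega>\<^sub>k\<close> is \<open>v \<omega>\<^sub>k\<close> for such a
  \<open>v\<close>. It remains to see that \<open>y\<^sub>i q\<close> is such a translation for \<open>q = w\<^sub>0\<^bsup>W\<^bsub>S - i\<^esub>\<^esup> w\<^sub>0\<close>. This holds as soon as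
  \<open>y\<^sub>i\<close> is reduced, maps the \<open>\<beta>\<^sub>j\<close> with \<open>j \<noteq> i\<close> to the simple roots of \<open>W\<close> other than \<open>\<beta>\<^sub>k\<close>, and maps
  \<open>\<beta>\<^sub>i\<close> to a root with positive \<open>\<delta>\<close>-coordinate and negative \<open>\<beta>\<^sub>k\<close>-coordinate. To check this, follow
  linear functionals through the word: it is reduced if a functional positive on the simple roots is
  positive at each letter in turn.
\<close>

section \<open>Vectors, reflections and words\<close>

text \<open>Since \<open>roots\<close> is generated inductively, finiteness, sign coherence and the
  highest root all have to be derived before positivity of affine roots can be handled.
  \<open>root_datum\<close> therefore asks only for facts about the simple roots, a dual family and
  one candidate \<open>rho\<close> that can be checked in each type. Reducedness of all prefixes of
  a periodic word comes down to one count: the number of inversions of a translation is a sum over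
  the finite roots, unchanged under conjugation by W and multiplied by p under p-th powers. So (v y
  u)^p has p times the length of the word v y u as soon as l(y q) = l(y) + l(q). A further obstacle
  is w0, for which no uniform word is available; it is avoided because the finite part of y already
  determines q. The index k is the image of i under the opposition involution -w0, which moves nodes
  in E6 and in D_n with n odd. The exceptional types are settled by evaluating integer tables, the
  classical ones by following a symbolic sequence of coordinates through the word.\<close>

lemma scl_apply: "scl c v k = c * v k"
  by (simp add: scl_def)

lemma sum_vec_apply: "(\<Sum>j\<in>A. f j :: vec) k = (\<Sum>j\<in>A. f j k)"
  by (induction A rule: infinite_finite_induct) auto

lemma delta_apply: "delta k = (if k = 0 then 1 else 0)"
  by (simp add: delta_def eps_def)

lemma eps_apply: "eps j k = (if k = j then 1 else 0)"
  by (simp add: eps_def)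

lemmas vec_apply = scl_apply sum_vec_apply plus_fun_apply zero_fun_apply minus_apply
  uminus_apply delta_apply eps_apply

text \<open>Vectors are to be treated as elements of a vector space; coordinates are unfolded only
  where \<open>vec_apply\<close> is named.\<close>

declare plus_fun_apply [simp del] zero_fun_apply [simp del] minus_apply [simp del]
  uminus_apply [simp del]

lemma scl_0 [simp]: "scl 0 v = 0" "scl c 0 = 0"
  by (auto simp: fun_eq_iff vec_apply)

lemma scl_1 [simp]: "scl 1 v = v"
  by (auto simp: fun_eq_iff vec_apply)

lemma scl_scl [simp]: "scl c (scl d v) = scl (c * d) v"
  by (auto simp: fun_eq_iff vec_apply)

lemma scl_add: "scl c (u + v) = scl c u + scl c v"
  and scl_diff: "scl c (u - v) = scl c u - scl c v"
  and scl_add_left: "scl (c + d) v = scl c v + scl d v"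
  and scl_diff_left: "scl (c - d) v = scl c v - scl d v"
  and scl_minus [simp]: "scl c (- v) = - scl c v" "scl (- c) v = - scl c v"
  by (auto simp: fun_eq_iff vec_apply algebra_simps)

lemma scl_sum: "scl c (\<Sum>j\<in>A. f j) = (\<Sum>j\<in>A. scl c (f j))"
  by (auto simp: fun_eq_iff vec_apply sum_distrib_left)

locale weyl_words =
  fixes X :: series and n :: nat
begin

abbreviation "ip \<equiv> inner_prod X n"
abbreviation "sr \<equiv> simple_root X n"
abbreviation "asr \<equiv> affine_simple_root X n"
abbreviation "elt \<equiv> word_elt X n"
abbreviation "R \<equiv> roots X n"
abbreviation "I \<equiv> {1..n}"

lemma ip_sym: "ip u v = ip v u"
  by (simp add: inner_prod_def mult.commute)

lemma ip_add_left [simp]: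
  fixes u v w :: vec
  shows "ip (u + v) w = ip u w + ip v w"
  and ip_diff_left [simp]: "ip (u - v) w = ip u w - ip v w"
  and ip_scl_left [simp]: "ip (scl c u) w = c * ip u w"
  and ip_uminus_left [simp]: "ip (- u) w = - ip u w"
  and ip_zero_left [simp]: "ip 0 w = 0"
  by (simp_all add: inner_prod_def vec_apply algebra_simps sum.distrib sum_subtractf sum_distrib_left sum_negf)

lemma ip_add_right [simp]:
  fixes u v w :: vec
  shows "ip w (u + v) = ip w u + ip w v"
  and ip_diff_right [simp]: "ip w (u - v) = ip w u - ip w v"
  and ip_scl_right [simp]: "ip w (scl c u) = c * ip w u"
  and ip_uminus_right [simp]: "ip w (- u) = - ip w u"
  and ip_zero_right [simp]: "ip w 0 = 0"
  by (simp_all add: ip_sym[of w])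

lemma ip_sum_left:
  fixes f :: "'a \<Rightarrow> vec"
  shows "ip (\<Sum>j\<in>A. f j) w = (\<Sum>j\<in>A. ip (f j) w)"
  by (induction A rule: infinite_finite_induct) auto

lemma ip_sum_right:
  fixes f :: "'a \<Rightarrow> vec"
  shows "ip w (\<Sum>j\<in>A. f j) = (\<Sum>j\<in>A. ip w (f j))"
  by (induction A rule: infinite_finite_induct) auto

lemma ip_delta [simp]: "ip delta v = 0" "ip v delta = 0"
  by (auto simp: inner_prod_def vec_apply intro!: sum.neutral)

lemma ip_add_self: "ip (u + v) (u + v) = ip u u + 2 * ip u v + ip v v"
  and ip_diff_self: "ip (u - v) (u - v) = ip u u - 2 * ip u v + ip v v" for u v :: vec
  by (simp_all add: ip_sym[of v u])

lemma ip_self_nonneg: "0 \<le> ip v v"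
  by (auto simp: inner_prod_def intro!: sum_nonneg)

lemma reflection_add:
  fixes u v :: vec
  shows "reflection X n g (u + v) = reflection X n g u + reflection X n g v"
  and reflection_scl: "reflection X n g (scl c u) = scl c (reflection X n g u)"
  by (auto simp: reflection_def fun_eq_iff vec_apply algebra_simps add_divide_distrib)

text \<open>If \<open>ip g g = 0\<close>, division by zero yields 0 and the reflection is the
  identity; hence the case split here and in the next lemma.\<close>

lemma ip_reflection: "ip (reflection X n g u) (reflection X n g v) = ip u v"
proof (cases "ip g g = 0")
  case False
  define a where "a = 2 * (ip u g / ip g g)"
  define b where "b = 2 * (ip v g / ip g g)"
  have "ip (reflection X n g u) (reflection X n g v) =
      ip u v - b * ip u g - a * ip v g + a * (b * ip g g)"
    unfolding reflection_def a_def[symmetric] b_def[symmetric]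
    by (simp add: ip_sym[of g v] right_diff_distrib)
  also have "b * ip g g = 2 * ip v g" using False by (simp add: b_def)
  also have "b * ip u g = a * ip v g" by (simp add: a_def b_def)
  finally show ?thesis by simp
qed (simp add: reflection_def)

lemma reflection_reflection [simp]: "reflection X n g (reflection X n g v) = v"
proof (cases "ip g g = 0")
  case False
  have "ip (reflection X n g v) g = - ip v g"
    using False by (simp add: reflection_def field_simps)
  then show ?thesis unfolding reflection_def[of X n g "reflection X n g v"]
    by (simp add: reflection_def)
qed (simp add: reflection_def)

lemma reflection_delta [simp]: "reflection X n g delta = delta"
  by (simp add: reflection_def)

lemma reflection_self: "ip g g \<noteq> 0 \<Longrightarrow> reflection X n g g = - g"
  by (auto simp: reflection_def fun_eq_iff vec_apply)

lemma reflection_orth: "ip v g = 0 \<Longrightarrow> reflection X n g v = v"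
  by (simp add: reflection_def)

lemma elt_Nil [simp]: "elt [] = id"
  and elt_Cons: "elt (j # xs) v = simple_refl X n j (elt xs v)"
  by (simp_all add: word_elt_def)

lemma elt_append: "elt (xs @ ys) v = elt xs (elt ys v)"
  by (induction xs) (simp_all add: elt_Cons)

lemma elt_append_comp: "elt (xs @ ys) = elt xs \<circ> elt ys"
  by (rule ext) (simp add: elt_append)

lemma simple_refl_twice [simp]: "simple_refl X n j (simple_refl X n j v) = v"
  by (simp add: simple_refl_def)

lemma elt_add:
  fixes u v :: vec
  shows "elt xs (u + v) = elt xs u + elt xs v"
  by (induction xs) (simp_all add: elt_Cons simple_refl_def reflection_add)

lemma elt_scl:
  fixes u v :: vec
  shows "elt xs (scl c v) = scl c (elt xs v)"
  by (induction xs) (simp_all add: elt_Cons simple_refl_def reflection_scl)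

lemma elt_uminus:
  fixes u v :: vec
  shows "elt xs (- v) = - elt xs v"
  using elt_scl[of xs "-1" v] by simp

lemma elt_diff:
  fixes u v :: vec
  shows "elt xs (u - v) = elt xs u - elt xs v"
  using elt_add[of xs u "- v"] by (simp add: elt_uminus)

lemma elt_zero [simp]: "elt xs 0 = 0"
  using elt_scl[of xs 0 0] by simp

lemma elt_sum:
  fixes f :: "'a \<Rightarrow> vec"
  shows "elt xs (\<Sum>j\<in>A. f j) = (\<Sum>j\<in>A. elt xs (f j))"
  by (induction A rule: infinite_finite_induct) (auto simp: elt_add)

lemma elt_delta [simp]: "elt xs delta = delta"
  by (induction xs) (simp_all add: elt_Cons simple_refl_def)

lemma ip_elt: "ip (elt xs u) (elt xs v) = ip u v"
  by (induction xs) (simp_all add: elt_Cons simple_refl_def ip_reflection)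

lemma elt_rev [simp]: "elt (rev xs) (elt xs v) = v"
  by (induction xs arbitrary: v) (simp_all add: elt_append elt_Cons)

lemma elt_rev' [simp]: "elt xs (elt (rev xs) v) = v"
  using elt_rev[of "rev xs" v] by simp

lemma ip_elt_left: "ip (elt xs u) v = ip u (elt (rev xs) v)"
  using ip_elt[of xs u "elt (rev xs) v"] by simp

lemma inv_elt: "inv (elt xs) = elt (rev xs)"
  by (rule inv_equality) auto

lemma elt_eq_iff [simp]: "elt xs u = elt xs v \<longleftrightarrow> u = v"
  by (metis elt_rev)

text \<open>The conjugation rule w s_g = s_(w g) w. It turns reflections in arbitrary roots into
  words and drives the deletion argument.\<close>

lemma elt_reflection: "elt xs (reflection X n g v) = reflection X n (elt xs g) (elt xs v)"
  by (simp add: reflection_def elt_diff elt_scl ip_elt)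

lemma simple_refl_finite: "j \<in> I \<Longrightarrow> simple_refl X n j = reflection X n (sr j)"
  by (auto simp: simple_refl_def affine_simple_root_def)

lemma elt_root: "set xs \<subseteq> I \<Longrightarrow> \<alpha> \<in> R \<Longrightarrow> elt xs \<alpha> \<in> R"
  by (induction xs) (auto simp: elt_Cons simple_refl_finite intro: roots.reflect)

text \<open>Properties invariant under W thus pass from simple roots to all roots.\<close>

lemma root_elt_simple:
  assumes "\<alpha> \<in> R"
  obtains w j where "set w \<subseteq> I" "j \<in> I" "\<alpha> = elt w (sr j)"
proof -
  have "\<exists>w j. set w \<subseteq> I \<and> j \<in> I \<and> \<alpha> = elt w (sr j)"
    using assms
  proof induction
    case (simple j)
    then show ?case by (intro exI[of _ "[]"]) auto
  next
    case (reflect \<alpha> j)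
    then obtain w k where "set w \<subseteq> I" "k \<in> I" "\<alpha> = elt w (sr k)" by blast
    with reflect show ?case
      by (intro exI[of _ "j # w"] exI[of _ k]) (auto simp: elt_Cons simple_refl_finite)
  qed
  then show ?thesis using that by blast
qed

end

section \<open>Finite root systems\<close>

text \<open>\<open>om\<close> is dual to the simple roots, \<open>s\<close> is the short squared
  length and \<open>r\<close> the ratio of long to short. \<open>rho\<close> is only a candidate for
  the highest root: a dominant long root. Irreducibility enters through \<open>rho_full\<close>,
  which says that \<open>rho\<close> involves every simple root.\<close>

locale root_datum = weyl_words X n for X :: series and n :: nat +
  fixes om :: "nat \<Rightarrow> vec" and rho :: vec and s :: real and r :: nat
  assumes n_pos: "1 \<le> n"
    and sr_support: "\<And>j k. j \<in> I \<Longrightarrow> k \<notin> {1..ambient_dim X n} \<Longrightarrow> sr j k = 0"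
    and sr_om: "\<And>i j. i \<in> I \<Longrightarrow> j \<in> I \<Longrightarrow> ip (sr i) (om j) = (if i = j then 1 else 0)"
    and cartan_int: "\<And>i j. i \<in> I \<Longrightarrow> j \<in> I \<Longrightarrow> \<exists>z::int. 2 * ip (sr i) (sr j) = z * ip (sr j) (sr j)"
    and obtuse: "\<And>i j. i \<in> I \<Longrightarrow> j \<in> I \<Longrightarrow> i \<noteq> j \<Longrightarrow> ip (sr i) (sr j) \<le> 0"
    and norm_sr: "\<And>j. j \<in> I \<Longrightarrow> ip (sr j) (sr j) \<in> {s, r * s}"
    and s_pos: "s > 0" and r_range: "r \<in> {1, 2, 3}"
    and rho_root: "rho \<in> roots X n"
    and rho_dominant: "\<And>j. j \<in> I \<Longrightarrow> 0 \<le> ip rho (sr j)"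
    and rho_long: "ip rho rho = r * s"
    and rho_full: "\<And>j. j \<in> I \<Longrightarrow> 0 < ip rho (om j)"
begin

text \<open>On the span of the simple roots this is the coefficient of \<open>sr j\<close>. It does
  not see \<open>delta\<close>, so it also reads the finite part of an affine root.\<close>

abbreviation "cf j v \<equiv> ip v (om j)"

definition comb :: "(nat \<Rightarrow> real) \<Rightarrow> vec" where
  "comb c = (\<Sum>j\<in>I. scl (c j) (sr j))"

lemma comb_cong: "(\<And>j. j \<in> I \<Longrightarrow> c j = d j) \<Longrightarrow> comb c = comb d"
  by (auto simp: comb_def intro: sum.cong)

lemma comb_add: "comb c + comb d = comb (\<lambda>j. c j + d j)"
  and comb_diff: "comb c - comb d = comb (\<lambda>j. c j - d j)"
  and comb_scl: "scl e (comb c) = comb (\<lambda>j. e * c j)"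
  by (simp_all add: comb_def scl_add_left scl_diff_left sum.distrib sum_subtractf scl_sum)

lemma comb_uminus: "- comb c = comb (\<lambda>j. - c j)"
  using comb_scl[of "-1" c] by simp

lemma comb_0: "(\<And>j. j \<in> I \<Longrightarrow> c j = 0) \<Longrightarrow> comb c = 0"
  by (auto simp: comb_def)

lemma comb_single: "j \<in> I \<Longrightarrow> comb (\<lambda>k. if k = j then e else 0) = scl e (sr j)"
proof -
  assume j: "j \<in> I"
  have "comb (\<lambda>k. if k = j then e else 0) = (\<Sum>k\<in>I. if k = j then scl e (sr j) else 0)"
    unfolding comb_def by (rule sum.cong) auto
  then show ?thesis using j by simp
qed

lemma cf_comb: "j \<in> I \<Longrightarrow> cf j (comb c) = c j"
proof -
  assume j: "j \<in> I"
  have "cf j (comb c) = (\<Sum>i\<in>I. if i = j then c j else 0)"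
    unfolding comb_def ip_sum_left
  proof (rule sum.cong)
    fix i assume "i \<in> I"
    then show "ip (scl (c i) (sr i)) (om j) = (if i = j then c j else 0)"
      using sr_om[OF _ j, of i] by simp
  qed simp
  then show ?thesis using j by simp
qed

lemma ip_comb: "ip (comb c) v = (\<Sum>j\<in>I. c j * ip (sr j) v)"
  by (simp add: comb_def ip_sum_left)

definition spn :: "vec set" where "spn = range comb"

lemma spn_expand: "v \<in> spn \<Longrightarrow> v = comb (\<lambda>j. cf j v)"
  by (auto simp: spn_def cf_comb intro!: comb_cong)

lemma comb_in_spn [simp]: "comb c \<in> spn"
  by (simp add: spn_def)

lemma spn_eqI: "u \<in> spn \<Longrightarrow> v \<in> spn \<Longrightarrow> (\<And>j. j \<in> I \<Longrightarrow> cf j u = cf j v) \<Longrightarrow> u = v"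
  by (metis (no_types, lifting) comb_cong spn_expand)

lemma sr_in_spn: "j \<in> I \<Longrightarrow> sr j \<in> spn"
  using comb_single[of j 1] by (metis comb_in_spn scl_1)

lemma spn_add:
  fixes u v :: vec
  shows "u \<in> spn \<Longrightarrow> v \<in> spn \<Longrightarrow> u + v \<in> spn"
  and spn_diff: "u \<in> spn \<Longrightarrow> v \<in> spn \<Longrightarrow> u - v \<in> spn"
  and spn_scl: "u \<in> spn \<Longrightarrow> scl e u \<in> spn"
  and spn_uminus: "u \<in> spn \<Longrightarrow> - u \<in> spn"
  by (auto simp: spn_def comb_add comb_diff comb_scl comb_uminus)

lemma spn_support: "v \<in> spn \<Longrightarrow> k \<notin> {1..ambient_dim X n} \<Longrightarrow> v k = 0"
  by (auto simp: spn_def comb_def sr_support vec_apply simp del: atLeastAtMost_iff)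

lemma spn_apply_0 [simp]: "v \<in> spn \<Longrightarrow> v 0 = 0"
  by (rule spn_support) auto

lemma spn_norm_0: "v \<in> spn \<Longrightarrow> ip v v = 0 \<Longrightarrow> v = 0"
proof
  fix k assume v: "v \<in> spn" "ip v v = 0"
  have "\<forall>k\<in>{1..ambient_dim X n}. v k * v k = 0"
    using v(2) unfolding inner_prod_def by (subst (asm) sum_nonneg_eq_0_iff) auto
  then show "v k = 0 k" using spn_support[OF v(1), of k] by (auto simp: vec_apply)
qed

lemma spn_norm_pos: "v \<in> spn \<Longrightarrow> v \<noteq> 0 \<Longrightarrow> 0 < ip v v"
  using spn_norm_0 ip_self_nonneg[of v] by fastforce

lemma r_pos: "1 \<le> r" and rs_ge: "s \<le> r * s"
  using r_range s_pos by auto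

lemma norm_sr_pos: "j \<in> I \<Longrightarrow> 0 < ip (sr j) (sr j)"
  using norm_sr[of j] s_pos r_pos by auto

lemma reflection_sr: "reflection X n (sr j) v = v - scl (2 * ip v (sr j) / ip (sr j) (sr j)) (sr j)"
  by (simp add: reflection_def)

lemma cf_reflection_sr:
  assumes "j \<in> I" "k \<in> I"
  shows "cf k (reflection X n (sr j) v) =
    cf k v - (if k = j then 2 * ip v (sr j) / ip (sr j) (sr j) else 0)"
  using assms by (simp add: reflection_sr sr_om)

lemma root_in_spn: "\<alpha> \<in> R \<Longrightarrow> \<alpha> \<in> spn"
proof (induction rule: roots.induct)
  case (reflect \<alpha> j)
  then show ?case unfolding reflection_sr by (blast intro: sr_in_spn spn_diff spn_scl)
qed (rule sr_in_spn)

lemma root_expand: "\<alpha> \<in> R \<Longrightarrow> \<alpha> = comb (\<lambda>j. cf j \<alpha>)"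
  using root_in_spn spn_expand by blast

lemma cartan_Ints: "i \<in> I \<Longrightarrow> j \<in> I \<Longrightarrow> 2 * ip (sr i) (sr j) / ip (sr j) (sr j) \<in> \<int>"
  using cartan_int[of i j] norm_sr_pos[of j] by auto

lemma root_cartan_Ints_aux:
  assumes "v \<in> spn" "\<And>k. k \<in> I \<Longrightarrow> cf k v \<in> \<int>" "j \<in> I"
  shows "2 * ip v (sr j) / ip (sr j) (sr j) \<in> \<int>"
proof -
  have "2 * ip v (sr j) / ip (sr j) (sr j) =
      (\<Sum>k\<in>I. cf k v * (2 * ip (sr k) (sr j) / ip (sr j) (sr j)))"
    by (subst spn_expand[OF assms(1)], subst ip_comb)
      (simp add: sum_distrib_left sum_divide_distrib mult_ac)
  also have "\<dots> \<in> \<int>" using assms cartan_Ints by (intro Ints_sum Ints_mult) auto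
  finally show ?thesis .
qed

lemma root_cf_Ints: "\<alpha> \<in> R \<Longrightarrow> k \<in> I \<Longrightarrow> cf k \<alpha> \<in> \<int>"
proof (induction arbitrary: k rule: roots.induct)
  case (simple j)
  then show ?case by (simp add: sr_om)
next
  case (reflect \<alpha> j)
  then show ?case
    using root_cartan_Ints_aux[OF root_in_spn[OF reflect(1)], of j]
    by (simp add: cf_reflection_sr)
qed

lemma root_cartan_sr_Ints: "\<alpha> \<in> R \<Longrightarrow> j \<in> I \<Longrightarrow> 2 * ip \<alpha> (sr j) / ip (sr j) (sr j) \<in> \<int>"
  by (rule root_cartan_Ints_aux) (auto simp: root_in_spn root_cf_Ints)

lemma root_norm: "\<alpha> \<in> R \<Longrightarrow> ip \<alpha> \<alpha> \<in> {s, r * s}"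
  by (induction rule: roots.induct) (use norm_sr in \<open>simp_all add: ip_reflection\<close>)

lemma root_norm_pos: "\<alpha> \<in> R \<Longrightarrow> 0 < ip \<alpha> \<alpha>"
  and root_norm_le: "\<alpha> \<in> R \<Longrightarrow> ip \<alpha> \<alpha> \<le> r * s"
  using root_norm[of \<alpha>] s_pos r_pos rs_ge by auto

lemma root_nonzero: "\<alpha> \<in> R \<Longrightarrow> \<alpha> \<noteq> 0"
  using root_norm_pos by force

lemma root_uminus: "\<alpha> \<in> R \<Longrightarrow> - \<alpha> \<in> R"
proof -
  assume "\<alpha> \<in> R"
  then obtain w j where w: "set w \<subseteq> I" "j \<in> I" "\<alpha> = elt w (sr j)" by (rule root_elt_simple)
  have "reflection X n (sr j) (sr j) \<in> R" using w by (intro roots.reflect roots.simple)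
  then have "- sr j \<in> R" using norm_sr_pos[OF w(2)] by (simp add: reflection_self)
  then show ?thesis using elt_root[OF w(1)] w(3) by (metis elt_uminus)
qed

lemma root_uminus_iff [simp]: "- \<alpha> \<in> R \<longleftrightarrow> \<alpha> \<in> R"
  using root_uminus by (metis minus_minus)

lemma root_reflection_word:
  assumes "\<alpha> \<in> R"
  obtains w where "set w \<subseteq> I" "elt w = reflection X n \<alpha>"
proof -
  obtain w j where w: "set w \<subseteq> I" "j \<in> I" "\<alpha> = elt w (sr j)" using assms by (rule root_elt_simple)
  have "elt (w @ [j] @ rev w) v = reflection X n \<alpha> v" for v
    using w by (simp add: elt_append elt_Cons simple_refl_finite[OF w(2)] elt_reflection)
  then show ?thesis using w by (intro that[of "w @ [j] @ rev w"]) auto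
qed

lemma root_reflection: "\<alpha> \<in> R \<Longrightarrow> \<beta> \<in> R \<Longrightarrow> reflection X n \<alpha> \<beta> \<in> R"
  by (metis elt_root root_reflection_word)

lemma root_cartan_Ints: "\<alpha> \<in> R \<Longrightarrow> \<beta> \<in> R \<Longrightarrow> 2 * ip \<alpha> \<beta> / ip \<beta> \<beta> \<in> \<int>"
proof -
  assume R: "\<alpha> \<in> R" "\<beta> \<in> R"
  obtain w j where w: "set w \<subseteq> I" "j \<in> I" "\<beta> = elt w (sr j)" using R(2) by (rule root_elt_simple)
  have "elt (rev w) \<alpha> \<in> R" using w R by (intro elt_root) auto
  from root_cartan_sr_Ints[OF this w(2)] show ?thesis
    by (simp add: w(3) ip_elt ip_elt_left)
qed

subsection \<open>Sign coherence\<close>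

text \<open>Products of distinct generators occur twice in the norm of a combination, so integrality
  is needed only for their doubles.\<close>

lemma lattice_norm:
  assumes b: "\<And>i. i \<in> I \<Longrightarrow> \<exists>z::int. ip (b i) (b i) = z * t"
    and bb: "\<And>i j. i \<in> I \<Longrightarrow> j \<in> I \<Longrightarrow> \<exists>z::int. 2 * ip (b i) (b j) = z * t"
    and F: "finite F" "F \<subseteq> I"
  shows "\<exists>z::int. ip (\<Sum>j\<in>F. scl (real_of_int (c j)) (b j)) (\<Sum>j\<in>F. scl (real_of_int (c j)) (b j)) = z * t"
  using F
proof (induction F rule: finite_induct)
  case empty
  then show ?case by (intro exI[of _ 0]) auto
next
  case (insert x F)
  let ?v = "\<Sum>j\<in>F. scl (real_of_int (c j)) (b j)"
  obtain z1 :: int where z1: "ip ?v ?v = z1 * t" using insert by auto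
  obtain z2 :: int where z2: "ip (b x) (b x) = z2 * t" using b insert by blast
  obtain z3 where z3: "\<forall>j\<in>F. 2 * ip (b x) (b j) = of_int (z3 j :: int) * t"
    using bb insert.prems by (metis (no_types, opaque_lifting) insert_subset subset_iff)
  have "2 * ip (b x) ?v = (\<Sum>j\<in>F. c j * (2 * ip (b x) (b j)))"
    by (simp add: ip_sum_right sum_distrib_left mult_ac)
  also have "\<dots> = (\<Sum>j\<in>F. c j * (of_int (z3 j) * t))"
    using z3 by (intro sum.cong) auto
  also have "\<dots> = of_int (\<Sum>j\<in>F. c j * z3 j) * t"
    by (simp add: sum_distrib_right sum_distrib_left mult_ac)
  finally have z4: "2 * ip (b x) ?v = of_int (\<Sum>j\<in>F. c j * z3 j) * t" .
  have "ip (scl (c x) (b x) + ?v) (scl (c x) (b x) + ?v) =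
      c x * c x * ip (b x) (b x) + c x * (2 * ip (b x) ?v) + ip ?v ?v"
    unfolding ip_add_self by (simp add: mult.assoc)
  also have "\<dots> = of_int (c x * c x * z2 + c x * (\<Sum>j\<in>F. c j * z3 j) + z1) * t"
    unfolding z1 z2 z4 by (simp add: algebra_simps)
  finally show ?case unfolding sum.insert[OF insert(1,2)] by blast
qed

text \<open>Split \<open>v = p - q\<close> into its positive and negative part. Both lie in the lattice spanned by
  the \<open>e\<^sub>j \<beta>\<^sub>j\<close> and \<open>(p, q) \<le> 0\<close>, so \<open>(v, v) \<ge> (p, p) + (q, q)\<close>, which is too large if neither
  vanishes, since \<open>t\<close> is the minimal norm of the lattice.\<close>

lemma sign_coherence_aux:
  assumes e: "\<And>i. i \<in> I \<Longrightarrow> 0 < e i" and t: "0 < t"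
    and b: "\<And>i. i \<in> I \<Longrightarrow> \<exists>z::int. ip (scl (e i) (sr i)) (scl (e i) (sr i)) = z * t"
    and bb: "\<And>i j. i \<in> I \<Longrightarrow> j \<in> I \<Longrightarrow> \<exists>z::int. 2 * ip (scl (e i) (sr i)) (scl (e j) (sr j)) = z * t"
    and v: "v = comb (\<lambda>j. real_of_int (c j) * e j)" "ip v v = t"
  shows "(\<forall>j\<in>I. 0 \<le> cf j v) \<or> (\<forall>j\<in>I. cf j v \<le> 0)"
proof -
  define p where "p = comb (\<lambda>j. real_of_int (max (c j) 0) * e j)"
  define q where "q = comb (\<lambda>j. real_of_int (max (- c j) 0) * e j)"
  have lat: "\<exists>z::int. ip (comb (\<lambda>j. real_of_int (d j) * e j)) (comb (\<lambda>j. real_of_int (d j) * e j)) = z * t"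
    for d :: "nat \<Rightarrow> int"
    using lattice_norm[of "\<lambda>i. scl (e i) (sr i)" t I d, OF b bb finite_atLeastAtMost subset_refl]
    by (simp add: comb_def)
  have big: "x = 0 \<or> t \<le> ip x x" if xd: "x = comb (\<lambda>j. real_of_int (d j) * e j)" for d :: "nat \<Rightarrow> int" and x
  proof -
    obtain z :: int where z: "ip x x = z * t" using lat[of d] unfolding xd by blast
    show ?thesis
    proof (cases "x = 0")
      case False
      have "x \<in> spn" using xd by simp
      then have "0 < ip x x" using False by (simp add: spn_norm_pos)
      then have "0 < z" using z t by (simp add: zero_less_mult_iff)
      then have "1 * t \<le> z * t" using t by (intro mult_right_mono) auto
      then show ?thesis using z by simp
    qed simp
  qed
  have pq: "v = p - q"
    unfolding v p_def q_def comb_diff by (intro comb_cong) (auto simp: max_def algebra_simps)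
  \<comment> \<open>Terms with i = j vanish because one of the two \<open>max\<close> factors is
    zero; all others are nonpositive by obtuseness.\<close>
  have "ip p q = (\<Sum>i\<in>I. \<Sum>j\<in>I. (real_of_int (max (c i) 0) * e i) * (real_of_int (max (- c j) 0) * e j) * ip (sr i) (sr j))"
    unfolding p_def ip_comb q_def
    by (simp add: comb_def ip_sum_right sum_distrib_left mult_ac)
  also have "\<dots> \<le> 0"
  proof (intro sum_nonpos)
    fix i j assume ij: "i \<in> I" "j \<in> I"
    show "(real_of_int (max (c i) 0) * e i) * (real_of_int (max (- c j) 0) * e j) * ip (sr i) (sr j) \<le> 0"
    proof (cases "i = j")
      case True
      then show ?thesis by (auto simp: max_def)
    next
      case False
      then show ?thesis using obtuse[OF ij False] e[OF ij(1)] e[OF ij(2)]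
        by (intro mult_nonneg_nonpos mult_nonneg_nonneg) auto
    qed
  qed
  finally have "ip p q \<le> 0" .
  then have "ip p p + ip q q \<le> t"
    using v(2) unfolding pq ip_diff_self by simp
  then have "p = 0 \<or> q = 0"
    using big[OF p_def] big[OF q_def] t by linarith
  then show ?thesis
  proof
    assume "p = 0"
    then have "\<forall>j\<in>I. real_of_int (max (c j) 0) * e j = 0"
      using cf_comb[of _ "\<lambda>j. real_of_int (max (c j) 0) * e j"] unfolding p_def by (metis ip_zero_left)
    then have "\<forall>j\<in>I. c j \<le> 0" using e by (fastforce simp: max_def split: if_splits)
    then show ?thesis using e by (auto simp: v cf_comb mult_nonpos_nonneg less_imp_le)
  next
    assume "q = 0"
    then have "\<forall>j\<in>I. real_of_int (max (- c j) 0) * e j = 0"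
      using cf_comb[of _ "\<lambda>j. real_of_int (max (- c j) 0) * e j"] unfolding q_def by (metis ip_zero_left)
    then have "\<forall>j\<in>I. c j \<ge> 0" using e by (fastforce simp: max_def split: if_splits)
    then show ?thesis using e by (auto simp: v cf_comb less_imp_le)
  qed
qed

text \<open>The long roots span the lattice of multiples of the coroots, where they are shortest.\<close>

lemma long_root_lattice:
  assumes "\<alpha> \<in> R" "ip \<alpha> \<alpha> = r * s"
  shows "\<exists>c. \<alpha> = comb (\<lambda>j. real_of_int (c j) * (r * s / ip (sr j) (sr j)))"
  using assms
proof (induction rule: roots.induct)
  case (simple j)
  have "sr j = comb (\<lambda>k. if k = j then 1 else 0)" using simple comb_single[of j 1] by simp
  also have "\<dots> = comb (\<lambda>k. real_of_int (if k = j then 1 else 0) * (r * s / ip (sr k) (sr k)))"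
    using simple norm_sr_pos[of j] by (intro comb_cong) auto
  finally show ?case by (rule exI[where x = "\<lambda>k. if k = j then 1 else 0"])
next
  case (reflect \<alpha> j)
  \<comment> \<open>\<open>e j\<close> times \<open>sr j\<close> is r s / 2 times the coroot of
    \<open>sr j\<close>.\<close>
  define e where "e j = r * s / ip (sr j) (sr j)" for j
  obtain c where c: "\<alpha> = comb (\<lambda>j. real_of_int (c j) * e j)"
    using reflect by (auto simp: ip_reflection e_def)
  have rs: "r * s > 0" using r_pos s_pos by simp
  obtain z where z: "\<forall>k\<in>I. 2 * ip (sr j) (sr k) = of_int (z k :: int) * ip (sr k) (sr k)"
    using cartan_int[OF reflect(2)] by metis
  have "2 * ip \<alpha> (sr j) / (r * s) = (\<Sum>k\<in>I. of_int (c k) * (e k * (2 * ip (sr k) (sr j)) / (r * s)))"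
    by (simp add: c ip_comb sum_distrib_left sum_divide_distrib mult_ac)
  also have "\<dots> = (\<Sum>k\<in>I. of_int (c k * z k))"
  proof (rule sum.cong)
    fix k assume k: "k \<in> I"
    then have "2 * ip (sr k) (sr j) = of_int (z k) * ip (sr k) (sr k)" using z[rule_format, OF k]
      by (simp add: ip_sym[of "sr j" "sr k"])
    then show "of_int (c k) * (e k * (2 * ip (sr k) (sr j)) / (r * s)) = of_int (c k * z k)"
      using rs norm_sr_pos[OF k] s_pos r_pos by (simp add: e_def)
  qed simp
  also have "\<dots> = of_int (\<Sum>k\<in>I. c k * z k)" by simp
  finally have q: "2 * ip \<alpha> (sr j) / (r * s) = of_int (\<Sum>k\<in>I. c k * z k)" .
  define q where "q = (\<Sum>k\<in>I. c k * z k)"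
  have "2 * ip \<alpha> (sr j) / ip (sr j) (sr j) = of_int q * e j"
  proof -
    have "2 * ip \<alpha> (sr j) = real_of_int q * (r * s)"
      using q s_pos r_pos by (simp add: q_def divide_eq_eq split: if_splits)
    then show ?thesis by (simp add: e_def)
  qed
  then have "reflection X n (sr j) \<alpha> = \<alpha> - scl (of_int q * e j) (sr j)"
    by (simp add: reflection_sr)
  also have "\<dots> = comb (\<lambda>k. real_of_int (c k - (if k = j then q else 0)) * e k)"
    unfolding c comb_single[OF reflect(2), symmetric] comb_diff
    by (intro comb_cong) (auto simp: algebra_simps)
  finally show ?case unfolding e_def
    by (rule exI[where x = "\<lambda>k. c k - (if k = j then q else 0)"])
qed

text \<open>The argument needs the norm of the root to generate the norms of a lattice containing
  it. Short roots satisfy this in the root lattice with \<open>s\<close>; long roots need the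
  sublattice of the rescaled simple roots, whose norms are multiples of
  \<open>r * s\<close>.\<close>

lemma root_sign:
  assumes "\<alpha> \<in> R"
  shows "(\<forall>j\<in>I. 0 \<le> cf j \<alpha>) \<or> (\<forall>j\<in>I. cf j \<alpha> \<le> 0)"
proof -
  have n1: "\<exists>z::int. ip (sr i) (sr i) = z * s" if "i \<in> I" for i
    using norm_sr[OF that] by (auto intro: exI[of _ 1] exI[of _ "int r"])
  consider "ip \<alpha> \<alpha> = s" | "ip \<alpha> \<alpha> = r * s" using root_norm[OF assms] by auto
  then show ?thesis
  proof cases
    case 1
    define c where "c j = \<lfloor>cf j \<alpha>\<rfloor>" for j
    have c: "\<forall>j\<in>I. cf j \<alpha> = of_int (c j)"
      using root_cf_Ints[OF assms] by (auto simp: c_def elim!: Ints_cases)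
    show ?thesis
    proof (rule sign_coherence_aux[where e = "\<lambda>_. 1" and t = s and c = c])
      fix i j assume ij: "i \<in> I" "j \<in> I"
      obtain z1 :: int where z1: "2 * ip (sr i) (sr j) = z1 * ip (sr j) (sr j)"
        using cartan_int[OF ij] by blast
      obtain z2 :: int where z2: "ip (sr j) (sr j) = z2 * s" using n1[OF ij(2)] by blast
      show "\<exists>z::int. 2 * ip (scl 1 (sr i)) (scl 1 (sr j)) = z * s"
        using z1 z2 by (intro exI[of _ "z1 * z2"]) simp
    next
      show "\<alpha> = comb (\<lambda>j. real_of_int (c j) * 1)"
        by (subst root_expand[OF assms], rule comb_cong) (use c in simp)
    qed (use n1 s_pos 1 in auto)
  next
    case 2
    define e where "e j = r * s / ip (sr j) (sr j)" for j
    have rs: "r * s > 0" using r_pos s_pos by simp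
    have e_int: "\<exists>z::int. e i = z" if "i \<in> I" for i
      using norm_sr[OF that] s_pos r_pos by (auto simp: e_def intro: exI[of _ "int r"] exI[of _ 1])
    obtain c where c: "\<alpha> = comb (\<lambda>j. real_of_int (c j) * e j)"
      using long_root_lattice[OF assms 2] by (auto simp: e_def)
    show ?thesis
    proof (rule sign_coherence_aux[where e = e and t = "r * s" and c = c])
      fix i assume i: "i \<in> I"
      then show "0 < e i" using rs norm_sr_pos[OF i] by (simp add: e_def)
      obtain z :: int where "e i = z" using e_int[OF i] by blast
      moreover have "ip (scl (e i) (sr i)) (scl (e i) (sr i)) = e i * (r * s)"
        using norm_sr_pos[OF i] by (simp add: e_def)
      ultimately show "\<exists>z::int. ip (scl (e i) (sr i)) (scl (e i) (sr i)) = z * (r * s)" by auto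
      fix j assume j: "j \<in> I"
      obtain z :: int where "e i = z" using e_int[OF i] by blast
      moreover obtain z1 :: int where z1: "2 * ip (sr i) (sr j) = z1 * ip (sr j) (sr j)"
        using cartan_int[OF i j] by blast
      moreover have "2 * ip (scl (e i) (sr i)) (scl (e j) (sr j)) = e i * (e j * (2 * ip (sr i) (sr j)))"
        by simp
      moreover have "e j * (z1 * ip (sr j) (sr j)) = z1 * (r * s)"
        using norm_sr_pos[OF j] by (simp add: e_def)
      ultimately show "\<exists>z::int. 2 * ip (scl (e i) (sr i)) (scl (e j) (sr j)) = z * (r * s)"
        by (intro exI[of _ "z * z1"]) auto
    qed (use rs 2 c in auto)
  qed
qed

text \<open>Bounded norm bounds the coordinates, hence the coefficients \<open>cf j\<close>, which
  are integers: the roots embed into a finite box of coefficient vectors.\<close>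

lemma finite_roots: "finite R"
proof -
  define M where "M = (\<Sum>j\<in>I. \<Sum>k = 1..ambient_dim X n. (1 + r * s) * \<bar>om j k\<bar>)"
  define C where "C = (\<lambda>c. comb (\<lambda>j. real_of_int (c j)))"
  have "R \<subseteq> C ` (PiE I (\<lambda>_. {-\<lceil>M\<rceil>..\<lceil>M\<rceil>}))"
  proof
    fix \<alpha> assume a: "\<alpha> \<in> R"
    \<comment> \<open>A crude bound avoiding square roots: a nonnegative real is at most 1 or at
      most its square.\<close>
    have coord: "\<bar>\<alpha> k\<bar> \<le> 1 + r * s" if "k \<in> {1..ambient_dim X n}" for k
    proof -
      have "\<alpha> k * \<alpha> k \<le> ip \<alpha> \<alpha>" unfolding inner_prod_def
        by (rule member_le_sum[where f = "\<lambda>k. \<alpha> k * \<alpha> k", OF that]) auto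
      also have "\<dots> \<le> r * s" using root_norm_le[OF a] .
      finally have "\<bar>\<alpha> k\<bar> ^ 2 \<le> r * s" by (simp add: power2_eq_square)
      moreover have "\<bar>\<alpha> k\<bar> \<le> 1 \<or> \<bar>\<alpha> k\<bar> \<le> \<bar>\<alpha> k\<bar> ^ 2"
        by (metis linorder_le_cases self_le_power zero_less_numeral)
      moreover have "0 \<le> r * s" using s_pos by simp
      ultimately show ?thesis by linarith
    qed
    have bound: "\<bar>cf j \<alpha>\<bar> \<le> M" if j: "j \<in> I" for j
    proof -
      have "\<bar>cf j \<alpha>\<bar> \<le> (\<Sum>k = 1..ambient_dim X n. \<bar>\<alpha> k * om j k\<bar>)"
        unfolding inner_prod_def by (rule sum_abs)
      also have "\<dots> \<le> (\<Sum>k = 1..ambient_dim X n. (1 + r * s) * \<bar>om j k\<bar>)"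
        by (intro sum_mono) (auto simp: abs_mult intro!: mult_right_mono coord)
      also have "\<dots> \<le> M" unfolding M_def
        using s_pos by (intro member_le_sum[where f = "\<lambda>j. \<Sum>k = 1..ambient_dim X n. (1 + r * s) * \<bar>om j k\<bar>", OF j]
          sum_nonneg mult_nonneg_nonneg) auto
      finally show ?thesis .
    qed
    define c where "c j = \<lfloor>cf j \<alpha>\<rfloor>" for j
    have c: "\<forall>j\<in>I. cf j \<alpha> = of_int (c j)"
      using root_cf_Ints[OF a] by (auto simp: c_def elim!: Ints_cases)
    have "\<alpha> = C (restrict c I)"
      unfolding C_def by (subst root_expand[OF a]) (auto intro!: comb_cong simp: c)
    moreover have "restrict c I \<in> PiE I (\<lambda>_. {-\<lceil>M\<rceil>..\<lceil>M\<rceil>})"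
    proof (intro PiE_I)
      fix j assume j: "j \<in> I"
      then have "\<bar>real_of_int (c j)\<bar> \<le> M" using bound c by metis
      then have "\<bar>c j\<bar> \<le> \<lceil>M\<rceil>" by linarith
      then show "restrict c I j \<in> {-\<lceil>M\<rceil>..\<lceil>M\<rceil>}" using j by auto
    qed auto
    ultimately show "\<alpha> \<in> C ` (PiE I (\<lambda>_. {-\<lceil>M\<rceil>..\<lceil>M\<rceil>}))" by blast
  qed
  then show ?thesis by (rule finite_subset) (intro finite_imageI finite_PiE; simp)
qed

text \<open>The factor is a nonnegative integer. A factor of at least 2 would give norm at least 4
  s, above the largest norm, which is at most 3 s.\<close>

lemma root_multiple_simple:
  assumes "\<alpha> \<in> R" "\<alpha> = scl c (sr j)" "j \<in> I" "0 \<le> c"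
  shows "c = 1"
proof -
  obtain z :: int where z: "c = z"
    using root_cf_Ints[OF assms(1,3)] assms(2,3) by (auto simp: sr_om Ints_def)
  have N: "c * c * ip (sr j) (sr j) \<in> {s, r * s}"
    using root_norm[OF assms(1)] by (simp add: assms(2) mult.assoc)
  have "c \<noteq> 0" using root_nonzero[OF assms(1)] assms(2) by auto
  then have z1: "z \<ge> 1" using assms(4) z by simp
  have "c = 1" if "z \<noteq> 1"
  proof -
    have "z \<ge> 2" using that z1 by simp
    then have "z * z \<ge> 2 * 2" by (intro mult_mono) auto
    then have "real_of_int (z * z) \<ge> 4" by (metis of_int_le_iff of_int_numeral mult_2 numeral_Bit0)
    then have "c * c \<ge> 4" using z by simp
    then have "c * c * ip (sr j) (sr j) \<ge> 4 * ip (sr j) (sr j)"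
      using norm_sr_pos[OF assms(3)] by (intro mult_right_mono) auto
    moreover have "ip (sr j) (sr j) \<ge> s" using norm_sr[OF assms(3)] rs_ge by auto
    ultimately have "c * c * ip (sr j) (sr j) \<ge> 4 * s" by linarith
    moreover have "real r \<le> 3" using r_range by auto
    then have "r * s \<le> 3 * s" using s_pos by (intro mult_right_mono) auto
    ultimately show ?thesis using N s_pos by auto
  qed
  then show ?thesis using z by auto
qed

subsection \<open>The highest root\<close>

text \<open>Fullness of \<open>rho\<close> gives a positive product with \<beta>. Since
  \<open>rho\<close> is long, positivity of the norm of rho - \<beta> forces the integer 2 (\<beta>,
  rho) / (rho, rho) to be 1, so \<beta> - rho is a root and has a sign. Were it positive, dominance
  of \<open>rho\<close> would make \<beta> longer than \<open>rho\<close>.\<close>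

lemma dominant_root_le_rho:
  assumes b: "\<beta> \<in> R" and dom: "\<And>j. j \<in> I \<Longrightarrow> 0 \<le> ip \<beta> (sr j)" and "j \<in> I"
  shows "cf j \<beta> \<le> cf j rho"
proof (cases "\<beta> = rho")
  case False
  have rs: "r * s > 0" using r_pos s_pos by simp
  have "\<exists>j\<in>I. 0 < ip \<beta> (sr j)"
  proof (rule ccontr)
    assume "\<not> ?thesis"
    then have "\<forall>j\<in>I. ip (sr j) \<beta> = 0" using dom by (force simp: ip_sym[of _ \<beta>])
    then have "ip \<beta> \<beta> = 0" by (subst (1) root_expand[OF b]) (simp add: ip_comb)
    then show False using root_norm_pos[OF b] by simp
  qed
  then have "0 < (\<Sum>j\<in>I. cf j rho * ip (sr j) \<beta>)"
    using dom rho_full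
    by (auto intro!: sum_pos2 simp: ip_sym[of _ \<beta>] less_imp_le simp del: atLeastAtMost_iff)
  then have pos: "0 < ip rho \<beta>"
    by (subst root_expand[OF rho_root]) (simp add: ip_comb)
  obtain q :: int where q: "2 * ip \<beta> rho / ip rho rho = q"
    using root_cartan_Ints[OF b rho_root] by (auto simp: Ints_def)
  then have q': "2 * ip \<beta> rho = q * (r * s)" using rs s_pos r_pos by (simp add: rho_long divide_eq_eq split: if_splits)
  have "0 < q * (r * s)" using pos by (simp add: ip_sym[of \<beta> rho] flip: q')
  then have q0: "0 < q" using rs by (simp add: zero_less_mult_iff)
  have "0 < ip (rho - \<beta>) (rho - \<beta>)"
    using False root_in_spn[OF b] root_in_spn[OF rho_root] by (intro spn_norm_pos spn_diff) auto
  then have "q * (r * s) < r * s + ip \<beta> \<beta>"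
    using q' unfolding ip_diff_self by (simp add: rho_long ip_sym[of rho \<beta>])
  then have "q * (r * s) < 2 * (r * s)" using root_norm_le[OF b] by simp
  then have "q < 2" using rs by (metis mult_less_cancel_right_pos of_int_less_numeral_iff)
  then have "q = 1" using q0 by simp
  then have "reflection X n rho \<beta> = \<beta> - rho" using q by (simp add: reflection_def)
  then have R: "\<beta> - rho \<in> R" using root_reflection[OF rho_root b] by simp
  from root_sign[OF this] show ?thesis
  proof
    assume "\<forall>j\<in>I. 0 \<le> cf j (\<beta> - rho)"
    then have "0 \<le> (\<Sum>j\<in>I. cf j (\<beta> - rho) * ip (sr j) rho)"
      using rho_dominant by (intro sum_nonneg mult_nonneg_nonneg) (auto simp: ip_sym[of _ rho])
    also have "\<dots> = ip (\<beta> - rho) rho"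
      by (subst (2) root_expand[OF R]) (simp only: ip_comb)
    finally have "0 \<le> ip (\<beta> - rho) rho" .
    moreover have "ip \<beta> \<beta> = ip rho rho + 2 * ip (\<beta> - rho) rho + ip (\<beta> - rho) (\<beta> - rho)"
      by (simp add: ip_sym[of rho \<beta>])
    ultimately show ?thesis using root_norm_pos[OF R] root_norm_le[OF b] rho_long by linarith
  qed (use \<open>j \<in> I\<close> in auto)
qed simp

text \<open>Among the roots dominating \<alpha> coefficientwise take one of maximal height. It is
  dominant, since reflecting in a simple root with negative product would raise the height.\<close>

lemma root_le_rho:
  assumes a: "\<alpha> \<in> R" and j: "j \<in> I"
  shows "cf j \<alpha> \<le> cf j rho"
proof -
  define U where "U = {\<beta> \<in> R. \<forall>j\<in>I. cf j \<alpha> \<le> cf j \<beta>}"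
  have U: "finite U" "U \<noteq> {}" using a finite_roots by (auto simp: U_def)
  define ht where "ht v = (\<Sum>j\<in>I. cf j v)" for v
  obtain \<beta> where b: "\<beta> \<in> U" "\<And>\<gamma>. \<gamma> \<in> U \<Longrightarrow> ht \<gamma> \<le> ht \<beta>"
  proof -
    have "Max (ht ` U) \<in> ht ` U" using U by (intro Max_in) auto
    then obtain \<beta> where "\<beta> \<in> U" "ht \<beta> = Max (ht ` U)" by auto
    then show thesis using U(1) by (intro that[of \<beta>]) auto
  qed
  have bR: "\<beta> \<in> R" using b by (simp add: U_def)
  have dom: "0 \<le> ip \<beta> (sr k)" if k: "k \<in> I" for k
  proof (rule ccontr)
    assume "\<not> ?thesis"
    then have neg: "2 * ip \<beta> (sr k) / ip (sr k) (sr k) < 0"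
      using norm_sr_pos[OF k] by (simp add: divide_neg_pos)
    let ?g = "reflection X n (sr k) \<beta>"
    have cf: "cf l ?g = cf l \<beta> - (if l = k then 2 * ip \<beta> (sr k) / ip (sr k) (sr k) else 0)" if "l \<in> I" for l
      using cf_reflection_sr[OF k that] .
    have "cf l \<alpha> \<le> cf l ?g" if l: "l \<in> I" for l
    proof -
      have "cf l \<alpha> \<le> cf l \<beta>" using b(1) l by (simp add: U_def)
      then show ?thesis using cf[OF l] neg by (simp split: if_splits)
    qed
    then have "?g \<in> U" using roots.reflect[OF bR k] by (simp add: U_def)
    moreover have "ht ?g = ht \<beta> - 2 * ip \<beta> (sr k) / ip (sr k) (sr k)"
      using cf k by (simp add: ht_def sum_subtractf)
    ultimately show False using b(2) neg by force
  qed
  have "cf j \<alpha> \<le> cf j \<beta>" using b j by (simp add: U_def)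
  also have "\<dots> \<le> cf j rho" using dominant_root_le_rho[OF bR dom j] .
  finally show ?thesis .
qed

lemma root_ge_minus_rho: "\<alpha> \<in> R \<Longrightarrow> j \<in> I \<Longrightarrow> - cf j rho \<le> cf j \<alpha>"
  using root_le_rho[OF root_uminus] by fastforce

lemma nonneg_comb_iff: "v \<in> spn \<Longrightarrow> nonneg_comb X n v \<longleftrightarrow> (\<forall>j\<in>I. 0 \<le> cf j v)"
proof
  assume "nonneg_comb X n v"
  then obtain c where "\<forall>j\<in>I. c j \<ge> 0" "v = comb c" by (auto simp: nonneg_comb_def comb_def)
  then show "\<forall>j\<in>I. 0 \<le> cf j v" by (simp add: cf_comb)
next
  assume "v \<in> spn" "\<forall>j\<in>I. 0 \<le> cf j v"
  then show "nonneg_comb X n v" using spn_expand[of v]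
    by (auto simp: nonneg_comb_def comb_def intro!: exI[of _ "\<lambda>j. cf j v"])
qed

lemma pos_roots_iff: "\<alpha> \<in> pos_roots X n \<longleftrightarrow> \<alpha> \<in> R \<and> (\<forall>j\<in>I. 0 \<le> cf j \<alpha>)"
  using root_in_spn by (auto simp: pos_roots_def nonneg_comb_iff)

lemma neg_roots_iff: "\<alpha> \<in> neg_roots X n \<longleftrightarrow> \<alpha> \<in> R \<and> (\<forall>j\<in>I. cf j \<alpha> \<le> 0)"
proof
  assume "\<alpha> \<in> neg_roots X n" then show "\<alpha> \<in> R \<and> (\<forall>j\<in>I. cf j \<alpha> \<le> 0)"
    by (auto simp: neg_roots_def pos_roots_iff)
next
  assume "\<alpha> \<in> R \<and> (\<forall>j\<in>I. cf j \<alpha> \<le> 0)"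
  then have "- \<alpha> \<in> pos_roots X n" by (auto simp: pos_roots_iff)
  then show "\<alpha> \<in> neg_roots X n" unfolding neg_roots_def by (metis image_eqI minus_minus)
qed

lemma highest_root_eq: "highest_root X n = rho"
  unfolding highest_root_def
proof (rule the_equality)
  have le: "nonneg_comb X n (rho - \<alpha>)" if "\<alpha> \<in> R" for \<alpha>
    using that root_le_rho by (subst nonneg_comb_iff) (auto intro: spn_diff root_in_spn rho_root)
  show "rho \<in> pos_roots X n \<and> (\<forall>\<alpha>\<in>pos_roots X n. nonneg_comb X n (rho - \<alpha>))"
    using rho_root rho_full le by (auto simp: pos_roots_iff less_imp_le)
  fix \<rho> assume "\<rho> \<in> pos_roots X n \<and> (\<forall>\<alpha>\<in>pos_roots X n. nonneg_comb X n (\<rho> - \<alpha>))"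
  then have rt: "\<rho> \<in> R" and "nonneg_comb X n (\<rho> - rho)"
    using rho_root rho_full by (auto simp: pos_roots_iff less_imp_le)
  then have "\<forall>j\<in>I. 0 \<le> cf j (\<rho> - rho)"
    by (subst (asm) nonneg_comb_iff) (auto intro: spn_diff root_in_spn rho_root)
  then show "\<rho> = rho" using root_le_rho[OF rt]
    by (intro spn_eqI root_in_spn rt rho_root) (fastforce)
qed

section \<open>Affine roots\<close>

abbreviation "mk j \<equiv> cf j rho"
abbreviation "P \<equiv> affine_pos_roots X n"

lemma asr_0: "asr 0 = delta - rho"
  and asr_finite: "j \<in> I \<Longrightarrow> asr j = sr j"
  by (auto simp: affine_simple_root_def highest_root_eq)

definition AR :: "vec set" where
  "AR = {\<alpha> + scl (real_of_int m) delta | \<alpha> m. \<alpha> \<in> R}"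

text \<open>The coefficient of \<open>asr k\<close> in z: because \<open>asr 0\<close> is
  \<open>delta - rho\<close>, the \<delta>-coordinate is the coefficient of \<open>asr 0\<close>,
  and each unit of it hides \<open>mk k\<close> copies of \<open>sr k\<close>.\<close>

definition K :: "nat \<Rightarrow> vec \<Rightarrow> real" where
  "K k z = (if k = 0 then z 0 else cf k z + mk k * z 0)"

lemma K_linear:
  "K k (u + v) = K k u + K k v" "K k (u - v) = K k u - K k v" "K k (scl c u) = c * K k u"
  "K k (- u) = - K k u"
  for u v :: vec
  by (auto simp: K_def vec_apply algebra_simps)

lemma mk_Ints: "k \<in> I \<Longrightarrow> mk k \<in> \<int>"
  by (rule root_cf_Ints[OF rho_root])

lemma mk_ge_1: "k \<in> I \<Longrightarrow> 1 \<le> mk k"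
  using mk_Ints[of k] rho_full[of k] by (auto elim!: Ints_cases)

lemma ARI: "\<alpha> \<in> R \<Longrightarrow> \<alpha> + scl (real_of_int m) delta \<in> AR"
  by (auto simp: AR_def)

lemma root_in_AR: "\<alpha> \<in> R \<Longrightarrow> \<alpha> \<in> AR"
  using ARI[of \<alpha> 0] by simp

lemma AR_uminus: "z \<in> AR \<Longrightarrow> - z \<in> AR"
proof -
  assume "z \<in> AR"
  then obtain \<alpha> m where "\<alpha> \<in> R" "z = \<alpha> + scl (real_of_int m) delta" by (auto simp: AR_def)
  then have "- z = - \<alpha> + scl (real_of_int (- m)) delta" by simp
  then show ?thesis using \<open>\<alpha> \<in> R\<close> by (metis ARI root_uminus)
qed

lemma K_AR:
  assumes "\<alpha> \<in> R"
  shows "K k (\<alpha> + scl m delta) = (if k = 0 then m else cf k \<alpha> + mk k * m)"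
  using root_in_spn[OF assms] by (simp add: K_def vec_apply)

lemma K_root: "\<alpha> \<in> R \<Longrightarrow> K k \<alpha> = (if k = 0 then 0 else cf k \<alpha>)"
  using root_in_spn by (simp add: K_def)

lemma asr_in_AR: "j \<le> n \<Longrightarrow> asr j \<in> AR"
proof (cases "j = 0")
  case True
  have "asr 0 = - rho + scl (real_of_int 1) delta" by (simp add: asr_0)
  then show ?thesis using True ARI[OF root_uminus[OF rho_root]] by metis
next
  case False
  assume "j \<le> n"
  then have "j \<in> I" using False by auto
  then show ?thesis by (simp add: asr_finite root_in_AR roots.simple)
qed

lemma K_asr:
  assumes "j \<le> n" "k \<le> n"
  shows "K k (asr j) = (if k = j then 1 else 0)"
proof (cases "j = 0")
  case True
  then show ?thesis using root_in_spn[OF rho_root] by (simp add: K_def asr_0 vec_apply)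
next
  case False
  then have j: "j \<in> I" using assms by auto
  then show ?thesis using root_in_spn[OF roots.simple[OF j]] assms sr_om[OF j, of k]
    by (auto simp: K_def asr_finite)
qed

text \<open>Every finite root lies between - rho and rho, so a single \<delta> outweighs its
  coefficients; without \<delta> this is the sign coherence of finite roots.\<close>

lemma AR_sign: "z \<in> AR \<Longrightarrow> (\<forall>k\<le>n. 0 \<le> K k z) \<or> (\<forall>k\<le>n. K k z \<le> 0)"
proof -
  assume "z \<in> AR"
  then obtain \<alpha> m where a: "\<alpha> \<in> R" and z: "z = \<alpha> + scl (real_of_int m) delta" by (auto simp: AR_def)
  have le: "cf k \<alpha> \<le> mk k" "- mk k \<le> cf k \<alpha>" if "k \<le> n" "k \<noteq> 0" for k
    using root_le_rho[OF a, of k] root_ge_minus_rho[OF a, of k] that by auto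
  consider "m = 0" | "m \<ge> 1" | "m \<le> -1" by linarith
  then show ?thesis
  proof cases
    case 1
    then have "K k z = (if k = 0 then 0 else cf k \<alpha>)" for k by (simp add: z K_root[OF a])
    then show ?thesis using root_sign[OF a] by auto
  next
    case 2
    have "0 \<le> K k z" if "k \<le> n" for k
    proof (cases "k = 0")
      case False
      have "mk k * 1 \<le> mk k * real_of_int m" using 2 False that mk_ge_1[of k] by (intro mult_left_mono) auto
      then show ?thesis using le[OF that False] False by (simp add: z K_AR[OF a])
    qed (use 2 in \<open>simp add: z K_AR[OF a]\<close>)
    then show ?thesis by blast
  next
    case 3
    have "K k z \<le> 0" if "k \<le> n" for k
    proof (cases "k = 0")
      case False
      have "real_of_int m \<le> -1" using 3 by simp
      then have "mk k * real_of_int m \<le> mk k * (-1)" using False that mk_ge_1[of k] by (intro mult_left_mono) auto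
      then show ?thesis using le[OF that False] False by (simp add: z K_AR[OF a])
    qed (use 3 in \<open>simp add: z K_AR[OF a]\<close>)
    then show ?thesis by blast
  qed
qed

lemma AR_nonzero: "z \<in> AR \<Longrightarrow> \<exists>k\<le>n. K k z \<noteq> 0"
proof (rule ccontr)
  assume "z \<in> AR" and "\<not> (\<exists>k\<le>n. K k z \<noteq> 0)"
  then obtain \<alpha> m where a: "\<alpha> \<in> R" and z: "z = \<alpha> + scl (real_of_int m) delta" and 0: "\<And>k. k \<le> n \<Longrightarrow> K k z = 0"
    by (auto simp: AR_def)
  have "m = 0" using 0[of 0] by (simp add: z K_AR[OF a])
  then have "cf k \<alpha> = 0" if "k \<in> I" for k using 0[of k] that by (simp add: z K_root[OF a])
  then have "\<alpha> = 0" using root_expand[OF a] comb_0 by metis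
  then show False using root_nonzero[OF a] by simp
qed

text \<open>From here on positivity is a sign condition treating \<open>asr 0\<close> like the other
  simple roots, and one positive coefficient decides it.\<close>

lemma P_iff: "z \<in> P \<longleftrightarrow> z \<in> AR \<and> (\<forall>k\<le>n. 0 \<le> K k z)"
proof
  assume "z \<in> P"
  then consider \<alpha> m where "z = \<alpha> + scl (real m) delta" "\<alpha> \<in> pos_roots X n"
    | \<alpha> m where "z = \<alpha> + scl (real m) delta" "\<alpha> \<in> neg_roots X n" "m \<ge> 1"
    by (auto simp: affine_pos_roots_def)
  then show "z \<in> AR \<and> (\<forall>k\<le>n. 0 \<le> K k z)"
  proof cases
    case 1
    then have a: "\<alpha> \<in> R" "\<forall>j\<in>I. 0 \<le> cf j \<alpha>" by (auto simp: pos_roots_iff)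
    have "z \<in> AR" using ARI[OF a(1), of "int m"] 1 by simp
    moreover have "0 \<le> K k z" if "k \<le> n" for k
    proof (cases "k = 0")
      case False
      then have "k \<in> I" using that by auto
      then show ?thesis using a mk_ge_1[of k] 1 False by (auto simp: K_AR)
    qed (use 1 a in \<open>simp add: K_AR\<close>)
    ultimately show ?thesis by blast
  next
    case 2
    then have a: "\<alpha> \<in> R" "\<forall>j\<in>I. cf j \<alpha> \<le> 0" by (auto simp: neg_roots_iff)
    have AR: "z \<in> AR" using ARI[OF a(1), of "int m"] 2 by simp
    have "K 0 z > 0" using 2 a by (simp add: K_AR)
    then show ?thesis using AR AR_sign[OF AR] by force
  qed
next
  assume *: "z \<in> AR \<and> (\<forall>k\<le>n. 0 \<le> K k z)"
  then obtain \<alpha> m where a: "\<alpha> \<in> R" and z: "z = \<alpha> + scl (real_of_int m) delta" by (auto simp: AR_def)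
  have "m \<ge> 0" using * K_AR[OF a, of 0 m] by (auto simp: z)
  then obtain m' where m': "m = int m'" by (metis nonneg_int_cases)
  show "z \<in> P"
  proof (cases "\<forall>j\<in>I. 0 \<le> cf j \<alpha>")
    case True
    then have "\<alpha> \<in> pos_roots X n" using a by (simp add: pos_roots_iff)
    then show ?thesis using z m' by (auto simp: affine_pos_roots_def)
  next
    case False
    then have "\<alpha> \<in> neg_roots X n" using a root_sign[OF a] by (auto simp: neg_roots_iff)
    moreover have "m' \<noteq> 0"
    proof
      assume "m' = 0"
      then have "0 \<le> cf j \<alpha>" if "j \<in> I" for j
        using *[THEN conjunct2, rule_format, of j] that m' by (simp add: z K_root[OF a])
      then show False using False by blast
    qed
    ultimately have "z \<in> {\<alpha> + scl (real m) delta | \<alpha> m. \<alpha> \<in> neg_roots X n \<and> m \<ge> 1}"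
      using z m' by (intro CollectI exI[of _ \<alpha>] exI[of _ m']) auto
    then show ?thesis by (simp add: affine_pos_roots_def)
  qed
qed

lemma neg_P_iff: "z \<in> affine_neg_roots X n \<longleftrightarrow> - z \<in> P"
  unfolding affine_neg_roots_def by (metis image_iff minus_minus)

lemma P_in_AR: "z \<in> P \<Longrightarrow> z \<in> AR" by (simp add: P_iff)

lemma AR_cases: "z \<in> AR \<Longrightarrow> z \<in> P \<or> - z \<in> P"
  using AR_sign[of z] AR_uminus[of z] by (auto simp: P_iff K_linear)

lemma P_not_neg: "z \<in> P \<Longrightarrow> - z \<notin> P"
proof
  assume z: "z \<in> P" "- z \<in> P"
  then obtain k where k: "k \<le> n" "K k z \<noteq> 0" using AR_nonzero[of z] by (auto simp: P_iff)
  then have "0 \<le> K k z" "0 \<le> - K k z" using z by (auto simp: P_iff K_linear)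
  then show False using k by simp
qed

lemma neg_P_not: "z \<in> AR \<Longrightarrow> z \<notin> P \<longleftrightarrow> - z \<in> P"
  using AR_cases P_not_neg by blast

lemma P_I: "z \<in> AR \<Longrightarrow> k \<le> n \<Longrightarrow> 0 < K k z \<Longrightarrow> z \<in> P"
  using AR_sign[of z] by (force simp: P_iff)

lemma asr_P: "j \<le> n \<Longrightarrow> asr j \<in> P"
  by (rule P_I[of _ j]) (auto simp: asr_in_AR K_asr)

lemma root_P_iff: "\<alpha> \<in> R \<Longrightarrow> \<alpha> \<in> P \<longleftrightarrow> (\<forall>j\<in>I. 0 \<le> cf j \<alpha>)"
  using K_AR[of \<alpha> _ 0] by (auto simp: P_iff root_in_AR)

lemma P_0_pos: "z \<in> AR \<Longrightarrow> 0 < z 0 \<Longrightarrow> z \<in> P"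
  by (rule P_I[of _ 0]) (auto simp: K_def)

lemma P_0_nonneg: "z \<in> P \<Longrightarrow> 0 \<le> z 0"
  by (auto simp: P_iff K_def dest: spec[of _ 0])

subsection \<open>The simple reflections permute the positive affine roots\<close>

lemma ip_asr_pos: "j \<le> n \<Longrightarrow> 0 < ip (asr j) (asr j)"
  using norm_sr_pos[of j] rho_long s_pos r_pos by (cases "j = 0") (auto simp: asr_0 asr_finite)

lemma simple_refl_asr: "j \<le> n \<Longrightarrow> simple_refl X n j (asr j) = - asr j"
  using ip_asr_pos[of j] by (simp add: simple_refl_def reflection_self)

lemma simple_refl_expand:
  "simple_refl X n j v = v - scl (2 * ip v (asr j) / ip (asr j) (asr j)) (asr j)"
  by (simp add: simple_refl_def reflection_def)

lemma simple_refl_AR: "j \<le> n \<Longrightarrow> z \<in> AR \<Longrightarrow> simple_refl X n j z \<in> AR"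
proof -
  assume j: "j \<le> n" and "z \<in> AR"
  then obtain \<alpha> m where a: "\<alpha> \<in> R" and z: "z = \<alpha> + scl (real_of_int m) delta" by (auto simp: AR_def)
  show ?thesis
  proof (cases "j = 0")
    case True
    obtain q :: int where q: "2 * ip \<alpha> rho / ip rho rho = q"
      using root_cartan_Ints[OF a rho_root] by (auto simp: Ints_def)
    have "simple_refl X n 0 z = reflection X n rho \<alpha> + scl (real_of_int (m + q)) delta"
      using q by (simp add: simple_refl_expand asr_0 z reflection_def scl_diff scl_add_left)
    then show ?thesis using True root_reflection[OF rho_root a] ARI by metis
  next
    case False
    then have "simple_refl X n j z = reflection X n (sr j) \<alpha> + scl (real_of_int m) delta"
      using j by (simp add: simple_refl_finite z reflection_add reflection_scl)
    moreover have "reflection X n (sr j) \<alpha> \<in> R" using j False a by (intro roots.reflect) auto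
    ultimately show ?thesis using ARI by metis
  qed
qed

lemma K_simple_refl:
  assumes "j \<le> n" "k \<le> n" "k \<noteq> j"
  shows "K k (simple_refl X n j z) = K k z"
  using assms by (simp add: simple_refl_expand K_linear K_asr)

text \<open>For j = 0 the finite part is - m rho, and the bound by \<open>rho\<close> forces m = 1;
  for j > 0 this is reducedness of the finite root system.\<close>

lemma only_multiple_asr:
  assumes z: "z \<in> P" and j: "j \<le> n" and 0: "\<And>k. k \<le> n \<Longrightarrow> k \<noteq> j \<Longrightarrow> K k z = 0"
  shows "z = asr j"
proof -
  obtain \<alpha> m where a: "\<alpha> \<in> R" and zeq: "z = \<alpha> + scl (real_of_int m) delta"
    using P_in_AR[OF z] by (auto simp: AR_def)
  have Kz: "0 \<le> K j z" using z j by (simp add: P_iff)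
  show ?thesis
  proof (cases "j = 0")
    case True
    have m0: "0 \<le> m" using z P_0_nonneg[OF z] root_in_spn[OF a] by (simp add: zeq vec_apply)
    have cf: "cf k \<alpha> = - real_of_int m * mk k" if "k \<in> I" for k
      using 0[of k] that True by (simp add: zeq K_AR[OF a] mult.commute add_eq_0_iff2)
    have "\<alpha> = scl (- real_of_int m) rho"
      using root_in_spn[OF a] root_in_spn[OF rho_root] cf by (intro spn_eqI spn_scl) auto
    moreover have "m = 1"
    proof -
      have "m \<noteq> 0" using \<open>\<alpha> = _\<close> root_nonzero[OF a] by auto
      moreover have "\<not> 2 \<le> m"
      proof
        assume "2 \<le> m"
        have "real_of_int m * mk 1 \<le> mk 1" using root_ge_minus_rho[OF a, of 1] cf[of 1] n_pos by auto
        moreover have "2 * mk 1 \<le> real_of_int m * mk 1" using \<open>2 \<le> m\<close> mk_ge_1[of 1] n_pos by (intro mult_right_mono) auto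
        ultimately show False using mk_ge_1[of 1] n_pos by auto
      qed
      ultimately show ?thesis using m0 by linarith
    qed
    ultimately show ?thesis by (simp add: zeq True asr_0)
  next
    case False
    then have jI: "j \<in> I" using j by auto
    have "m = 0" using 0[of 0] False by (simp add: zeq K_AR[OF a])
    then have z': "z = \<alpha>" by (simp add: zeq)
    have cf: "cf k \<alpha> = K k z" if "k \<in> I" for k using that K_AR[OF a, of k 0] z' by simp
    have "\<alpha> = scl (cf j \<alpha>) (sr j)"
      using 0 cf jI by (intro spn_eqI root_in_spn[OF a] spn_scl sr_in_spn) (auto simp: sr_om)
    moreover have "0 \<le> cf j \<alpha>" using cf[OF jI] Kz by simp
    ultimately have "\<alpha> = sr j" using root_multiple_simple[OF a _ jI] by (metis scl_1)
    then show ?thesis using z' jI by (simp add: asr_finite)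
  qed
qed

text \<open>The reflection changes only the coefficient at j, while a positive root other than
  \<open>asr j\<close> has another positive coefficient.\<close>

lemma simple_refl_P: "j \<le> n \<Longrightarrow> z \<in> P \<Longrightarrow> z \<noteq> asr j \<Longrightarrow> simple_refl X n j z \<in> P"
proof -
  assume j: "j \<le> n" and z: "z \<in> P" "z \<noteq> asr j"
  then obtain k where k: "k \<le> n" "k \<noteq> j" "K k z \<noteq> 0" using only_multiple_asr by blast
  then have "0 < K k (simple_refl X n j z)" using z j by (auto simp: K_simple_refl P_iff less_le)
  then show ?thesis using k j z by (intro P_I[of _ k] simple_refl_AR) (auto simp: P_iff)
qed

lemma simple_refl_neg: "j \<le> n \<Longrightarrow> - z \<in> P \<Longrightarrow> z \<noteq> - asr j \<Longrightarrow> - simple_refl X n j z \<in> P"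
  using simple_refl_P[of j "- z"] elt_uminus[of "[j]" z] minus_equation_iff[of z "asr j"]
  by (auto simp: elt_Cons)

section \<open>Length and inversions\<close>

abbreviation wrd :: "nat list \<Rightarrow> bool" where "wrd xs \<equiv> set xs \<subseteq> {0..n}"

lemma elt_AR: "wrd xs \<Longrightarrow> z \<in> AR \<Longrightarrow> elt xs z \<in> AR"
  by (induction xs) (auto simp: elt_Cons simple_refl_AR)

text \<open>These are the inversions of the inverse element: \<open>inversions\<close> of
  \<open>elt xs\<close> is \<open>D (rev xs)\<close>. In this form a new leading letter acts after
  the rest of the word, which suits induction on lists.\<close>

definition D :: "nat list \<Rightarrow> vec set" where
  "D xs = {z \<in> P. - elt xs z \<in> P}"

lemma inversions_elt: "inversions X n (elt xs) = D (rev xs)"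
  by (simp add: inversions_def inv_elt D_def neg_P_iff)

lemma D_Nil [simp]: "D [] = {}"
  using P_not_neg by (auto simp: D_def)

lemma D_cong: "elt xs = elt ys \<Longrightarrow> D xs = D ys"
  by (simp add: D_def)

lemma elt_rev_eq_iff: "elt (rev xs) u = v \<longleftrightarrow> u = elt xs v"
  by auto

text \<open>Only the root that \<open>xs\<close> sends to \<open>asr j\<close> can change sign under
  the letter j.\<close>

lemma D_Cons_pos:
  assumes "wrd xs" "j \<le> n" "elt (rev xs) (asr j) \<in> P"
  shows "D (j # xs) = insert (elt (rev xs) (asr j)) (D xs)" "elt (rev xs) (asr j) \<notin> D xs"
proof -
  show "elt (rev xs) (asr j) \<notin> D xs" using asr_P[OF assms(2)] P_not_neg by (auto simp: D_def)
  show "D (j # xs) = insert (elt (rev xs) (asr j)) (D xs)"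
  proof (intro set_eqI iffI)
    fix z assume z: "z \<in> D (j # xs)"
    show "z \<in> insert (elt (rev xs) (asr j)) (D xs)"
    proof (cases "elt xs z = asr j")
      case True then show ?thesis by (metis elt_rev insertI1)
    next
      case False
      have "elt xs z \<notin> P" using z simple_refl_P[OF assms(2) _ False] P_not_neg
        by (auto simp: D_def elt_Cons)
      then show ?thesis using z elt_AR[OF assms(1)] P_in_AR by (auto simp: D_def neg_P_not)
    qed
  next
    fix z assume "z \<in> insert (elt (rev xs) (asr j)) (D xs)"
    then show "z \<in> D (j # xs)"
    proof
      assume "z = elt (rev xs) (asr j)"
      then show ?thesis using assms asr_P by (simp add: D_def elt_Cons simple_refl_asr)
    next
      assume z: "z \<in> D xs"
      have "elt xs z \<noteq> - asr j"
      proof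
        assume "elt xs z = - asr j"
        then have "z = - elt (rev xs) (asr j)" by (metis elt_rev elt_uminus)
        then show False using z assms(3) P_not_neg by (auto simp: D_def)
      qed
      then show ?thesis using z simple_refl_neg[OF assms(2)] by (auto simp: D_def elt_Cons)
    qed
  qed
qed

lemma D_Cons_neg:
  assumes "wrd xs" "j \<le> n" "elt (rev xs) (asr j) \<notin> P"
  shows "D (j # xs) \<subseteq> D xs"
proof
  fix z assume z: "z \<in> D (j # xs)"
  have "elt xs z \<noteq> asr j" using z assms(3) by (auto simp: D_def) (metis elt_rev)
  then have "elt xs z \<notin> P" using z simple_refl_P[OF assms(2)] P_not_neg by (auto simp: D_def elt_Cons)
  then show "z \<in> D xs" using z elt_AR[OF assms(1)] P_in_AR by (auto simp: D_def neg_P_not)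
qed

lemma D_finite_card: "wrd xs \<Longrightarrow> finite (D xs) \<and> card (D xs) \<le> length xs"
proof (induction xs)
  case (Cons j xs)
  show ?case
  proof (cases "elt (rev xs) (asr j) \<in> P")
    case True
    then show ?thesis using D_Cons_pos[of xs j] Cons by auto
  next
    case False
    have "D (j # xs) \<subseteq> D xs" using D_Cons_neg[of xs j] False Cons by auto
    then show ?thesis using Cons card_mono[of "D xs" "D (j # xs)"] finite_subset by fastforce
  qed
qed simp

lemmas finite_D = D_finite_card[THEN conjunct1]
lemmas card_D_le = D_finite_card[THEN conjunct2]

lemma D_rev: "wrd xs \<Longrightarrow> D (rev xs) = (\<lambda>z. - elt xs z) ` D xs"
proof (intro set_eqI iffI)
  fix z assume "z \<in> D (rev xs)"
  then have "- elt (rev xs) z \<in> D xs" "z = - elt xs (- elt (rev xs) z)" by (auto simp: D_def elt_uminus)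
  then show "z \<in> (\<lambda>z. - elt xs z) ` D xs" by blast
qed (auto simp: D_def elt_uminus)

lemma card_D_rev: "wrd xs \<Longrightarrow> card (D (rev xs)) = card (D xs)"
  unfolding D_rev by (rule card_image) (auto simp: inj_on_def)

text \<open>Counts inversions instead of minimising over words; \<open>cox_length_elt\<close>
  identifies the two notions.\<close>

definition reduced :: "nat list \<Rightarrow> bool" where
  "reduced xs \<longleftrightarrow> wrd xs \<and> card (D xs) = length xs"

lemma reduced_Nil [simp]: "reduced []" by (simp add: reduced_def)

lemma reduced_rev: "reduced (rev xs) \<longleftrightarrow> reduced xs"
  by (auto simp: reduced_def card_D_rev)

lemma card_D_Cons_pos:
  assumes "wrd xs" "j \<le> n" "elt (rev xs) (asr j) \<in> P"
  shows "card (D (j # xs)) = Suc (card (D xs))"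
  using D_Cons_pos[of xs j] assms finite_D[of xs] by simp

lemma reduced_Cons_iff:
  "reduced (j # xs) \<longleftrightarrow> reduced xs \<and> j \<le> n \<and> elt (rev xs) (asr j) \<in> P"
proof
  assume r: "reduced (j # xs)"
  then have w: "wrd xs" "j \<le> n" by (auto simp: reduced_def)
  have P: "elt (rev xs) (asr j) \<in> P"
  proof (rule ccontr)
    assume "\<not> ?thesis"
    then have "card (D (j # xs)) \<le> card (D xs)"
      using D_Cons_neg[OF w] finite_D[OF w(1)] by (intro card_mono) auto
    then show False using r card_D_le[OF w(1)] by (simp add: reduced_def)
  qed
  then show "reduced xs \<and> j \<le> n \<and> elt (rev xs) (asr j) \<in> P"
    using r w card_D_Cons_pos[OF w] by (simp add: reduced_def)
next
  assume "reduced xs \<and> j \<le> n \<and> elt (rev xs) (asr j) \<in> P"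
  then show "reduced (j # xs)" using card_D_Cons_pos[of xs j] by (simp add: reduced_def)
qed

lemma reduced_snoc_iff:
  "reduced (xs @ [j]) \<longleftrightarrow> reduced xs \<and> j \<le> n \<and> elt xs (asr j) \<in> P"
  using reduced_Cons_iff[of j "rev xs"] reduced_rev[of "xs @ [j]"] reduced_rev[of xs] by simp

lemma reduced_appendD1: "reduced (xs @ ys) \<Longrightarrow> reduced xs"
  by (induction ys rule: rev_induct) (auto simp: reduced_snoc_iff simp flip: append_assoc)

lemma reduced_wrd: "reduced xs \<Longrightarrow> wrd xs"
  by (simp add: reduced_def)

text \<open>Follow z through the word from the right. At the letter k where it turns negative it
  must equal \<open>asr k\<close>, the only positive root that this letter makes negative.\<close>

lemma strong_exchange:
  assumes "z \<in> P" "elt xs z \<notin> P" "wrd xs"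
  shows "\<exists>p k q. xs = p @ [k] @ q \<and> elt q z = asr k"
  using assms
proof (induction xs)
  case (Cons j xs)
  show ?case
  proof (cases "elt xs z \<in> P")
    case True
    then have "elt xs z = asr j" using Cons simple_refl_P[of j "elt xs z"] by (auto simp: elt_Cons)
    then show ?thesis by (intro exI[of _ "[]"]) auto
  next
    case False
    then obtain p k q where "xs = p @ [k] @ q" "elt q z = asr k" using Cons by auto
    then show ?thesis by (intro exI[of _ "j # p"] exI[of _ k] exI[of _ q]) auto
  qed
qed simp

text \<open>If j cannot be put in front of \<open>xs\<close>, then \<open>asr j\<close> turns
  negative at some letter k of \<open>rev xs\<close>, and by the conjugation rule the leading j
  cancels this k. No new letters appear, so the argument stays inside parabolic subgroups.\<close>

lemma deletion:
  assumes "wrd xs" "\<not> reduced xs"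
  shows "\<exists>ys. set ys \<subseteq> set xs \<and> length ys < length xs \<and> elt ys = elt xs"
  using assms
proof (induction xs)
  case (Cons j xs)
  show ?case
  proof (cases "reduced xs")
    case True
    then have "elt (rev xs) (asr j) \<notin> P" using Cons reduced_Cons_iff by auto
    then obtain p k q where pq: "rev xs = p @ [k] @ q" "elt q (asr j) = asr k"
      using strong_exchange[of "asr j" "rev xs"] asr_P[of j] Cons by auto
    have xs: "xs = rev q @ [k] @ rev p"
      using arg_cong[OF pq(1), of rev] by simp
    have "elt (j # rev q) v = elt (rev q @ [k]) v" for v
    proof -
      have "asr j = elt (rev q) (asr k)" using pq(2) by (metis elt_rev)
      then have "elt (rev q) (reflection X n (asr k) (elt q (elt (rev q) v))) = reflection X n (asr j) (elt (rev q) v)"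
        by (simp only: elt_reflection elt_rev)
      then show ?thesis by (simp add: elt_Cons elt_append simple_refl_def)
    qed
    then have "elt (j # xs) v = elt (rev q @ rev p) v" for v
      by (simp add: xs elt_append elt_Cons)
    then show ?thesis using xs by (intro exI[of _ "rev q @ rev p"]) (auto simp: fun_eq_iff)
  next
    case False
    then obtain ys where ys: "set ys \<subseteq> set xs" "length ys < length xs" "elt ys = elt xs" using Cons by auto
    then show ?thesis by (intro exI[of _ "j # ys"]) (auto intro!: ext simp: elt_Cons)
  qed
qed simp

lemma reduced_word_exists:
  assumes "wrd xs"
  obtains ys where "reduced ys" "set ys \<subseteq> set xs" "elt ys = elt xs"
proof -
  have "\<exists>ys. reduced ys \<and> set ys \<subseteq> set xs \<and> elt ys = elt xs"
    using assms
  proof (induction "length xs" arbitrary: xs rule: less_induct)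
    case less
    show ?case
    proof (cases "reduced xs")
      case False
      then obtain ys where ys: "set ys \<subseteq> set xs" "length ys < length xs" "elt ys = elt xs"
        using deletion less by blast
      then obtain zs where "reduced zs \<and> set zs \<subseteq> set ys \<and> elt zs = elt ys"
        using less(1)[of ys] less(2) by (meson subset_trans)
      then show ?thesis using ys by (metis subset_trans)
    qed blast
  qed
  then show ?thesis using that by blast
qed

text \<open>The length is the same in every parabolic subgroup containing the letters, because
  reduction only removes letters.\<close>

lemma cox_length_elt:
  assumes "set xs \<subseteq> J" "J \<subseteq> {0..n}"
  shows "cox_length X n J (elt xs) = card (D xs)"
  unfolding cox_length_def
proof (rule Least_equality)
  obtain ys where ys: "reduced ys" "set ys \<subseteq> set xs" "elt ys = elt xs"
    using assms by (meson reduced_word_exists subset_trans)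
  then show "\<exists>ys. set ys \<subseteq> J \<and> elt ys = elt xs \<and> length ys = card (D xs)"
    using assms D_cong[OF ys(3)] by (intro exI[of _ ys]) (auto simp: reduced_def)
next
  fix k assume "\<exists>ys. set ys \<subseteq> J \<and> elt ys = elt xs \<and> length ys = k"
  then obtain ys where "set ys \<subseteq> J" "elt ys = elt xs" "length ys = k" by blast
  then show "card (D xs) \<le> k" using card_D_le[of ys] assms D_cong by (metis subset_trans)
qed

lemma reduced_expression_iff:
  assumes "J \<subseteq> {0..n}"
  shows "reduced_expression X n J xs w \<longleftrightarrow> set xs \<subseteq> J \<and> elt xs = w \<and> reduced xs"
  using assms cox_length_elt[of xs J] by (auto simp: reduced_expression_def reduced_def)

lemma inf_reduced_iff: "inf_reduced X n x \<longleftrightarrow> (\<forall>j. reduced (prefix_word x j))"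
proof -
  have 0: "reduced (prefix_word x 0)" by (simp add: prefix_word_def)
  have "inf_reduced X n x \<longleftrightarrow> (\<forall>j\<ge>1. reduced (prefix_word x j))"
    using reduced_wrd by (auto simp: inf_reduced_def reduced_expression_iff)
  also have "\<dots> \<longleftrightarrow> (\<forall>j. reduced (prefix_word x j))"
    using 0 by (metis less_one not_le)
  finally show ?thesis .
qed

text \<open>If \<open>l(xy) = l(x) + l(y)\<close>, the inversions of \<open>xy\<close> not coming from \<open>y\<close> correspond to those
  of \<open>x\<close> through the action of \<open>y\<close>.\<close>

lemma card_D_append:
  assumes w: "wrd xs" "wrd ys" and sub: "D ys \<subseteq> D (xs @ ys)"
  shows "card (D (xs @ ys)) = card (D xs) + card (D ys)"
proof -
  have w': "wrd (xs @ ys)" using w by auto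
  let ?E = "D (xs @ ys) - D ys"
  have E: "elt ys ` ?E = D xs"
  proof (intro set_eqI iffI)
    fix z assume "z \<in> elt ys ` ?E"
    then obtain y where y: "y \<in> P" "- elt xs (elt ys y) \<in> P" "\<not> - elt ys y \<in> P" "z = elt ys y"
      by (auto simp: D_def elt_append)
    then show "z \<in> D xs" using elt_AR[OF w(2)] P_in_AR by (auto simp: D_def neg_P_not[symmetric])
  next
    fix z assume z: "z \<in> D xs"
    let ?y = "elt (rev ys) z"
    have AR: "?y \<in> AR" using z w P_in_AR by (intro elt_AR) (auto simp: D_def)
    have "?y \<in> P"
    proof (rule ccontr)
      assume "?y \<notin> P"
      then have "- ?y \<in> P" using AR neg_P_not by blast
      moreover have "elt ys (- ?y) = - z" by (simp add: elt_uminus)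
      ultimately have "- ?y \<in> D ys" using z by (simp add: D_def)
      then have "- elt (xs @ ys) (- ?y) \<in> P" using sub by (auto simp: D_def)
      then show False using z P_not_neg by (simp add: D_def elt_append elt_uminus)
    qed
    then have "?y \<in> ?E" using z P_not_neg by (auto simp: D_def elt_append)
    then show "z \<in> elt ys ` ?E" by (metis elt_rev' image_eqI)
  qed
  have "card (D xs) = card ?E" unfolding E[symmetric] by (rule card_image) (auto simp: inj_on_def)
  moreover have "card (D (xs @ ys)) = card ?E + card (D ys)"
    using sub finite_D[OF w'] finite_D[OF w(2)] by (metis Diff_partition card_Un_disjoint Diff_disjoint add.commute finite_Diff)
  ultimately show ?thesis by simp
qed

section \<open>Longest elements\<close>

lemma I_wrd: "set xs \<subseteq> I \<Longrightarrow> wrd xs" by fastforce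

lemma elt_spn: "set xs \<subseteq> I \<Longrightarrow> v \<in> spn \<Longrightarrow> elt xs v \<in> spn"
proof (induction xs)
  case (Cons j xs)
  then have j: "j \<in> I" by simp
  show ?case using Cons by (simp add: elt_Cons simple_refl_finite[OF j] reflection_sr spn_diff spn_scl sr_in_spn[OF j])
qed simp

lemma elt_comb: "elt xs (comb c) = (\<Sum>j\<in>I. scl (c j) (elt xs (sr j)))"
  by (simp add: comb_def elt_sum elt_scl)

lemma ip_elt_comb: "ip (elt xs (comb c)) v = (\<Sum>j\<in>I. c j * ip (elt xs (sr j)) v)"
  by (simp add: elt_comb ip_sum_left)

lemma elt_0: "set xs \<subseteq> I \<Longrightarrow> (elt xs v) 0 = v 0"
proof (induction xs)
  case (Cons j xs)
  then have "j \<in> I" by simp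
  then show ?case using Cons spn_apply_0[OF sr_in_spn[of j]]
    by (simp add: elt_Cons simple_refl_finite reflection_sr vec_apply)
qed simp

lemma AR_0_root: "z \<in> AR \<Longrightarrow> z 0 = 0 \<Longrightarrow> z \<in> R"
  using root_in_spn by (auto simp: AR_def vec_apply)

lemma D_finite_word: "set xs \<subseteq> I \<Longrightarrow> D xs \<subseteq> R \<inter> P"
proof
  fix z assume xs: "set xs \<subseteq> I" and z: "z \<in> D xs"
  then have "0 \<le> z 0" "0 \<le> - z 0" using P_0_nonneg[of z] P_0_nonneg[of "- elt xs z"]
    by (auto simp: D_def vec_apply elt_0)
  then show "z \<in> R \<inter> P" using z AR_0_root P_in_AR by (auto simp: D_def)
qed

lemma root_not_P: "\<alpha> \<in> R \<Longrightarrow> \<alpha> \<notin> P \<longleftrightarrow> - \<alpha> \<in> P"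
  using neg_P_not root_in_AR by blast

text \<open>For words in J this characterises the longest element of the parabolic subgroup, without
  mention of length.\<close>

definition neg_on :: "nat set \<Rightarrow> nat list \<Rightarrow> bool" where
  "neg_on J xs \<longleftrightarrow> (\<forall>j\<in>J. - elt xs (sr j) \<in> P)"

lemma cf_parabolic:
  assumes "set xs \<subseteq> J" "J \<subseteq> I" "k \<in> I" "k \<notin> J"
  shows "cf k (elt xs v) = cf k v"
  using assms(1)
proof (induction xs)
  case (Cons j xs)
  then have "j \<in> I" "j \<noteq> k" using assms by auto
  then show ?case using Cons cf_reflection_sr[of j k] assms(3) by (simp add: elt_Cons simple_refl_finite)
qed simp

lemma neg_on_root:
  assumes xs: "set xs \<subseteq> I" "neg_on J xs"
    and a: "\<alpha> \<in> R" "\<alpha> \<in> P" and 0: "\<And>k. k \<in> I \<Longrightarrow> k \<notin> J \<Longrightarrow> cf k \<alpha> = 0"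
  shows "- elt xs \<alpha> \<in> P"
proof -
  have R: "elt xs \<alpha> \<in> R" using xs a elt_root by blast
  have "cf k (elt xs \<alpha>) \<le> 0" if k: "k \<in> I" for k
  proof -
    have "cf k (elt xs \<alpha>) = (\<Sum>j\<in>I. cf j \<alpha> * cf k (elt xs (sr j)))"
      by (subst root_expand[OF a(1)]) (simp only: ip_elt_comb)
    also have "\<dots> \<le> 0"
    proof (intro sum_nonpos)
      fix j assume j: "j \<in> I"
      show "cf j \<alpha> * cf k (elt xs (sr j)) \<le> 0"
      proof (cases "j \<in> J")
        case True
        then have "- elt xs (sr j) \<in> P" "- elt xs (sr j) \<in> R"
          using xs elt_root[OF xs(1) roots.simple[OF j]] by (auto simp: neg_on_def)
        then have "0 \<le> cf k (- elt xs (sr j))" using k root_P_iff by blast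
        then show ?thesis using a j root_P_iff[OF a(1)] by (simp add: mult_nonneg_nonpos)
      qed (use 0 j in simp)
    qed
    finally show ?thesis .
  qed
  then show ?thesis using R root_P_iff[of "- elt xs \<alpha>"] by simp
qed

text \<open>The simple root of the last letter of a nonempty reduced word is made negative by that
  word.\<close>

lemma parabolic_trivial:
  assumes "set xs \<subseteq> J" "J \<subseteq> I" "\<And>j. j \<in> J \<Longrightarrow> elt xs (sr j) \<in> P"
  shows "elt xs = id"
proof -
  have "wrd xs" using assms by (auto intro: I_wrd)
  then obtain ys where ys: "reduced ys" "set ys \<subseteq> set xs" "elt ys = elt xs"
    by (rule reduced_word_exists)
  have "ys = []"
  proof (cases ys rule: rev_cases)
    case (snoc zs j)
    then have j: "j \<in> J" using ys assms by auto
    then have jI: "j \<in> I" using assms by auto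
    have "elt zs (sr j) \<in> P" using ys(1) snoc by (simp add: reduced_snoc_iff asr_finite[OF jI])
    moreover have "elt ys (sr j) = - elt zs (sr j)"
      using simple_refl_asr[of j] jI
      by (simp add: snoc elt_append elt_Cons asr_finite[OF jI] elt_uminus)
    ultimately show ?thesis using assms(3)[OF j] ys(3) P_not_neg by metis
  qed
  then show ?thesis using ys by simp
qed

text \<open>The quotient \<open>rev xs @ ys\<close> keeps the simple roots of J positive: a negative
  image would, after \<open>xs\<close>, contradict that \<open>ys\<close> makes them negative. Hence
  the quotient is trivial.\<close>

lemma neg_on_unique:
  assumes J: "J \<subseteq> I" and xs: "set xs \<subseteq> J" "neg_on J xs" and ys: "set ys \<subseteq> J" "neg_on J ys"
  shows "elt xs = elt ys"
proof -
  have I: "set xs \<subseteq> I" "set ys \<subseteq> I" using assms by auto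
  have "elt (rev xs @ ys) = id"
  proof (rule parabolic_trivial[OF _ J])
    fix j assume j: "j \<in> J"
    then have jI: "j \<in> I" using J by auto
    let ?g = "elt ys (sr j)"
    have g: "?g \<in> R" "- ?g \<in> P" using j ys elt_root[OF I(2) roots.simple[OF jI]] by (auto simp: neg_on_def)
    let ?h = "elt (rev xs) ?g"
    have hR: "?h \<in> R" using elt_root[OF _ g(1), of "rev xs"] I by simp
    have "?h \<in> P"
    proof (rule ccontr)
      assume "?h \<notin> P"
      then have hP: "- ?h \<in> P" using hR root_not_P by blast
      have "cf k (- ?h) = 0" if "k \<in> I" "k \<notin> J" for k
        using cf_parabolic[OF _ J that, of "rev xs @ ys" "sr j"] xs(1) ys(1) sr_om[OF jI that(1)] j that
        by (auto simp: elt_append)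
      then have "- elt xs (- ?h) \<in> P" using neg_on_root[OF I(1) xs(2), of "- ?h"] hP hR by simp
      then show False using g P_not_neg by (simp add: elt_uminus) 
    qed
    then show "elt (rev xs @ ys) (sr j) \<in> P" by (simp add: elt_append)
  qed (use xs ys in auto)
  then have "elt xs (elt (rev xs @ ys) v) = elt xs v" for v by simp
  then show ?thesis by (auto simp: elt_append)
qed

lemma neg_on_rev:
  assumes J: "J \<subseteq> I" and xs: "set xs \<subseteq> J" "neg_on J xs"
  shows "neg_on J (rev xs)"
  unfolding neg_on_def
proof
  fix j assume j: "j \<in> J"
  then have jI: "j \<in> I" and I: "set xs \<subseteq> I" using assms by auto
  let ?h = "elt (rev xs) (sr j)"
  have hR: "?h \<in> R" using I jI by (intro elt_root roots.simple) auto
  show "- ?h \<in> P"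
  proof (rule ccontr)
    assume "- ?h \<notin> P"
    then have "?h \<in> P" using hR root_not_P by blast
    moreover have "cf k ?h = 0" if "k \<in> I" "k \<notin> J" for k
      using cf_parabolic[OF _ J that, of "rev xs" "sr j"] xs(1) sr_om[OF jI that(1)] j that by auto
    ultimately have "- elt xs ?h \<in> P" using neg_on_root[OF I xs(2) hR] by blast
    then show False using asr_P[of j] jI P_not_neg by (simp add: asr_finite[OF jI])
  qed
qed

lemma not_neg_on_extend:
  assumes "reduced xs" "set xs \<subseteq> J" "J \<subseteq> I" "\<not> neg_on J xs"
  shows "\<exists>j\<in>J. reduced (xs @ [j])"
proof -
  obtain j where j: "j \<in> J" "- elt xs (sr j) \<notin> P" using assms(4) by (auto simp: neg_on_def)
  then have jI: "j \<in> I" using assms by auto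
  have "elt xs (sr j) \<in> R" using assms jI by (intro elt_root roots.simple) auto
  then have "elt xs (sr j) \<in> P" using j root_not_P by blast
  then have "reduced (xs @ [j])" using assms(1) jI by (simp add: reduced_snoc_iff asr_finite[OF jI])
  then show ?thesis using j by blast
qed

lemma longest_word_exists:
  assumes J: "J \<subseteq> I"
  shows "\<exists>xs. reduced xs \<and> set xs \<subseteq> J \<and> neg_on J xs \<and>
    (\<forall>ys. set ys \<subseteq> J \<longrightarrow> card (D ys) \<le> length xs)"
proof -
  let ?Q = "\<lambda>xs. reduced xs \<and> set xs \<subseteq> J"
  have bound: "length xs < Suc (card R)" if "?Q xs" for xs
  proof -
    have "length xs = card (D xs)" using that by (simp add: reduced_def)
    also have "\<dots> \<le> card R"
      using D_finite_word[of xs] that J finite_roots by (intro card_mono) auto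
    finally show ?thesis by simp
  qed
  obtain xs where xs: "?Q xs" "\<And>ys. ?Q ys \<Longrightarrow> length ys \<le> length xs"
    using ex_has_greatest_nat[of ?Q "[]" length "Suc (card R)"] bound by auto
  have "neg_on J xs"
  proof (rule ccontr)
    assume "\<not> ?thesis"
    then obtain j where "j \<in> J" "reduced (xs @ [j])" using not_neg_on_extend[of xs J] xs(1) J by blast
    then show False using xs(2)[of "xs @ [j]"] xs(1) by simp
  qed
  moreover have "card (D ys) \<le> length xs" if "set ys \<subseteq> J" for ys
  proof -
    have "wrd ys" using that J by (auto intro: I_wrd)
    then obtain zs where "reduced zs" "set zs \<subseteq> set ys" "elt zs = elt ys" by (rule reduced_word_exists)
    then show ?thesis using xs(2)[of zs] that D_cong[of zs ys] by (auto simp: reduced_def)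
  qed
  ultimately show ?thesis using xs by blast
qed

text \<open>A reduced word that is not \<open>neg_on J\<close> can be lengthened within J. So
  maximal length forces \<open>neg_on J\<close>, and uniqueness makes the definite description
  meaningful.\<close>

lemma longest_element_eq:
  assumes J: "J \<subseteq> I" and xs: "set xs \<subseteq> J" "neg_on J xs"
  shows "longest_element X n J = elt xs"
proof -
  have J0: "J \<subseteq> {0..n}" using J by fastforce
  obtain m where m: "reduced m" "set m \<subseteq> J" "neg_on J m" "\<forall>ys. set ys \<subseteq> J \<longrightarrow> card (D ys) \<le> length m"
    using longest_word_exists[OF J] by blast
  have eq: "elt xs = elt m" using neg_on_unique[OF J xs m(2,3)] .
  show ?thesis unfolding longest_element_def
  proof (rule the_equality)
    have "cox_length X n J (elt ys) \<le> cox_length X n J (elt xs)" if "set ys \<subseteq> J" for ys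
      using that m unfolding eq by (simp add: cox_length_elt[OF _ J0] reduced_def)
    then show "elt xs \<in> parabolic X n J \<and> (\<forall>w'\<in>parabolic X n J. cox_length X n J w' \<le> cox_length X n J (elt xs))"
      using xs by (auto simp: parabolic_def)
  next
    fix w assume w: "w \<in> parabolic X n J \<and> (\<forall>w'\<in>parabolic X n J. cox_length X n J w' \<le> cox_length X n J w)"
    then obtain ys where ys: "set ys \<subseteq> J" "w = elt ys" by (auto simp: parabolic_def)
    then have "wrd ys" using J0 by auto
    then obtain zs where zs: "reduced zs" "set zs \<subseteq> set ys" "elt zs = elt ys" by (rule reduced_word_exists)
    have zsJ: "set zs \<subseteq> J" using zs ys by auto
    have "neg_on J zs"
    proof (rule ccontr)
      assume "\<not> ?thesis"
      then obtain j where j: "j \<in> J" "reduced (zs @ [j])" using not_neg_on_extend[OF zs(1) zsJ J] by blast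
      have "elt (zs @ [j]) \<in> parabolic X n J"
        unfolding parabolic_def using j zsJ by (intro CollectI exI[of _ "zs @ [j]"]) auto
      then have "cox_length X n J (elt (zs @ [j])) \<le> cox_length X n J (elt zs)"
        using w ys zs by metis
      then show False using j zsJ zs(1) by (simp add: cox_length_elt[OF _ J0] reduced_def)
    qed
    then have "elt zs = elt m" using neg_on_unique[OF J zsJ _ m(2,3)] by blast
    then show "w = elt xs" using zs ys eq by simp
  qed
qed

section \<open>Translations\<close>

definition fin :: "vec \<Rightarrow> vec" where "fin v = v - scl (v 0) delta"

lemma ip_fin [simp]: "ip (fin v) w = ip v w"
  by (simp add: fin_def)

lemma fin_spn [simp]: "v \<in> spn \<Longrightarrow> fin v = v"
  by (simp add: fin_def)

text \<open>The projection of the affine Weyl group onto W; the reflection \<open>s_0\<close> goes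
  to the reflection in \<open>rho\<close>, which is a word in I because \<open>rho\<close> is a
  root.\<close>

lemma fin_elt_exists:
  "wrd xs \<Longrightarrow> \<exists>ys. set ys \<subseteq> I \<and> (\<forall>v. fin (elt xs v) = elt ys (fin v))"
proof (induction xs)
  case Nil
  then show ?case by (intro exI[of _ "[]"]) simp
next
  case (Cons j xs)
  then obtain ys where ys: "set ys \<subseteq> I" "\<And>v. fin (elt xs v) = elt ys (fin v)" by auto
  obtain zs where zs: "set zs \<subseteq> I" "\<And>v. fin (simple_refl X n j v) = elt zs (fin v)"
  proof (cases "j = 0")
    case True
    obtain zs where zs: "set zs \<subseteq> I" "elt zs = reflection X n rho"
      using rho_root by (rule root_reflection_word)
    have "fin (simple_refl X n j v) = elt zs (fin v)" for v
      using True root_in_spn[OF rho_root] unfolding zs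
      by (auto simp: fin_def reflection_def simple_refl_expand asr_0 fun_eq_iff vec_apply)
    then show ?thesis using zs that by blast
  next
    case False
    then have j: "j \<in> I" using Cons by auto
    have "fin (simple_refl X n j v) = elt [j] (fin v)" for v
      using spn_apply_0[OF sr_in_spn[OF j]] j
      by (auto simp: elt_Cons fin_def reflection_def simple_refl_finite fun_eq_iff vec_apply)
    then show ?thesis using j that[of "[j]"] by auto
  qed
  show ?case using ys zs
    by (intro exI[of _ "zs @ ys"]) (auto simp: elt_append elt_Cons)
qed

text \<open>\<open>q\<close> is a word for \<open>w\<^sub>0\<^bsup>W\<^sub>J\<^esup> w\<^sub>0\<close>, and \<open>y q\<close> is the translation by a negative multiple of
  the fundamental coweight \<open>om k\<close>.\<close>

definition translating :: "nat list \<Rightarrow> nat \<Rightarrow> nat list \<Rightarrow> real \<Rightarrow> bool" where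
  "translating y k q d \<longleftrightarrow> reduced y \<and> k \<in> I \<and> set q \<subseteq> I \<and> 0 < d \<and>
    (\<forall>\<alpha>\<in>spn. elt (y @ q) \<alpha> = \<alpha> - scl (d * cf k \<alpha>) delta) \<and>
    D q = {\<beta> \<in> R \<inter> P. 0 < cf k \<beta>}"

text \<open>Speaks only of the images of simple roots under y, so it can be checked by running the
  word, with no knowledge of longest elements.\<close>

definition criterion :: "nat \<Rightarrow> nat list \<Rightarrow> nat \<Rightarrow> bool" where
  "criterion i y k \<longleftrightarrow> i \<in> I \<and> k \<in> I \<and> reduced y \<and>
    (\<exists>p. bij_betw p (I - {i}) (I - {k}) \<and> (\<forall>j\<in>I - {i}. elt y (sr j) = sr (p j))) \<and>
    cf k (elt y (sr i)) < 0 \<and> 0 < (elt y (sr i)) 0"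

text \<open>Let g be the finite part of y and \<open>xs\<close> a longest word for I - {i}. Then g
  after \<open>xs\<close> makes all simple roots negative, so it is w0 and q is the inverse of g.
  The element y q has trivial finite part, hence is a translation, and its \<delta>-shift vanishes
  on every simple root except \<open>sr k\<close>.\<close>

lemma criterion_translating:
  assumes "criterion i y k"
  shows "\<exists>q d. translating y k q d \<and>
    longest_element X n (I - {i}) \<circ> longest_element X n I = elt q"
proof -
  obtain p where i: "i \<in> I" and k: "k \<in> I" and red: "reduced y"
    and p: "bij_betw p (I - {i}) (I - {k})" and y: "\<And>j. j \<in> I - {i} \<Longrightarrow> elt y (sr j) = sr (p j)"
    and neg: "cf k (elt y (sr i)) < 0" and pos: "0 < (elt y (sr i)) 0"
    using assms unfolding criterion_def by blast
  have pI: "p j \<in> I" "p j \<noteq> k" if "j \<in> I - {i}" for j using p that by (auto simp: bij_betw_def)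
  have p_surj: "\<exists>m. m \<in> I - {i} \<and> j = p m" if "j \<in> I" "j \<noteq> k" for j
  proof -
    have "j \<in> p ` (I - {i})" using p that by (simp add: bij_betw_def)
    then show ?thesis by blast
  qed
  obtain g where g: "set g \<subseteq> I" "\<And>v. fin (elt y v) = elt g (fin v)"
    using fin_elt_exists[OF reduced_wrd[OF red]] by blast
  have gsr: "elt g (sr j) = sr (p j)" if "j \<in> I - {i}" for j
    using g(2)[of "sr j"] y[OF that] pI[OF that] sr_in_spn that by simp
  define b where "b = elt g (sr i)"
  have bR: "b \<in> R" unfolding b_def using g i by (intro elt_root roots.simple)
  have cfb: "cf k b = cf k (elt y (sr i))"
    using g(2)[of "sr i"] sr_in_spn[OF i] by (metis b_def fin_spn ip_fin)
  \<comment> \<open>All \<open>sr j\<close> with j \<noteq> i go to simple roots other than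
    \<open>sr k\<close>, so only the coefficient at i contributes.\<close>
  have cfk_g: "cf k (elt g v) = cf i v * cf k b" if "v \<in> spn" for v
  proof -
    have "cf k (elt g v) = (\<Sum>j\<in>I. cf j v * cf k (elt g (sr j)))"
      by (subst spn_expand[OF that]) (simp only: ip_elt_comb)
    also have "\<dots> = (\<Sum>j\<in>I. if j = i then cf i v * cf k b else 0)"
    proof (rule sum.cong)
      fix j assume j: "j \<in> I"
      then show "cf j v * cf k (elt g (sr j)) = (if j = i then cf i v * cf k b else 0)"
        using gsr[of j] pI[of j] sr_om[of "p j" k] k by (cases "j = i") (auto simp: b_def)
    qed simp
    finally show ?thesis using i by simp
  qed
  let ?J = "I - {i}"
  obtain xs where xs: "set xs \<subseteq> ?J" "neg_on ?J xs" using longest_word_exists[OF Diff_subset] by blast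
  have xsI: "set xs \<subseteq> I" using xs by auto
  \<comment> \<open>On I - {i} the word \<open>xs\<close> gives negative roots without
    \<open>sr i\<close>, and g keeps their sign. The image of \<open>sr i\<close> still has
    coefficient 1 at i, which g turns into a negative coefficient at k.\<close>
  have neg_h: "neg_on I (g @ xs)"
    unfolding neg_on_def
  proof
    fix j assume j: "j \<in> I"
    have R: "elt xs (sr j) \<in> R" "elt g (elt xs (sr j)) \<in> R"
      using j g xsI by (auto intro!: elt_root roots.simple)
    have "cf i (elt xs (sr j)) = cf i (sr j)" using cf_parabolic[OF xs(1), of i] i by auto
    show "- elt (g @ xs) (sr j) \<in> P"
    proof (cases "j = i")
      case True
      then have "cf k (elt g (elt xs (sr j))) < 0"
        using cfk_g[OF root_in_spn[OF R(1)]] \<open>cf i _ = _\<close> sr_om[OF i i] cfb neg by simp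
      then have "elt g (elt xs (sr j)) \<notin> P" using k root_P_iff[OF R(2)] by force
      then show ?thesis using root_not_P[OF R(2)] by (simp add: elt_append)
    next
      case False
      then have jJ: "j \<in> ?J" using j by simp
      let ?c = "- elt xs (sr j)"
      have c: "?c \<in> R" "?c \<in> P" using R xs(2) jJ by (auto simp: neg_on_def)
      have ci: "cf i ?c = 0" using \<open>cf i _ = _\<close> sr_om[OF j i] False by simp
      have "0 \<le> cf l (elt g ?c)" if l: "l \<in> I" for l
      proof -
        have "cf l (elt g ?c) = (\<Sum>m\<in>I. cf m ?c * cf l (elt g (sr m)))"
          by (subst root_expand[OF c(1)]) (simp only: ip_elt_comb)
        also have "0 \<le> \<dots>"
        proof (intro sum_nonneg)
          fix m assume m: "m \<in> I"
          show "0 \<le> cf m ?c * cf l (elt g (sr m))"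
          proof (cases "m = i")
            case False
            then have m': "m \<in> ?J" using m by simp
            have "0 \<le> cf m ?c" using c root_P_iff[OF c(1)] m by blast
            moreover have "0 \<le> cf l (elt g (sr m))"
              using gsr[OF m'] sr_om[OF pI(1)[OF m'] l] by simp
            ultimately show ?thesis by (rule mult_nonneg_nonneg)
          qed (use ci in simp)
        qed
        finally show ?thesis .
      qed
      moreover have "elt g ?c \<in> R" using R(2) by (simp add: elt_uminus)
      ultimately have "elt g ?c \<in> P" using root_P_iff by blast
      then show ?thesis by (simp add: elt_append elt_uminus)
    qed
  qed
  have setg: "set (g @ xs) \<subseteq> I" using g xsI by simp
  \<comment> \<open>The inverse of g \<open>xs\<close> is \<open>neg_on I\<close> as well, hence
    also w0; in this form \<open>xs\<close> cancels against the longest element of I - {i}.\<close>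
  have "longest_element X n I = elt (rev (g @ xs))"
    using longest_element_eq[OF subset_refl, of "rev (g @ xs)"] neg_on_rev[OF subset_refl setg neg_h] setg by simp
  moreover have "longest_element X n ?J = elt xs" using longest_element_eq[OF _ xs] by simp
  ultimately have U: "longest_element X n ?J \<circ> longest_element X n I = elt (rev g)"
    by (auto intro!: ext simp: elt_append)
  let ?q = "rev g"
  have q: "set ?q \<subseteq> I" using g by simp
  have qsr: "elt ?q (sr (p j)) = sr j" if "j \<in> ?J" for j using gsr[OF that] by (metis elt_rev)
  define f where "f v = (elt y (elt ?q v)) 0" for v
  have T: "elt (y @ ?q) v = v + scl (f v) delta" if "v \<in> spn" for v
  proof -
    have "fin (elt y (elt ?q v)) = elt g (elt ?q v)"
      using g(2) elt_spn[OF q that] by simp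
    then have "fin (elt y (elt ?q v)) = v" by simp
    then have "elt y (elt ?q v) = v + scl (f v) delta" unfolding fin_def f_def by (simp add: diff_eq_eq)
    then show ?thesis by (simp add: elt_append)
  qed
  have f_expand: "f v = cf k v * f (sr k)" if "v \<in> spn" for v
  proof -
    have "f v = (\<Sum>j\<in>I. cf j v * f (sr j))"
      unfolding f_def by (subst spn_expand[OF that]) (simp add: elt_comb elt_sum elt_scl vec_apply)
    also have "\<dots> = (\<Sum>j\<in>I. if j = k then cf k v * f (sr k) else 0)"
    proof (rule sum.cong)
      fix j assume j: "j \<in> I"
      show "cf j v * f (sr j) = (if j = k then cf k v * f (sr k) else 0)"
      proof (cases "j = k")
        case False
        then obtain m where m: "m \<in> ?J" "j = p m" using p_surj[OF j] by blast
        then have "f (sr j) = 0" using qsr[OF m(1)] y[OF m(1)] spn_apply_0[OF sr_in_spn[OF j]]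
          by (simp add: f_def)
        then show ?thesis using False by simp
      qed simp
    qed simp
    finally show ?thesis using k by simp
  qed
  \<comment> \<open>The sign comes from the root b: its shift is the positive \<delta>-coordinate of
    \<open>y (sr i)\<close>, while its coefficient at k is negative.\<close>
  define d where "d = - f (sr k)"
  have "f b = (elt y (sr i)) 0" by (simp add: f_def b_def)
  then have "cf k b * f (sr k) > 0" using f_expand[OF root_in_spn[OF bR]] pos by simp
  then have d: "0 < d" using neg cfb by (auto simp: d_def zero_less_mult_iff)
  have "D ?q = {\<beta> \<in> R \<inter> P. 0 < cf k \<beta>}"
  proof -
    have "\<beta> \<in> D ?q \<longleftrightarrow> 0 < cf k \<beta>" if b: "\<beta> \<in> R" "\<beta> \<in> P" for \<beta>
    proof -
      have R: "elt ?q \<beta> \<in> R" using elt_root[OF q b(1)] .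
      have cf0: "0 \<le> cf l \<beta>" if "l \<in> I" for l using b root_P_iff that by blast
      have cfk: "cf k \<beta> = cf i (elt ?q \<beta>) * cf k b"
        using cfk_g[OF root_in_spn[OF R]] by simp
      show ?thesis
      proof (cases "0 < cf k \<beta>")
        case True
        then have "cf i (elt ?q \<beta>) < 0" using cfk neg cfb by (auto simp: zero_less_mult_iff)
        then have "elt ?q \<beta> \<notin> P" using root_P_iff[OF R] i by force
        then show ?thesis using True b root_not_P[OF R] by (simp add: D_def)
      next
        case False
        then have 0: "cf k \<beta> = 0" using cf0[OF k] by simp
        have "0 \<le> cf l (elt ?q \<beta>)" if l: "l \<in> I" for l
        proof -
          have "cf l (elt ?q \<beta>) = (\<Sum>m\<in>I. cf m \<beta> * cf l (elt ?q (sr m)))"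
            by (subst root_expand[OF b(1)]) (simp only: ip_elt_comb)
          also have "0 \<le> \<dots>"
          proof (intro sum_nonneg)
            fix m assume m: "m \<in> I"
            show "0 \<le> cf m \<beta> * cf l (elt ?q (sr m))"
            proof (cases "m = k")
              case False
              then obtain m' where m': "m' \<in> ?J" "m = p m'" using p_surj[OF m] by blast
              then have "0 \<le> cf l (elt ?q (sr m))" using qsr sr_om[of m' l] l by simp
              then show ?thesis using cf0[OF m] by simp
            qed (use 0 in simp)
          qed
          finally show ?thesis .
        qed
        then have "elt ?q \<beta> \<in> P" using root_P_iff[OF R] by blast
        then show ?thesis using False P_not_neg by (simp add: D_def)
      qed
    qed
    then show ?thesis using D_finite_word[OF q] by blast
  qed
  moreover have "elt (y @ ?q) v = v - scl (d * cf k v) delta" if "v \<in> spn" for v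
    using T[OF that] f_expand[OF that] by (simp add: d_def mult.commute)
  ultimately have "translating y k ?q d" using red k q d by (simp add: translating_def)
  then show ?thesis using U by blast
qed

section \<open>Periodic words\<close>

definition N :: "vec \<Rightarrow> vec set" where "N v = {z \<in> P. ip z v < 0}"

lemma P_shift_iff:
  assumes "\<alpha> \<in> R"
  shows "\<alpha> + scl (real_of_int m) delta \<in> P \<longleftrightarrow> (if \<alpha> \<in> P then 0 else 1) \<le> m"
proof -
  let ?z = "\<alpha> + scl (real_of_int m) delta"
  have z0: "?z 0 = m" using root_in_spn[OF assms] by (simp add: vec_apply)
  consider "m \<le> -1" | "m = 0" | "1 \<le> m" by linarith
  then show ?thesis
  proof cases
    case 1
    then show ?thesis using P_0_nonneg[of ?z] z0 by auto
  next
    case 3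
    then show ?thesis using P_0_pos[OF ARI[OF assms], of m] z0 by simp
  qed simp
qed

lemma P_cases:
  assumes "z \<in> P"
  obtains \<alpha> m where "\<alpha> \<in> R" "z = \<alpha> + scl (real_of_int m) delta"
  using P_in_AR[OF assms] by (auto simp: AR_def)

text \<open>On the \<delta>-string of each finite root, the inversions are the
  \<open>e \<alpha>\<close> members following the first positive one; if \<open>e \<alpha>\<close>
  is not positive there are none.\<close>

lemma card_D_translation:
  assumes w: "wrd xs" and T: "\<And>\<alpha>. \<alpha> \<in> R \<Longrightarrow> elt xs \<alpha> = \<alpha> - scl (real_of_int (e \<alpha>)) delta"
  shows "card (D xs) = (\<Sum>\<alpha>\<in>R. nat (e \<alpha>))"
proof -
  define m0 :: "vec \<Rightarrow> int" where "m0 \<alpha> = (if \<alpha> \<in> P then 0 else 1)" for \<alpha>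
  define A where "A \<alpha> = (\<lambda>m. \<alpha> + scl (real_of_int m) delta) ` {m0 \<alpha>..<m0 \<alpha> + e \<alpha>}" for \<alpha>
  have elt: "elt xs (\<alpha> + scl (real_of_int m) delta) = \<alpha> + scl (real_of_int (m - e \<alpha>)) delta"
    if "\<alpha> \<in> R" for \<alpha> m
    using T[OF that] by (simp add: elt_add elt_scl scl_diff_left)
  have D_iff: "\<alpha> + scl (real_of_int m) delta \<in> D xs \<longleftrightarrow> m0 \<alpha> \<le> m \<and> m < m0 \<alpha> + e \<alpha>" if "\<alpha> \<in> R" for \<alpha> m
  proof -
    let ?z = "\<alpha> + scl (real_of_int (m - e \<alpha>)) delta"
    have "- ?z \<in> P \<longleftrightarrow> ?z \<notin> P" by (rule neg_P_not[OF ARI[OF that], symmetric])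
    also have "\<dots> \<longleftrightarrow> m - e \<alpha> < m0 \<alpha>" unfolding P_shift_iff[OF that] m0_def by auto
    finally show ?thesis
      unfolding D_def mem_Collect_eq elt[OF that] P_shift_iff[OF that] m0_def by auto
  qed
  have "D xs = (\<Union>\<alpha>\<in>R. A \<alpha>)"
  proof (intro set_eqI iffI)
    fix z assume z: "z \<in> D xs"
    then obtain \<alpha> m where "\<alpha> \<in> R" "z = \<alpha> + scl (real_of_int m) delta" using z by (auto simp: D_def elim: P_cases)
    then have "m \<in> {m0 \<alpha>..<m0 \<alpha> + e \<alpha>}" using z D_iff by auto
    then have "z \<in> A \<alpha>" using \<open>z = _\<close> unfolding A_def by blast
    then show "z \<in> (\<Union>\<alpha>\<in>R. A \<alpha>)" using \<open>\<alpha> \<in> R\<close> by blast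
  qed (auto simp: A_def D_iff)
  moreover have "card (\<Union>\<alpha>\<in>R. A \<alpha>) = (\<Sum>\<alpha>\<in>R. card (A \<alpha>))"
  proof (intro card_UN_disjoint ballI impI)
    fix \<alpha> \<beta> assume ab: "\<alpha> \<in> R" "\<beta> \<in> R" "\<alpha> \<noteq> \<beta>"
    have "fin z = \<gamma>" if "z \<in> A \<gamma>" "\<gamma> \<in> R" for z \<gamma>
      using that root_in_spn by (auto simp: A_def fin_def vec_apply)
    then show "A \<alpha> \<inter> A \<beta> = {}" using ab by blast
  qed (auto simp: A_def finite_roots)
  moreover have "card (A \<alpha>) = nat (e \<alpha>)" if "\<alpha> \<in> R" for \<alpha>
  proof -
    have "inj_on (\<lambda>m. \<alpha> + scl (real_of_int m) delta) {m0 \<alpha>..<m0 \<alpha> + e \<alpha>}"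
    proof (rule inj_onI)
      fix x y assume "\<alpha> + scl (real_of_int x) delta = \<alpha> + scl (real_of_int y) delta"
      then have "(scl (real_of_int x) delta) 0 = (scl (real_of_int y) delta) 0" by simp
      then show "x = y" by (simp add: vec_apply)
    qed
    then show ?thesis by (simp add: A_def card_image)
  qed
  ultimately show ?thesis by simp
qed

lemma D_append_mono: "reduced (xs @ ys) \<Longrightarrow> D ys \<subseteq> D (xs @ ys)"
proof (induction xs)
  case (Cons j xs)
  then have "reduced (xs @ ys)" "D (j # (xs @ ys)) = insert (elt (rev (xs @ ys)) (asr j)) (D (xs @ ys))"
    using D_Cons_pos(1)[of "xs @ ys" j] reduced_wrd[of "xs @ ys"] by (auto simp: reduced_Cons_iff)
  then show ?case using Cons by auto
qed simp

lemma prefix_append: "prefix_word x (i + j) = prefix_word x i @ map x [i..<i + j]"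
  using upt_add_eq_append[of 0 i j] by (simp add: prefix_word_def)

lemma prefix_mono:
  assumes "inf_reduced X n x" "i \<le> j"
  shows "D (rev (prefix_word x i)) \<subseteq> D (rev (prefix_word x j))"
proof -
  obtain l where l: "j = i + l" using assms le_Suc_ex by blast
  have "reduced (rev (prefix_word x j))" using assms(1) by (simp add: inf_reduced_iff reduced_rev)
  then show ?thesis using D_append_mono[of "rev (map x [i..<i + l])" "rev (prefix_word x i)"]
    by (simp add: l prefix_append)
qed

lemma inf_inversions_eq: "inf_inversions X n x = (\<Union>j. D (rev (prefix_word x j)))"
proof -
  have "inf_inversions X n x = (\<Union>j\<in>{1..}. D (rev (prefix_word x j)))"
    by (simp add: inf_inversions_def inversions_elt)
  also have "\<dots> = (\<Union>j. D (rev (prefix_word x j)))"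
  proof -
    have 0: "D (rev (prefix_word x 0)) = {}" by (simp add: prefix_word_def)
    show ?thesis
    proof (intro equalityI subsetI)
      fix z assume "z \<in> (\<Union>j. D (rev (prefix_word x j)))"
      then obtain j where j: "z \<in> D (rev (prefix_word x j))" by blast
      then have "j \<noteq> 0" using 0 by (cases "j = 0") auto
      then show "z \<in> (\<Union>j\<in>{1..}. D (rev (prefix_word x j)))" using j by auto
    qed blast
  qed
  finally show ?thesis .
qed

lemma prefix_periodic: "prefix_word (periodic_word ws) (p * length ws) = concat (replicate p ws)"
proof (induction p)
  case (Suc p)
  have "map (periodic_word ws) [p * length ws..<p * length ws + length ws] = ws"
    by (rule nth_equalityI) (auto simp: periodic_word_def)
  then have "prefix_word (periodic_word ws) (p * length ws + length ws) = concat (replicate p ws) @ ws"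
    using prefix_append[of "periodic_word ws" "p * length ws" "length ws"] Suc by simp
  also have "\<dots> = concat (replicate (Suc p) ws)"
    using concat_append[of "replicate p ws" "[ws]"] replicate_append_same[of p ws] by simp
  finally show ?case by (simp add: add.commute)
qed (simp add: prefix_word_def)

lemma translation_power:
  assumes "\<And>\<alpha>. \<alpha> \<in> spn \<Longrightarrow> elt ws \<alpha> = \<alpha> - scl (f \<alpha>) delta" "\<alpha> \<in> spn"
  shows "elt (concat (replicate p ws)) \<alpha> = \<alpha> - scl (real p * f \<alpha>) delta"
proof (induction p)
  case (Suc p)
  have "elt (concat (replicate (Suc p) ws)) \<alpha> = elt ws (\<alpha> - scl (real p * f \<alpha>) delta)"
    by (simp add: elt_append Suc)
  also have "\<dots> = \<alpha> - scl (f \<alpha>) delta - scl (real p * f \<alpha>) delta"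
    by (simp add: elt_diff elt_scl assms)
  also have "\<dots> = \<alpha> - scl (real (Suc p) * f \<alpha>) delta"
    by (simp add: fun_eq_iff vec_apply algebra_simps)
  finally show ?case .
qed simp

text \<open>As group elements v y u is the conjugate by v of y q, so the translation vector is
  carried from \<open>om k\<close> to its image under v.\<close>

lemma translating_conj:
  assumes t: "translating y k q d" and u: "set (u @ v) \<subseteq> I" "elt (u @ v) = elt q" and a: "\<alpha> \<in> spn"
  shows "elt (v @ y @ u) \<alpha> = \<alpha> - scl (d * ip \<alpha> (elt v (om k))) delta"
proof -
  let ?b = "elt (rev v) \<alpha>"
  have b: "?b \<in> spn" using u a by (intro elt_spn) auto
  have "elt u \<alpha> = elt (u @ v) ?b" by (simp add: elt_append)
  then have "elt (y @ u) \<alpha> = elt (y @ q) ?b" using u(2) by (simp add: elt_append)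
  also have "\<dots> = ?b - scl (d * cf k ?b) delta" using t b by (simp add: translating_def)
  finally have "elt (v @ y @ u) \<alpha> = \<alpha> - scl (d * cf k ?b) delta"
    by (simp add: elt_append elt_diff elt_scl)
  then show ?thesis using ip_elt_left[of v "om k" \<alpha>] by (simp add: ip_sym[of \<alpha>] ip_sym[of ?b])
qed

text \<open>The p-th power of the word translates p times as far, so its number of inversions is p
  times that of one period. The whole claim of reducedness is thus that one period has as many
  inversions as letters.\<close>

lemma translating_periodic:
  assumes t: "translating y k q d" and u: "reduced (u @ v)" "set (u @ v) \<subseteq> I" "elt (u @ v) = elt q"
  shows "inf_reduced X n (periodic_word (v @ y @ u))"
    "inf_inversions X n (periodic_word (v @ y @ u)) = N (elt v (om k))"
proof -
  let ?ws = "v @ y @ u" and ?l = "elt v (om k)"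
  have k: "k \<in> I" and y: "reduced y" and d: "0 < d" using t by (auto simp: translating_def)
  have wu: "wrd (u @ v)" "wrd u" "wrd v" "wrd y" using u(1) y reduced_wrd[of "u @ v"] reduced_wrd[of y] by auto
  have T: "elt ?ws \<alpha> = \<alpha> - scl (d * ip \<alpha> ?l) delta" if "\<alpha> \<in> spn" for \<alpha>
    using translating_conj[OF t u(2,3) that] .
  have wws: "wrd ?ws" using wu by auto
  \<comment> \<open>The floor is exact: the word maps affine roots to affine roots, so the
    \<delta>-shift of a root is an integer.\<close>
  define e where "e \<alpha> = \<lfloor>d * ip \<alpha> ?l\<rfloor>" for \<alpha>
  have e: "d * ip \<alpha> ?l = real_of_int (e \<alpha>)" if a: "\<alpha> \<in> R" for \<alpha>
  proof -
    have "elt ?ws \<alpha> \<in> AR" using elt_AR[OF wws root_in_AR[OF a]] .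
    then obtain \<beta> m where b: "\<beta> \<in> R" "\<alpha> - scl (d * ip \<alpha> ?l) delta = \<beta> + scl (real_of_int m) delta"
      using T[OF root_in_spn[OF a]] by (auto simp: AR_def)
    have "- (d * ip \<alpha> ?l) = m"
      using arg_cong[OF b(2), of "\<lambda>v. v 0"] root_in_spn[OF a] root_in_spn[OF b(1)] by (simp add: vec_apply)
    then have "d * ip \<alpha> ?l = real_of_int (- m)" by simp
    then show ?thesis unfolding e_def by (metis floor_of_int)
  qed
  have Tp: "elt (concat (replicate p ?ws)) \<alpha> = \<alpha> - scl (real_of_int (int p * e \<alpha>)) delta" if "\<alpha> \<in> R" for \<alpha> p
    using translation_power[of ?ws "\<lambda>\<alpha>. d * ip \<alpha> ?l", OF T root_in_spn[OF that]] e[OF that] by simp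
  have wp: "wrd (concat (replicate p ?ws))" for p using wws by (induction p) auto
  have cardp: "card (D (concat (replicate p ?ws))) = p * (\<Sum>\<alpha>\<in>R. nat (e \<alpha>))" for p
    using card_D_translation[OF wp Tp] by (simp add: nat_mult_distrib sum_distrib_left)
  \<comment> \<open>Since v permutes the roots, v y u and y u v have equally many inversions, and
    the latter splits as y followed by an expression of q.\<close>
  have "(\<Sum>\<alpha>\<in>R. nat (e \<alpha>)) = card (D (y @ u @ v))"
  proof -
    have bij: "bij_betw (elt v) R R"
      using elt_root[of v] elt_root[of "rev v"] u(2)
      by (intro bij_betwI[where g = "elt (rev v)"]) auto
    have ev: "e (elt v \<alpha>) = \<lfloor>d * cf k \<alpha>\<rfloor>" for \<alpha> by (simp add: e_def ip_elt)
    have Ty: "elt (y @ u @ v) \<alpha> = \<alpha> - scl (real_of_int (e (elt v \<alpha>))) delta" if "\<alpha> \<in> R" for \<alpha>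
    proof -
      have "elt (y @ u @ v) \<alpha> = elt (y @ q) \<alpha>" using u(3) by (simp add: elt_append_comp)
      also have "\<dots> = \<alpha> - scl (d * cf k \<alpha>) delta"
        using t root_in_spn[OF that] by (simp add: translating_def)
      also have "d * cf k \<alpha> = real_of_int (e (elt v \<alpha>))"
        using e[of "elt v \<alpha>"] elt_root[of v \<alpha>] u(2) that by (simp add: ip_elt)
      finally show ?thesis .
    qed
    have "card (D (y @ u @ v)) = (\<Sum>\<alpha>\<in>R. nat (e (elt v \<alpha>)))"
      using wu by (intro card_D_translation Ty) auto
    also have "\<dots> = (\<Sum>\<alpha>\<in>R. nat (e \<alpha>))"
      using bij by (rule sum.reindex_bij_betw)
    finally show ?thesis by simp
  qed
  also have "\<dots> = length ?ws"
  proof -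
    \<comment> \<open>Lengths add: inversions of q have positive coefficient at k, and the
      translation by a negative multiple of \<open>om k\<close> moves exactly such roots
      downwards.\<close>
    have "D (u @ v) \<subseteq> D (y @ u @ v)"
    proof
      fix b assume "b \<in> D (u @ v)"
      then have "b \<in> D q" using D_cong[OF u(3)] by simp
      then have b: "b \<in> R" "b \<in> P" "0 < cf k b" using t by (auto simp: translating_def)
      have "elt (y @ u @ v) b = elt (y @ q) b" using u(3) by (simp add: elt_append_comp)
      also have "\<dots> = b - scl (d * cf k b) delta"
        using t root_in_spn[OF b(1)] by (simp add: translating_def)
      finally have "(- elt (y @ u @ v) b) 0 > 0" using d b root_in_spn[OF b(1)] by (simp add: vec_apply)
      moreover have "- elt (y @ u @ v) b \<in> AR"
        using wu b root_in_AR by (intro AR_uminus elt_AR) auto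
      ultimately show "b \<in> D (y @ u @ v)" using b P_0_pos by (simp add: D_def)
    qed
    then have "card (D (y @ u @ v)) = card (D y) + card (D (u @ v))"
      by (rule card_D_append[OF wu(4,1)])
    then show ?thesis using y u(1) by (simp add: reduced_def)
  qed
  finally have redp: "reduced (concat (replicate p ?ws))" for p
    using wp cardp by (simp add: reduced_def length_concat sum_list_replicate)
  \<comment> \<open>\<open>periodic_word\<close> indexes modulo the length, so the period must be
    nonempty; an empty one would be the trivial translation.\<close>
  have ws0: "length ?ws > 0"
  proof (rule ccontr)
    assume "\<not> ?thesis"
    then have "?ws = []" by simp
    then have "scl (d * ip (sr k) (om k)) delta = 0"
      using T[OF sr_in_spn[OF k]] by simp
    then have "d * ip (sr k) (om k) = 0" by (auto dest: fun_cong[of _ _ 0] simp: vec_apply)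
    then show False using d sr_om[OF k k] by simp
  qed
  have pre: "\<exists>l. prefix_word (periodic_word ?ws) (j * length ?ws) = prefix_word (periodic_word ?ws) j @ l" for j
  proof -
    have "j \<le> j * length ?ws" using ws0 by (cases "length ?ws") auto
    then obtain i where "j * length ?ws = j + i" using le_Suc_ex by blast
    then show ?thesis using prefix_append[of "periodic_word ?ws" j i] by metis
  qed
  show red: "inf_reduced X n (periodic_word ?ws)"
    unfolding inf_reduced_iff
  proof
    fix j
    obtain l where "prefix_word (periodic_word ?ws) (j * length ?ws) = prefix_word (periodic_word ?ws) j @ l"
      using pre by blast
    then show "reduced (prefix_word (periodic_word ?ws) j)"
      using redp[of j] reduced_appendD1 unfolding prefix_periodic by metis
  qed
  have inv: "elt (rev (concat (replicate p ?ws))) (\<alpha> + scl (real_of_int m) delta) =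
      \<alpha> + scl (real_of_int (m + int p * e \<alpha>)) delta" if "\<alpha> \<in> R" for \<alpha> m p
    using Tp[OF that, of p] by (simp add: elt_rev_eq_iff elt_add elt_scl scl_add_left)
  have "inf_inversions X n (periodic_word ?ws) = (\<Union>p. D (rev (concat (replicate p ?ws))))"
  proof -
    have "D (rev (prefix_word (periodic_word ?ws) j)) \<subseteq> D (rev (concat (replicate j ?ws)))" for j
    proof -
      have "j \<le> j * length ?ws" using ws0 by (cases "length ?ws") auto
      then show ?thesis using prefix_mono[OF red] unfolding prefix_periodic[symmetric] by blast
    qed
    moreover have "D (rev (concat (replicate p ?ws))) \<subseteq> (\<Union>j. D (rev (prefix_word (periodic_word ?ws) j)))" for p
      unfolding prefix_periodic[symmetric] by blast
    ultimately show ?thesis unfolding inf_inversions_eq by blast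
  qed
  also have "\<dots> = N ?l"
  proof (intro set_eqI iffI)
    fix z assume "z \<in> (\<Union>p. D (rev (concat (replicate p ?ws))))"
    then obtain p where z: "z \<in> P" "- elt (rev (concat (replicate p ?ws))) z \<in> P" by (auto simp: D_def)
    obtain \<alpha> m where a: "\<alpha> \<in> R" "z = \<alpha> + scl (real_of_int m) delta" using z(1) by (rule P_cases)
    have "e \<alpha> < 0"
    proof (rule ccontr)
      assume "\<not> ?thesis"
      then have "m \<le> m + int p * e \<alpha>" by simp
      then have "elt (rev (concat (replicate p ?ws))) z \<in> P"
        using z(1) P_shift_iff[OF a(1)] unfolding a(2) inv[OF a(1)] by (meson order_trans)
      then show False using z P_not_neg by blast
    qed
    then have "d * ip \<alpha> ?l < 0" using e[OF a(1)] by simp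
    then have "ip \<alpha> ?l < 0" using d by (simp add: mult_less_0_iff)
    then show "z \<in> N ?l" using z a by (simp add: N_def)
  next
    fix z assume "z \<in> N ?l"
    then have z: "z \<in> P" "ip z ?l < 0" by (auto simp: N_def)
    obtain \<alpha> m where a: "\<alpha> \<in> R" "z = \<alpha> + scl (real_of_int m) delta" using z(1) by (rule P_cases)
    have "d * ip \<alpha> ?l < 0" using z(2) a d by (simp add: mult_less_0_iff)
    then have e0: "e \<alpha> < 0" using e[OF a(1)] by simp
    \<comment> \<open>Each period lowers the \<delta>-coordinate by at least 1, so this many periods
      make it negative.\<close>
    define p where "p = nat (\<bar>m\<bar> + 1)"
    have "int p * e \<alpha> \<le> int p * (-1)" using e0 by (intro mult_left_mono) auto
    then have "m + int p * e \<alpha> < 0" by (simp add: p_def)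
    then have "elt (rev (concat (replicate p ?ws))) z \<notin> P"
      unfolding a(2) inv[OF a(1)] P_shift_iff[OF a(1)] by auto
    moreover have "elt (rev (concat (replicate p ?ws))) z \<in> AR"
      using wp P_in_AR[OF z(1)] by (intro elt_AR) auto
    ultimately have "z \<in> D (rev (concat (replicate p ?ws)))" using z neg_P_not by (simp add: D_def)
    then show "z \<in> (\<Union>p. D (rev (concat (replicate p ?ws))))" by blast
  qed
  finally show "inf_inversions X n (periodic_word ?ws) = N ?l" .
qed

text \<open>Choosing \<open>v\<close> of minimal length among all words moving \<open>om k\<close> to a given point of its
  orbit makes every inversion of \<open>v\<close> one of \<open>q\<close>, so that \<open>v\<close> is a final segment of a
  reduced expression.\<close>

lemma translating_cover:
  assumes t: "translating y k q d" and w: "set w \<subseteq> I"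
  shows "\<exists>u v. reduced (u @ v) \<and> set (u @ v) \<subseteq> I \<and> elt (u @ v) = elt q \<and> elt v (om k) = elt w (om k)"
proof -
  have k: "k \<in> I" and q: "set q \<subseteq> I" and Dq: "D q = {\<beta> \<in> R \<inter> P. 0 < cf k \<beta>}"
    using t by (auto simp: translating_def)
  let ?Q = "\<lambda>v. set v \<subseteq> I \<and> elt v (om k) = elt w (om k)"
  obtain v where v: "?Q v" "\<And>v'. ?Q v' \<Longrightarrow> length v \<le> length v'"
    using ex_has_least_nat[of ?Q w length] w by blast
  have wv: "wrd v" "wrd q" using v q by (auto intro: I_wrd)
  have red: "reduced v"
  proof (rule ccontr)
    assume "\<not> ?thesis"
    then obtain v' where "set v' \<subseteq> set v" "length v' < length v" "elt v' = elt v" using deletion[OF wv(1)] by blast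
    then show False using v(1) v(2)[of v'] by auto
  qed
  have sub: "D v \<subseteq> D q"
  proof
    fix b assume b: "b \<in> D v"
    then have bP: "b \<in> R" "b \<in> P" using D_finite_word v by auto
    have "cf k b \<noteq> 0"
    proof
      assume 0: "cf k b = 0"
      have "elt v b \<notin> P" using b P_not_neg by (auto simp: D_def)
      then obtain p j r where pr: "v = p @ [j] @ r" "elt r b = asr j"
        using strong_exchange[OF bP(2) _ wv(1)] by blast
      \<comment> \<open>The letter j at which b changes sign then fixes the image of
        \<open>om k\<close> under r, so dropping it contradicts minimality.\<close>
      have "ip (elt r (om k)) (asr j) = 0" using 0 by (simp add: ip_elt ip_sym[of _ b] flip: pr(2))
      then have "elt (p @ r) (om k) = elt v (om k)"
        by (simp add: pr(1) elt_append elt_Cons simple_refl_def reflection_orth)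
      then show False using v(1) v(2)[of "p @ r"] pr(1) by auto
    qed
    moreover have "0 \<le> cf k b" using bP root_P_iff k by blast
    ultimately show "b \<in> D q" using Dq bP by simp
  qed
  have "wrd (q @ rev v)" using wv by simp
  then obtain u where u: "reduced u" "set u \<subseteq> set (q @ rev v)" "elt u = elt (q @ rev v)"
    by (rule reduced_word_exists)
  have uv: "elt (u @ v) = elt q" using u(3) by (auto intro!: ext simp: elt_append)
  have "card (D (u @ v)) = card (D u) + card (D v)"
    using sub D_cong[OF uv] by (intro card_D_append reduced_wrd u red) auto
  then have "reduced (u @ v)" using u(1) red by (simp add: reduced_def)
  moreover have "set (u @ v) \<subseteq> I" using u(2) v q by auto
  ultimately show ?thesis using uv v(1) by blast
qed

section \<open>Minimal infinite reduced words\<close>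

text \<open>For the last letter j of w, the remaining word sends \<open>sr j\<close> to a positive
  root, so dominance of the image gives \<open>ip (sr j) \<mu> \<le> 0\<close>. Hence j fixes \<mu>
  and can be stripped.\<close>

lemma dominant_orbit:
  assumes w: "reduced w" "set w \<subseteq> I" and m: "\<And>j. j \<in> I \<Longrightarrow> 0 \<le> ip (sr j) \<mu>"
    and dom: "\<And>j. j \<in> I \<Longrightarrow> 0 \<le> ip (sr j) (elt w \<mu>)"
  shows "elt w \<mu> = \<mu>"
  using w dom
proof (induction w rule: rev_induct)
  case (snoc j w)
  have j: "j \<in> I" and w: "reduced w" "set w \<subseteq> I" and P: "elt w (sr j) \<in> P"
    using snoc.prems by (auto simp: reduced_snoc_iff asr_finite)
  have R: "elt w (sr j) \<in> R" using w j by (intro elt_root roots.simple)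
  have "elt (w @ [j]) (sr j) = - elt w (sr j)"
    using simple_refl_asr[of j] j by (simp add: elt_append elt_Cons asr_finite[OF j] elt_uminus)
  then have "ip (sr j) \<mu> = - ip (elt w (sr j)) (elt (w @ [j]) \<mu>)"
    using ip_elt[of "w @ [j]" "sr j" \<mu>] by simp
  also have "\<dots> = - (\<Sum>l\<in>I. cf l (elt w (sr j)) * ip (sr l) (elt (w @ [j]) \<mu>))"
    by (subst (1) root_expand[OF R]) (simp only: ip_comb)
  also have "\<dots> \<le> 0"
  proof -
    have "0 \<le> cf l (elt w (sr j)) * ip (sr l) (elt (w @ [j]) \<mu>)" if "l \<in> I" for l
      using root_P_iff[OF R] P snoc.prems(3)[OF that] that by simp
    then have "0 \<le> (\<Sum>l\<in>I. cf l (elt w (sr j)) * ip (sr l) (elt (w @ [j]) \<mu>))" by (rule sum_nonneg)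
    then show ?thesis by simp
  qed
  finally have "ip (sr j) \<mu> = 0" using m[OF j] by simp
  then have "elt (w @ [j]) \<mu> = elt w \<mu>"
    using j by (simp add: elt_append elt_Cons simple_refl_finite reflection_orth ip_sym[of \<mu>])
  then show ?case using snoc.IH[OF w] snoc.prems by simp
qed simp

lemma om_dominant: "j \<in> I \<Longrightarrow> l \<in> I \<Longrightarrow> 0 \<le> ip (sr j) (om l)"
  by (simp add: sr_om)

text \<open>Move both vectors by the inverse of v. The inclusion says that roots negative on \<nu>
  are negative on \<open>om k\<close>; hence \<nu> is dominant, so it equals \<open>om l\<close>,
  and testing with - \<open>sr l\<close> yields l = k.\<close>

lemma N_subset_eq:
  assumes w: "set w \<subseteq> I" and v: "set v \<subseteq> I" and l: "l \<in> I" and k: "k \<in> I"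
    and sub: "N (elt w (om l)) \<subseteq> N (elt v (om k))"
  shows "elt w (om l) = elt v (om k)"
proof -
  have wr: "wrd (rev v @ w)" using w v I_wrd[of w] I_wrd[of v] by simp
  then obtain r where r: "reduced r" "set r \<subseteq> set (rev v @ w)" "elt r = elt (rev v @ w)"
    by (rule reduced_word_exists)
  define \<nu> where "\<nu> = elt r (om l)"
  have \<nu>: "\<nu> = elt (rev v) (elt w (om l))" by (simp add: \<nu>_def r elt_append)
  have key: "ip a (om k) < 0" if a: "a \<in> R" "ip a \<nu> < 0" for a
  proof -
    let ?b = "elt v a"
    \<comment> \<open>Adding one \<delta> gives a positive affine root whatever the sign of the
      finite one, so the inclusion can be tested on every finite root.\<close>
    let ?z = "?b + scl (real_of_int 1) delta"
    have b: "?b \<in> R" using elt_root[OF v a(1)] .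
    have "ip ?b (elt w (om l)) = ip a \<nu>" unfolding \<nu> by (rule ip_elt_left)
    then have "?z \<in> N (elt w (om l))" using a P_shift_iff[OF b, of 1] by (simp add: N_def)
    then have "?z \<in> N (elt v (om k))" using sub by blast
    then show ?thesis by (simp add: N_def ip_elt)
  qed
  have "0 \<le> ip (sr j) \<nu>" if "j \<in> I" for j
    using key[OF roots.simple[OF that]] om_dominant[OF that k] by force
  then have "\<nu> = om l"
    using dominant_orbit[OF r(1) _ om_dominant[OF _ l]] r(2) w v unfolding \<nu>_def by auto
  moreover have "l = k"
  proof -
    have "ip (- sr l) \<nu> < 0" using \<open>\<nu> = om l\<close> sr_om[OF l l] by simp
    then have "ip (- sr l) (om k) < 0" using key[of "- sr l"] roots.simple[OF l] by simp
    then show ?thesis using sr_om[OF l k] by (simp split: if_splits)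
  qed
  ultimately have "elt (rev v) (elt w (om l)) = om k" using \<nu> by simp
  then show ?thesis by (metis elt_rev')
qed

text \<open>Minimise the number of positive roots negative on the image of \<mu>. If
  \<open>sr j\<close> is one of them, applying the reflection j removes it and permutes the
  others.\<close>

lemma dominant_exists: "\<exists>w. set w \<subseteq> I \<and> (\<forall>j\<in>I. 0 \<le> ip (sr j) (elt w \<mu>))"
proof -
  define A where "A w = {a \<in> R \<inter> P. ip a (elt w \<mu>) < 0}" for w
  obtain w where w: "set w \<subseteq> I" "\<And>w'. set w' \<subseteq> I \<Longrightarrow> card (A w) \<le> card (A w')"
    using ex_has_least_nat[of "\<lambda>w. set w \<subseteq> I" "[]" "\<lambda>w. card (A w)"] by auto
  have "0 \<le> ip (sr j) (elt w \<mu>)" if j: "j \<in> I" for j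
  proof (rule ccontr)
    assume neg: "\<not> ?thesis"
    let ?s = "simple_refl X n j"
    have s: "?s = elt [j]" by (auto intro!: ext simp: elt_Cons)
    have jn: "j \<le> n" and jP: "sr j \<in> P" using j asr_P[of j] by (auto simp: asr_finite[OF j])
    have srj: "?s (sr j) = - sr j" using simple_refl_asr[OF jn] by (simp add: asr_finite[OF j])
    have ips: "ip (?s a) b = ip a (?s b)" for a b using ip_elt_left[of "[j]" a b] by (simp add: s)
    have "?s ` A (j # w) \<subseteq> A w - {sr j}"
    proof
      fix b assume "b \<in> ?s ` A (j # w)"
      then obtain a where a: "a \<in> R" "a \<in> P" "ip a (?s (elt w \<mu>)) < 0" "b = ?s a"
        by (auto simp: A_def elt_Cons)
      have n1: "a \<noteq> sr j" using a(3) neg ips[of "sr j" "elt w \<mu>"] by (auto simp: srj)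
      have "b \<in> P" using simple_refl_P[OF jn a(2)] n1 a(4) by (simp add: asr_finite[OF j])
      moreover have "b \<in> R" using elt_root[of "[j]" a] j a by (simp add: elt_Cons)
      moreover have "ip b (elt w \<mu>) < 0" using a ips by simp
      moreover have "b \<noteq> sr j"
      proof
        assume "b = sr j"
        then have "a = - sr j" using srj a(4) by (metis simple_refl_twice)
        then show False using a(2) jP P_not_neg by simp
      qed
      ultimately show "b \<in> A w - {sr j}" by (simp add: A_def)
    qed
    moreover have fin: "finite (A w)" using finite_roots by (simp add: A_def)
    ultimately have "card (?s ` A (j # w)) \<le> card (A w - {sr j})" by (intro card_mono) auto
    moreover have "card (?s ` A (j # w)) = card (A (j # w))"
      by (rule card_image) (auto simp: inj_on_def s simp del: simple_refl_twice)
    moreover have "sr j \<in> A w" using neg j jP by (simp add: A_def roots.simple)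
    then have "card (A w - {sr j}) < card (A w)" using fin by (rule card_Diff1_less[rotated])
    ultimately show False using w(2)[of "j # w"] w(1) j by auto
  qed
  then show ?thesis using w by blast
qed

text \<open>Along an infinite reduced word the \<open>\<delta>\<close>-coordinates of the inverse images of a finite root
  tend to \<open>-\<infinity>\<close> or stay bounded below. By the pigeonhole principle two of these coordinate
  functionals agree on the roots on which all of them are bounded; their difference is the vector
  \<open>\<mu>\<close> of the proof, and any fundamental coweight on a ray of the face containing it will do.\<close>

lemma inf_reduced_contains_N:
  assumes x: "inf_reduced X n x"
  shows "\<exists>k\<in>I. \<exists>w. set w \<subseteq> I \<and> N (elt w (om k)) \<subseteq> inf_inversions X n x"
proof -
  \<comment> \<open>\<open>g j\<close> represents the inverse of the j-th prefix, so its set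
    \<open>D\<close> consists of the inversions of that prefix and has j elements.\<close>
  define g where "g j = rev (prefix_word x j)" for j
  define f where "f j a = (elt (g j) a) 0" for j a
  have red: "reduced (g j)" for j using x by (simp add: g_def inf_reduced_iff reduced_rev)
  then have wg: "wrd (g j)" for j by (rule reduced_wrd)
  have cardg: "card (D (g j)) = j" for j using red[of j] by (simp add: reduced_def g_def prefix_word_def)
  have mono: "D (g i) \<subseteq> D (g j)" if "i \<le> j" for i j using prefix_mono[OF x that] by (simp add: g_def)
  have inv: "inf_inversions X n x = (\<Union>j. D (g j))" by (simp add: inf_inversions_eq g_def)
  have f_int: "f j a = of_int \<lfloor>f j a\<rfloor>" if "a \<in> R" for j a
  proof -
    have "elt (g j) a \<in> AR" using elt_AR[OF wg root_in_AR[OF that]] .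
    then obtain b m where b: "b \<in> R" "elt (g j) a = b + scl (real_of_int m) delta" by (auto simp: AR_def)
    then have "f j a = m" using root_in_spn[OF b(1)] by (simp add: f_def vec_apply)
    then show ?thesis by simp
  qed
  have f_neg: "f j (- a) = - f j a" for j a by (simp add: f_def elt_uminus vec_apply)
  have f_comb: "f j a = (\<Sum>l\<in>I. cf l a * f j (sr l))" if "a \<in> R" for j a
    unfolding f_def by (subst root_expand[OF that]) (simp add: elt_comb vec_apply)
  have elt_shift: "(elt (g j) (a + scl c delta)) 0 = f j a + c" for j a c
    by (simp add: f_def elt_add elt_scl vec_apply)
  have in_D: "a + scl (real_of_int m) delta \<in> D (g j)"
    if a: "a \<in> R" "a + scl (real_of_int m) delta \<in> P" "f j a + m < 0" for a j and m :: int
  proof -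
    let ?z = "a + scl (real_of_int m) delta"
    have "elt (g j) ?z \<in> AR" using elt_AR[OF wg ARI[OF a(1)]] .
    moreover have "elt (g j) ?z \<notin> P" using P_0_nonneg[of "elt (g j) ?z"] elt_shift a(3) by force
    ultimately show ?thesis using a neg_P_not by (simp add: D_def)
  qed
  have D_f: "f j a + m \<le> 0" if a: "a \<in> R" "a + scl (real_of_int m) delta \<in> D (g j)" for a j and m :: int
  proof (rule ccontr)
    assume "\<not> ?thesis"
    then have "elt (g j) (a + scl (real_of_int m) delta) \<in> P"
      using elt_AR[OF wg ARI[OF a(1)], of j m] elt_shift by (intro P_0_pos) auto
    then show False using a(2) P_not_neg by (auto simp: D_def)
  qed
  define S where "S = {a \<in> R. \<forall>M::real. \<exists>j. f j a < M}"
  have S_lim: "\<exists>i. \<forall>j\<ge>i. f j a < M" if a: "a \<in> S" for a M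
  proof -
    have aR: "a \<in> R" using a by (simp add: S_def)
    \<comment> \<open>m \<ge> 1 makes \<open>a + m \<delta>\<close> positive for either sign of a.
      Once this root is an inversion it remains one, which keeps \<open>f j a\<close> at or below -
      m from then on.\<close>
    define m where "m = max 1 (\<lfloor>- M\<rfloor> + 1)"
    have m: "1 \<le> m" "- M < m" by (auto simp: m_def max_def)
    obtain i where i: "f i a < - real_of_int m" using a unfolding S_def by blast
    have zP: "a + scl (real_of_int m) delta \<in> P" using P_shift_iff[OF aR, of m] m by simp
    have "f j a < M" if "i \<le> j" for j
    proof -
      have "a + scl (real_of_int m) delta \<in> D (g j)"
        using in_D[OF aR zP, of i] i mono[OF that] by auto
      then have "f j a + m \<le> 0" by (rule D_f[OF aR])
      then show ?thesis using m by simp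
    qed
    then show ?thesis by blast
  qed
  have S_sub: "z \<in> inf_inversions X n x" if z: "z \<in> P" "z = a + scl (real_of_int m) delta" "a \<in> S" for z a and m :: int
  proof -
    have aR: "a \<in> R" using z(3) by (simp add: S_def)
    obtain j where "f j a < - real_of_int m" using z(3) unfolding S_def by blast
    then have "f j a + m < 0" by simp
    then show ?thesis using in_D[OF aR] z inv by blast
  qed
  have S_neg: "- a \<notin> S" if a: "a \<in> S" for a
  proof
    assume "- a \<in> S"
    then obtain i i' where "\<forall>j\<ge>i. f j a < 0" "\<forall>j\<ge>i'. f j (- a) < 0" using S_lim[OF a] S_lim[of "- a"] by blast
    then have "f (max i i') a < 0" "f (max i i') (- a) < 0" by auto
    then show False by (simp add: f_neg)
  qed
  have bounded: "\<exists>M. \<forall>j. - M \<le> f j a \<and> f j a \<le> M" if a: "a \<in> R" "a \<notin> S" "- a \<notin> S" for a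
  proof -
    obtain M1 where M1: "\<And>j. M1 \<le> f j a" using a by (auto simp: S_def not_less)
    obtain M2 where M2: "\<And>j. M2 \<le> f j (- a)" using a by (auto simp: S_def not_less)
    have "- (\<bar>M1\<bar> + \<bar>M2\<bar>) \<le> f j a \<and> f j a \<le> \<bar>M1\<bar> + \<bar>M2\<bar>" for j
      using M1[of j] M2[of j] unfolding f_neg by linarith
    then show ?thesis by blast
  qed
  define R0 where "R0 = {a \<in> R. a \<notin> S \<and> - a \<notin> S}"
  have "\<forall>a\<in>R0. \<exists>M. \<forall>j. - M \<le> f j a \<and> f j a \<le> M" using bounded by (simp add: R0_def)
  then obtain M where M: "\<And>a j. a \<in> R0 \<Longrightarrow> - M a \<le> f j a \<and> f j a \<le> M a" by metis
  \<comment> \<open>Otherwise all these coordinates are bounded, and one finite set would contain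
    inversion sets of every size.\<close>
  have S_ne: "S \<noteq> {}"
  proof
    assume "S = {}"
    then have R0: "R0 = R" by (simp add: R0_def)
    define F where "F = (\<Union>a\<in>R. (\<lambda>m. a + scl (real_of_int m) delta) ` {0..\<lfloor>M a\<rfloor>})"
    have F: "finite F" using finite_roots by (simp add: F_def)
    have "D (g j) \<subseteq> F" for j
    proof
      fix z assume z: "z \<in> D (g j)"
      then obtain a m where a: "a \<in> R" "z = a + scl (real_of_int m) delta" using z by (auto simp: D_def elim: P_cases)
      have "f j a + m \<le> 0" using D_f[OF a(1)] z a(2) by simp
      then have "m \<le> M a" using M[of a j] a R0 by simp
      then have "m \<le> \<lfloor>M a\<rfloor>" by (simp add: le_floor_iff)
      moreover have "0 \<le> m" using z P_shift_iff[OF a(1), of m] a(2) by (auto simp: D_def split: if_splits)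
      ultimately have "z \<in> (\<lambda>m. a + scl (real_of_int m) delta) ` {0..\<lfloor>M a\<rfloor>}"
        unfolding a(2) by (intro imageI) simp
      then show "z \<in> F" using a(1) unfolding F_def by blast
    qed
    then have "card (D (g (Suc (card F)))) \<le> card F" using F by (intro card_mono)
    then show False by (simp add: cardg)
  qed
  have finS: "finite S" using finite_roots by (simp add: S_def)
  define key where "key j = restrict (\<lambda>a. \<lfloor>f j a\<rfloor>) R0" for j
  have "range key \<subseteq> PiE R0 (\<lambda>a. {\<lfloor>- M a\<rfloor>..\<lfloor>M a\<rfloor>})"
    using M by (auto simp: key_def intro!: floor_mono)
  moreover have "finite (PiE R0 (\<lambda>a. {\<lfloor>- M a\<rfloor>..\<lfloor>M a\<rfloor>}))"
    using finite_roots by (intro finite_PiE) (auto simp: R0_def)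
  ultimately have "finite (range key)" by (rule finite_subset)
  then obtain i where i: "infinite {j. key j = key i}"
    using pigeonhole_infinite[of UNIV key] infinite_UNIV_nat by auto
  have "\<forall>a\<in>S. \<forall>\<^sub>F j in sequentially. f j a < f i a"
    using S_lim by (auto simp: eventually_sequentially)
  then have "\<forall>\<^sub>F j in sequentially. \<forall>a\<in>S. f j a < f i a"
    using finS by (simp add: eventually_ball_finite_distrib)
  then obtain i' where i': "\<And>j. i' \<le> j \<Longrightarrow> \<forall>a\<in>S. f j a < f i a"
    by (auto simp: eventually_sequentially)
  obtain j where j: "i' \<le> j" "key j = key i" using i unfolding infinite_nat_iff_unbounded_le by blast
  \<comment> \<open>Defined by duality so that its product with a root is the difference of the
    functionals at j and i: zero on \<open>R0\<close>, negative on \<open>S\<close>, positive on the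
    negatives of \<open>S\<close>.\<close>
  define \<mu> where "\<mu> = (\<Sum>l\<in>I. scl (f j (sr l) - f i (sr l)) (om l))"
  have ip_mu: "ip a \<mu> = f j a - f i a" if "a \<in> R" for a
    by (simp add: \<mu>_def ip_sum_right f_comb[OF that] sum_subtractf right_diff_distrib left_diff_distrib mult.commute)
  have mu_S: "a \<in> S" if a: "a \<in> R" "ip a \<mu> < 0" for a
  proof (rule ccontr)
    assume "a \<notin> S"
    show False
    proof (cases "- a \<in> S")
      case True
      then have "f j (- a) < f i (- a)" using i'[OF j(1)] by blast
      then show False using a ip_mu by (simp add: f_neg)
    next
      case False
      then have "a \<in> R0" using a \<open>a \<notin> S\<close> by (simp add: R0_def)
      then have "\<lfloor>f j a\<rfloor> = \<lfloor>f i a\<rfloor>" using fun_cong[OF j(2), of a] by (simp add: key_def)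
      then have "f j a = f i a" using f_int[OF a(1)] by metis
      then show False using a ip_mu by simp
    qed
  qed
  obtain a0 where a0: "a0 \<in> S" using S_ne by blast
  then have a0R: "a0 \<in> R" by (simp add: S_def)
  have a0neg: "ip a0 \<mu> < 0" using i'[OF j(1)] a0 ip_mu[OF a0R] by auto
  obtain w where w: "set w \<subseteq> I" "\<And>l. l \<in> I \<Longrightarrow> 0 \<le> ip (sr l) (elt w \<mu>)"
    using dominant_exists by blast
  have expand: "ip a \<mu> = (\<Sum>l\<in>I. cf l (elt w a) * ip (sr l) (elt w \<mu>))" if "a \<in> R" for a
  proof -
    have "ip a \<mu> = ip (elt w a) (elt w \<mu>)" by (simp add: ip_elt)
    also have "\<dots> = (\<Sum>l\<in>I. cf l (elt w a) * ip (sr l) (elt w \<mu>))"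
      by (subst (1) root_expand[OF elt_root[OF w(1) that]]) (simp only: ip_comb)
    finally show ?thesis .
  qed
  have "\<exists>k\<in>I. ip (sr k) (elt w \<mu>) \<noteq> 0"
  proof (rule ccontr)
    assume "\<not> ?thesis"
    then have "ip a0 \<mu> = 0" unfolding expand[OF a0R] by (intro sum.neutral) auto
    then show False using a0neg by simp
  qed
  then obtain k where k: "k \<in> I" "0 < ip (sr k) (elt w \<mu>)" using w(2) by force
  \<comment> \<open>A root with negative coefficient at k has no positive coefficient. Against the
    dominant vector every term is then nonpositive and the k-th one negative, so the root lies in
    \<open>S\<close>.\<close>
  have "N (elt (rev w) (om k)) \<subseteq> inf_inversions X n x"
  proof
    fix z assume "z \<in> N (elt (rev w) (om k))"
    then have z: "z \<in> P" "ip z (elt (rev w) (om k)) < 0" by (auto simp: N_def)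
    obtain a m where a: "a \<in> R" "z = a + scl (real_of_int m) delta" using z(1) by (rule P_cases)
    have neg: "cf k (elt w a) < 0" using z(2) a by (simp add: ip_elt_left)
    have wR: "elt w a \<in> R" using elt_root[OF w(1) a(1)] .
    then have le: "cf l (elt w a) \<le> 0" if "l \<in> I" for l
      using root_sign[OF wR] neg k(1) that by fastforce
    let ?h = "\<lambda>l. cf l (elt w a) * ip (sr l) (elt w \<mu>)"
    have "ip a \<mu> = ?h k + (\<Sum>l\<in>I - {k}. ?h l)"
      unfolding expand[OF a(1)] using k(1) by (intro sum.remove) auto
    moreover have "(\<Sum>l\<in>I - {k}. ?h l) \<le> 0"
      using le w(2) by (intro sum_nonpos mult_nonpos_nonneg) auto
    moreover have "?h k < 0" using neg k(2) by (rule mult_neg_pos)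
    ultimately have "ip a \<mu> < 0" by linarith
    then show "z \<in> inf_inversions X n x" using S_sub[OF z(1) a(2)] mu_S[OF a(1)] by blast
  qed
  then show ?thesis using k(1) w(1) by (intro bexI[of _ k] exI[of _ "rev w"]) auto
qed

text \<open>\<kappa> sends i to the index of the coweight along which \<open>y i\<close> translates.
  Its surjectivity ensures that each coweight found below an infinite reduced word belongs to one of
  the given words.\<close>

theorem minimal_iff:
  assumes crit: "\<And>i. i \<in> I \<Longrightarrow> criterion i (y i) (\<kappa> i)" and \<kappa>: "I \<subseteq> \<kappa> ` I"
    and x: "inf_reduced X n x"
  shows "minimal_inf_reduced X n x \<longleftrightarrow>
    (\<exists>i \<in> {1..n}. \<exists>u v.
      reduced_expression X n {1..n} (u @ v)
        (longest_element X n ({1..n} - {i}) \<circ> longest_element X n {1..n}) \<and>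
      inf_reduced_expression X n (periodic_word (v @ y i @ u)) x)"
proof
  have I0: "I \<subseteq> {0..n}" by auto
  assume min: "minimal_inf_reduced X n x"
  obtain k w where k: "k \<in> I" "set w \<subseteq> I" "N (elt w (om k)) \<subseteq> inf_inversions X n x"
    using inf_reduced_contains_N[OF x] by blast
  obtain i where i: "i \<in> I" "k = \<kappa> i" using \<kappa> k by blast
  obtain q d where q: "translating (y i) k q d"
    "longest_element X n (I - {i}) \<circ> longest_element X n I = elt q"
    using criterion_translating[OF crit[OF i(1)]] i by blast
  obtain u v where uv: "reduced (u @ v)" "set (u @ v) \<subseteq> I" "elt (u @ v) = elt q" "elt v (om k) = elt w (om k)"
    using translating_cover[OF q(1) k(2)] by blast
  note per = translating_periodic[OF q(1) uv(1-3)]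
  have "limit_le X n (periodic_word (v @ y i @ u)) x" using per k uv(4) by (simp add: limit_le_def)
  then have "limit_eq X n (periodic_word (v @ y i @ u)) x"
    using min per(1) by (simp add: minimal_inf_reduced_def)
  moreover have "reduced_expression X n I (u @ v) (elt q)"
    by (rule iffD2[OF reduced_expression_iff[OF I0]]) (use uv in blast)
  ultimately show "\<exists>i \<in> I. \<exists>u v.
      reduced_expression X n I (u @ v) (longest_element X n (I - {i}) \<circ> longest_element X n I) \<and>
      inf_reduced_expression X n (periodic_word (v @ y i @ u)) x"
    using i(1) q(2) per(1) unfolding inf_reduced_expression_def by (intro bexI[of _ i] exI[of _ u] exI[of _ v]) simp_all
next
  have I0: "I \<subseteq> {0..n}" by auto
  assume "\<exists>i \<in> I. \<exists>u v.
      reduced_expression X n I (u @ v) (longest_element X n (I - {i}) \<circ> longest_element X n I) \<and>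
      inf_reduced_expression X n (periodic_word (v @ y i @ u)) x"
  then obtain i u v where i: "i \<in> I"
    and uv: "reduced_expression X n I (u @ v) (longest_element X n (I - {i}) \<circ> longest_element X n I)"
    and e: "inf_reduced_expression X n (periodic_word (v @ y i @ u)) x" by blast
  obtain q d where q: "translating (y i) (\<kappa> i) q d"
    "longest_element X n (I - {i}) \<circ> longest_element X n I = elt q"
    using criterion_translating[OF crit[OF i]] by blast
  have uv': "reduced (u @ v)" "set (u @ v) \<subseteq> I" "elt (u @ v) = elt q"
    using iffD1[OF reduced_expression_iff[OF I0] uv[unfolded q(2)]] by blast+
  have inv: "inf_inversions X n x = N (elt v (om (\<kappa> i)))"
    using translating_periodic(2)[OF q(1) uv'] e by (simp add: inf_reduced_expression_def limit_eq_def)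
  have ki: "\<kappa> i \<in> I" using q(1) by (simp add: translating_def)
  show "minimal_inf_reduced X n x"
    unfolding minimal_inf_reduced_def
  proof (intro conjI allI impI x)
    fix z assume z: "inf_reduced X n z \<and> limit_le X n z x"
    obtain k w where k: "k \<in> I" "set w \<subseteq> I" "N (elt w (om k)) \<subseteq> inf_inversions X n z"
      using inf_reduced_contains_N z by blast
    then have "N (elt w (om k)) \<subseteq> N (elt v (om (\<kappa> i)))" using z inv by (auto simp: limit_le_def)
    then have "elt w (om k) = elt v (om (\<kappa> i))" using N_subset_eq[OF k(2) _ k(1) ki] uv'(2) by simp
    then show "limit_eq X n z x" using k z inv by (auto simp: limit_le_def limit_eq_def)
  qed
qed

end

section \<open>Root data given by integer tables\<close>

definition vec_of :: "int \<Rightarrow> int list \<Rightarrow> vec" where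
  "vec_of d t = (\<lambda>k. if k \<in> {1..length t} then of_int (t ! (k - 1)) / of_int d else 0)"

definition dot :: "int list \<Rightarrow> int list \<Rightarrow> int" where
  "dot t u = sum_list (map2 (*) t u)"

lemma inner_prod_vec_of:
  assumes "length t = ambient_dim X n" "length u = ambient_dim X n"
  shows "inner_prod X n (vec_of d t) (vec_of e u) = of_int (dot t u) / (of_int d * of_int e)"
proof -
  have "inner_prod X n (vec_of d t) (vec_of e u) =
      (\<Sum>k = 1..length t. of_int (t ! (k - 1) * u ! (k - 1)) / (of_int d * of_int e))"
    unfolding inner_prod_def assms(1)[symmetric] using assms by (intro sum.cong) (auto simp: vec_of_def)
  also have "\<dots> = (\<Sum>k = 0..<length t. of_int (t ! k * u ! k) / (of_int d * of_int e))"
    by (rule sum.reindex_bij_witness[of _ Suc "\<lambda>k. k - 1"]) auto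
  also have "\<dots> = of_int (dot t u) / (of_int d * of_int e)"
    using assms by (simp add: dot_def sum_list_sum_nth sum_divide_distrib)
  finally show ?thesis .
qed

text \<open>The numerical assumptions of \<open>root_datum\<close> in executable form. Lists count
  from 0, simple roots from 1; \<open>d\<close> and \<open>e\<close> are common denominators for
  roots and coweights.\<close>

definition datum_check ::
    "nat \<Rightarrow> nat \<Rightarrow> int \<Rightarrow> int list list \<Rightarrow> int \<Rightarrow> int list list \<Rightarrow> int list \<Rightarrow> int \<Rightarrow> nat \<Rightarrow> bool" where
  "datum_check n N d S e Om rho s r \<longleftrightarrow>
    1 \<le> n \<and> 0 < d \<and> 0 < e \<and> 0 < s \<and> (r = 1 \<or> r = 2 \<or> r = 3) \<and> length S = n \<and> length Om = n \<and>
    length rho = N \<and> (\<forall>t\<in>set S. length t = N) \<and> (\<forall>t\<in>set Om. length t = N) \<and>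
    (\<forall>i\<in>set [0..<n]. \<forall>j\<in>set [0..<n].
      dot (S ! i) (Om ! j) = (if i = j then d * e else 0) \<and>
      2 * dot (S ! i) (S ! j) mod dot (S ! j) (S ! j) = 0 \<and>
      (i = j \<or> dot (S ! i) (S ! j) \<le> 0)) \<and>
    (\<forall>j\<in>set [0..<n].
      (dot (S ! j) (S ! j) = s * (d * d) \<or> dot (S ! j) (S ! j) = int r * s * (d * d)) \<and>
      0 \<le> dot rho (S ! j) \<and> 0 < dot rho (Om ! j)) \<and>
    dot rho rho = int r * s * (d * d)"

lemma root_datum_tables:
  assumes c: "datum_check n (ambient_dim X n) d S e Om rho s r"
    and sr: "\<And>j. j \<in> {1..n} \<Longrightarrow> simple_root X n j = vec_of d (S ! (j - 1))"
    and rho: "vec_of d rho \<in> roots X n"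
  shows "root_datum X n (\<lambda>j. vec_of e (Om ! (j - 1))) (vec_of d rho) (of_int s) r"
proof
  have idx: "j - 1 \<in> set [0..<n]" if "j \<in> {1..n}" for j using that by auto
  have d: "0 < d" "0 < e" and S: "length S = n" "length Om = n" "length rho = ambient_dim X n"
    and lens: "\<And>t. t \<in> set S \<Longrightarrow> length t = ambient_dim X n" "\<And>t. t \<in> set Om \<Longrightarrow> length t = ambient_dim X n"
    using c by (auto simp: datum_check_def)
  have lenS: "length (S ! (j - 1)) = ambient_dim X n" if "j \<in> {1..n}" for j
    using idx[OF that] S by (intro lens nth_mem) auto
  have lenO: "length (Om ! (j - 1)) = ambient_dim X n" if "j \<in> {1..n}" for j
    using idx[OF that] S by (intro lens nth_mem) auto
  have c2: "dot (S ! (i - 1)) (Om ! (j - 1)) = (if i = j then d * e else 0)"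
      "2 * dot (S ! (i - 1)) (S ! (j - 1)) mod dot (S ! (j - 1)) (S ! (j - 1)) = 0"
      "i = j \<or> dot (S ! (i - 1)) (S ! (j - 1)) \<le> 0" if ij: "i \<in> {1..n}" "j \<in> {1..n}" for i j
  proof -
    have "i - 1 = j - 1 \<longleftrightarrow> i = j" using ij by auto
    then show "dot (S ! (i - 1)) (Om ! (j - 1)) = (if i = j then d * e else 0)"
      "2 * dot (S ! (i - 1)) (S ! (j - 1)) mod dot (S ! (j - 1)) (S ! (j - 1)) = 0"
      "i = j \<or> dot (S ! (i - 1)) (S ! (j - 1)) \<le> 0"
      using c idx[OF ij(1)] idx[OF ij(2)] unfolding datum_check_def by metis+
  qed
  have c1: "dot (S ! (j - 1)) (S ! (j - 1)) = s * (d * d) \<or> dot (S ! (j - 1)) (S ! (j - 1)) = int r * s * (d * d)"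
      "0 \<le> dot rho (S ! (j - 1))" "0 < dot rho (Om ! (j - 1))" if "j \<in> {1..n}" for j
    using c idx[OF that] unfolding datum_check_def by blast+
  have ipS: "inner_prod X n (simple_root X n i) (simple_root X n j) = of_int (dot (S ! (i - 1)) (S ! (j - 1))) / (of_int d * of_int d)"
    if "i \<in> {1..n}" "j \<in> {1..n}" for i j
    unfolding sr[OF that(1)] sr[OF that(2)] by (rule inner_prod_vec_of[OF lenS[OF that(1)] lenS[OF that(2)]])
  show "1 \<le> n" "0 < real_of_int s" "r \<in> {1, 2, 3}" using c by (auto simp: datum_check_def)
  show "simple_root X n j k = 0" if "j \<in> {1..n}" "k \<notin> {1..ambient_dim X n}" for j k
    unfolding sr[OF that(1)] vec_of_def lenS[OF that(1)] by (rule if_not_P[OF that(2)])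
  show "inner_prod X n (simple_root X n i) (vec_of e (Om ! (j - 1))) = (if i = j then 1 else 0)"
    if "i \<in> {1..n}" "j \<in> {1..n}" for i j
    unfolding sr[OF that(1)] inner_prod_vec_of[OF lenS[OF that(1)] lenO[OF that(2)]] c2(1)[OF that]
    using d by simp
  show "\<exists>z::int. 2 * inner_prod X n (simple_root X n i) (simple_root X n j) =
      z * inner_prod X n (simple_root X n j) (simple_root X n j)" if ij: "i \<in> {1..n}" "j \<in> {1..n}" for i j
  proof -
    obtain z where z: "2 * dot (S ! (i - 1)) (S ! (j - 1)) = z * dot (S ! (j - 1)) (S ! (j - 1))"
      using c2(2)[OF ij] by (metis dvd_eq_mod_eq_0 dvd_def mult.commute)
    have "2 * inner_prod X n (simple_root X n i) (simple_root X n j) =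
        of_int (2 * dot (S ! (i - 1)) (S ! (j - 1))) / (of_int d * of_int d)"
      unfolding ipS[OF ij] by simp
    also have "\<dots> = z * inner_prod X n (simple_root X n j) (simple_root X n j)"
      unfolding ipS[OF ij(2) ij(2)] z by simp
    finally show ?thesis by blast
  qed
  show "inner_prod X n (simple_root X n i) (simple_root X n j) \<le> 0"
    if "i \<in> {1..n}" "j \<in> {1..n}" "i \<noteq> j" for i j
    using c2(3)[OF that(1,2)] that(3) d unfolding ipS[OF that(1,2)] by (simp add: divide_nonpos_pos)
  show "inner_prod X n (simple_root X n j) (simple_root X n j) \<in> {real_of_int s, real r * real_of_int s}"
    if "j \<in> {1..n}" for j
    using c1(1)[OF that] d unfolding ipS[OF that that] by auto
  show "vec_of d rho \<in> roots X n" by (rule rho)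
  show "0 \<le> inner_prod X n (vec_of d rho) (simple_root X n j)" if "j \<in> {1..n}" for j
    unfolding sr[OF that] inner_prod_vec_of[OF S(3) lenS[OF that]] using c1(2)[OF that] d by simp
  show "inner_prod X n (vec_of d rho) (vec_of d rho) = real r * real_of_int s"
    unfolding inner_prod_vec_of[OF S(3) S(3)] using c d by (simp add: datum_check_def)
  show "0 < inner_prod X n (vec_of d rho) (vec_of e (Om ! (j - 1)))" if "j \<in> {1..n}" for j
    unfolding inner_prod_vec_of[OF S(3) lenO[OF that]] using c1(3)[OF that] d by simp
qed

text \<open>A certificate that \<open>rho\<close> belongs to the inductively defined
  \<open>roots\<close>: a list of simple reflections leading to it from a known root, with exact
  division at every step.\<close>

fun root_chain :: "int list list \<Rightarrow> int list \<Rightarrow> nat list \<Rightarrow> int list \<Rightarrow> bool" where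
  "root_chain S t [] u \<longleftrightarrow> t = u"
| "root_chain S t (j # js) u \<longleftrightarrow>
    (let v = S ! (j - 1); a = 2 * dot t v; b = dot v v; q = a div b in
      1 \<le> j \<and> j \<le> length S \<and> b \<noteq> 0 \<and> length v = length t \<and> a mod b = 0 \<and>
      root_chain S (map2 (\<lambda>x y. x - q * y) t v) js u)"

lemma root_chain_root:
  assumes "root_chain S t js u" "vec_of d t \<in> roots X n" "length t = ambient_dim X n" "length S = n" "d \<noteq> 0"
    and sr: "\<And>j. j \<in> {1..n} \<Longrightarrow> simple_root X n j = vec_of d (S ! (j - 1))"
  shows "vec_of d u \<in> roots X n"
  using assms(1-3)
proof (induction js arbitrary: t)
  case (Cons j js)
  define v where "v = S ! (j - 1)"
  define q where "q = 2 * dot t v div dot v v"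
  let ?t = "map2 (\<lambda>x y. x - q * y) t v"
  have j: "j \<in> {1..n}" and b: "dot v v \<noteq> 0" and l: "length v = length t"
    and m: "2 * dot t v mod dot v v = 0" and ch: "root_chain S ?t js u"
    using Cons.prems(1) assms(4) by (auto simp: Let_def v_def q_def)
  have q: "2 * dot t v = q * dot v v" using m by (auto simp: q_def)
  have lv: "length v = ambient_dim X n" using l Cons.prems by simp
  have "2 * (inner_prod X n (vec_of d t) (vec_of d v) / inner_prod X n (vec_of d v) (vec_of d v)) = of_int q"
  proof -
    have "real_of_int (2 * dot t v) = real_of_int (q * dot v v)" using q by simp
    then show ?thesis using b assms(5)
      unfolding inner_prod_vec_of[OF Cons.prems(3) lv] inner_prod_vec_of[OF lv lv]
      by (simp add: field_simps)
  qed
  then have "reflection X n (simple_root X n j) (vec_of d t) = vec_of d t - scl (of_int q) (vec_of d v)"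
    unfolding reflection_def sr[OF j] v_def[symmetric] by simp
  also have "\<dots> = vec_of d ?t"
    using l by (auto simp: fun_eq_iff vec_apply vec_of_def diff_divide_distrib)
  finally have "vec_of d ?t \<in> roots X n" using roots.reflect[OF Cons.prems(2) j] by simp
  then show ?case using Cons.IH[OF ch] Cons.prems l by simp
qed simp

text \<open>The numbers game: \<open>p\<close> lists the values of a linear functional at the affine simple roots
  \<open>\<alpha>\<^sub>0, \<dots>, \<alpha>\<^sub>n\<close>, and \<open>play C y p\<close> lists its values at \<open>y \<alpha>\<^sub>0, \<dots>, y \<alpha>\<^sub>n\<close>.\<close>

fun fire :: "int list list \<Rightarrow> nat \<Rightarrow> int list \<Rightarrow> int list" where
  "fire C j p = (let x = p ! j in map2 (\<lambda>a c. a - c * x) p (C ! j))"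

fun legal_play :: "int list list \<Rightarrow> nat list \<Rightarrow> int list \<Rightarrow> bool" where
  "legal_play C [] p = True"
| "legal_play C (j # js) p = (0 < p ! j \<and> legal_play C js (fire C j p))"

fun play :: "int list list \<Rightarrow> nat list \<Rightarrow> int list \<Rightarrow> int list" where
  "play C [] p = p"
| "play C (j # js) p = play C js (fire C j p)"

text \<open>The values of the coefficient functional \<open>K l\<close> at the affine simple
  roots.\<close>

definition unit_row :: "nat \<Rightarrow> nat \<Rightarrow> int list" where
  "unit_row n l = map (\<lambda>k. if k = l then 1 else 0) [0..<n + 1]"

text \<open>A recursion rather than a \<open>map\<close>, so that rewriting does not unfold the play of a symbolic
  row under the abstraction.\<close>

fun plays :: "int list list \<Rightarrow> nat list \<Rightarrow> int list list \<Rightarrow> int list list" where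
  "plays C y [] = []"
| "plays C y (q # qs) = play C y q # plays C y qs"

lemma plays_map: "plays C y qs = map (play C y) qs"
  by (induction qs) auto

text \<open>The row of ones is the height functional and certifies reducedness.
  \<open>M ! l ! j\<close> is the coefficient of the affine simple root l in the image of the j-th
  one; subtracting \<open>m ! k\<close> times the coefficient at 0 turns \<open>K k\<close> back
  into \<open>cf k\<close>.\<close>

definition crit_check ::
    "int list list \<Rightarrow> int list \<Rightarrow> nat \<Rightarrow> nat list \<Rightarrow> nat \<Rightarrow> nat \<Rightarrow> nat list \<Rightarrow> bool" where
  "crit_check C m n y i k p \<longleftrightarrow>
    1 \<le> i \<and> i \<le> n \<and> 1 \<le> k \<and> k \<le> n \<and> (\<forall>j\<in>set y. j \<le> n) \<and>
    legal_play C y (replicate (n + 1) 1) \<and>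
    (let M = plays C y (map (unit_row n) [0..<n + 1]); J = filter (\<lambda>j. j \<noteq> i) [1..<n + 1] in
      distinct (map ((!) p) J) \<and> set (map ((!) p) J) = set (filter (\<lambda>j. j \<noteq> k) [1..<n + 1]) \<and>
      (\<forall>j\<in>set J. \<forall>l\<in>set [0..<n + 1]. M ! l ! j = (if l = p ! j then 1 else 0)) \<and>
      M ! k ! i - m ! k * M ! 0 ! i < 0 \<and> 0 < M ! 0 ! i)"

fun crit_all ::
    "series \<Rightarrow> int list list \<Rightarrow> int list \<Rightarrow> nat \<Rightarrow> nat list \<Rightarrow> nat list list \<Rightarrow> nat list \<Rightarrow> bool" where
  "crit_all X C m n \<kappa> p [] = True"
| "crit_all X C m n \<kappa> p (i # is) =
    (crit_check C m n (y_word X n i) i (\<kappa> ! i) (p ! i) \<and> crit_all X C m n \<kappa> p is)"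

lemma crit_allD:
  "crit_all X C m n \<kappa> p is \<Longrightarrow> i \<in> set is \<Longrightarrow> crit_check C m n (y_word X n i) i (\<kappa> ! i) (p ! i)"
  by (induction "is") auto

section \<open>Checking the criterion by integer arithmetic\<close>

context root_datum
begin

lemma AR_expand: "z \<in> AR \<Longrightarrow> z = (\<Sum>k = 0..n. scl (K k z) (asr k))"
proof -
  assume "z \<in> AR"
  then obtain \<alpha> m where a: "\<alpha> \<in> R" and z: "z = \<alpha> + scl (real_of_int m) delta" by (auto simp: AR_def)
  have "(\<Sum>k = 0..n. scl (K k z) (asr k)) = scl m (delta - rho) + (\<Sum>k\<in>I. scl (cf k \<alpha> + mk k * m) (sr k))"
  proof -
    have "(\<Sum>k\<in>I. scl (K k z) (asr k)) = (\<Sum>k\<in>I. scl (cf k \<alpha> + mk k * m) (sr k))"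
      by (rule sum.cong) (auto simp: z K_AR[OF a] asr_finite)
    then show ?thesis by (simp add: sum.atLeast_Suc_atMost[of 0 n] z K_AR[OF a] asr_0)
  qed
  also have "(\<Sum>k\<in>I. scl (cf k \<alpha> + mk k * m) (sr k)) = comb (\<lambda>k. cf k \<alpha>) + scl m (comb mk)"
    unfolding comb_scl comb_add by (simp add: comb_def mult.commute)
  also have "\<dots> = \<alpha> + scl m rho" by (simp flip: root_expand[OF a] root_expand[OF rho_root])
  also have "scl m (delta - rho) + (\<alpha> + scl m rho) = z" by (simp add: z scl_diff)
  finally show ?thesis by simp
qed

lemma AR_eqI: "u \<in> AR \<Longrightarrow> v \<in> AR \<Longrightarrow> (\<And>k. k \<le> n \<Longrightarrow> K k u = K k v) \<Longrightarrow> u = v"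
  by (subst AR_expand[of u], assumption, subst AR_expand[of v], assumption) (auto intro!: sum.cong)

lemma linear_sum:
  fixes L :: "vec \<Rightarrow> real"
  assumes "\<And>u v. L (u + v) = L u + L v" "\<And>c v. L (scl c v) = c * L v"
  shows "L (\<Sum>k\<in>A. f k) = (\<Sum>k\<in>A. L (f k))"
proof (induction A rule: infinite_finite_induct)
  case (infinite A)
  then show ?case using assms(2)[of 0 0] by simp
next
  case empty
  then show ?case using assms(2)[of 0 0] by simp
qed (simp add: assms(1))

text \<open>The coefficients of an affine root share one sign, so a single functional positive on
  the simple roots detects positivity.\<close>

lemma P_iff_functional:
  fixes L :: "vec \<Rightarrow> real"
  assumes L: "\<And>u v. L (u + v) = L u + L v" "\<And>c v. L (scl c v) = c * L v"
    and pos: "\<And>j. j \<le> n \<Longrightarrow> 0 < L (asr j)" and z: "z \<in> AR"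
  shows "z \<in> P \<longleftrightarrow> 0 < L z"
proof -
  have pos': "0 < L z" if z: "z \<in> P" for z
  proof -
    have zz: "z \<in> AR" using z by (rule P_in_AR)
    obtain k where k: "k \<le> n" "K k z \<noteq> 0" using AR_nonzero[OF zz] by blast
    have K: "0 \<le> K j z" if "j \<le> n" for j using z that by (simp add: P_iff)
    have "0 < (\<Sum>j = 0..n. K j z * L (asr j))"
    proof (rule sum_pos2)
      show "k \<in> {0..n}" "0 < K k z * L (asr k)" using k K[of k] pos[of k] by auto
      show "0 \<le> K j z * L (asr j)" if "j \<in> {0..n}" for j using that K[of j] pos[of j] by simp
    qed simp
    also have "\<dots> = L z" by (subst (2) AR_expand[OF zz]) (simp add: linear_sum[OF L] L(2))
    finally show ?thesis .
  qed
  show ?thesis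
  proof
    assume "0 < L z"
    show "z \<in> P"
    proof (rule ccontr)
      assume "z \<notin> P"
      then have "0 < L (- z)" using pos' neg_P_not[OF z] by blast
      then show False using \<open>0 < L z\<close> L(2)[of "-1" z] by simp
    qed
  qed (rule pos')
qed

lemma K_add: "K k (u + v) = K k u + K k v" for u v :: vec by (rule K_linear)
lemma K_scl: "K k (scl c u) = c * K k u" by (rule K_linear)

lemma criterion_tables:
  assumes C: "length C = n + 1" "\<And>j. j \<le> n \<Longrightarrow> length (C ! j) = n + 1"
      "\<And>j k. j \<le> n \<Longrightarrow> k \<le> n \<Longrightarrow> 2 * ip (asr k) (asr j) = of_int (C ! j ! k) * ip (asr j) (asr j)"
    and m: "\<And>k. k \<in> I \<Longrightarrow> mk k = of_int (m ! k)"
    and chk: "crit_check C m n y i k p"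
  shows "criterion i y k"
proof -
  have refl: "simple_refl X n j (asr k) = asr k - scl (of_int (C ! j ! k)) (asr j)" if "j \<le> n" "k \<le> n" for j k
    using C(3)[OF that] ip_asr_pos[OF that(1)] by (simp add: simple_refl_expand)
  \<comment> \<open>\<open>p\<close> tabulates L composed with \<open>elt xs\<close>. A letter j
    appended to \<open>xs\<close> acts first on the argument, which is precisely what firing j does
    to the table.\<close>
  define rep where "rep L xs p \<longleftrightarrow> length p = n + 1 \<and> (\<forall>k\<le>n. L (elt xs (asr k)) = real_of_int (p ! k))"
    for L :: "vec \<Rightarrow> real" and xs p
  have rep_fire: "rep L (xs @ [j]) (fire C j q)"
    if L: "\<And>u v. L (u + v) = L u + L v" "\<And>c v. L (scl c v) = c * L v" and q: "rep L xs q" and j: "j \<le> n"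
    for L xs q j
  proof -
    have "L (elt (xs @ [j]) (asr k)) = real_of_int (fire C j q ! k)" if k: "k \<le> n" for k
    proof -
      have "elt (xs @ [j]) (asr k) = elt xs (asr k) + scl (- of_int (C ! j ! k)) (elt xs (asr j))"
        by (simp add: elt_append elt_Cons refl[OF j k] elt_diff elt_scl)
      then have "L (elt (xs @ [j]) (asr k)) = L (elt xs (asr k)) - of_int (C ! j ! k) * L (elt xs (asr j))"
        by (simp only: L)
      then show ?thesis using q j k C(2)[OF j] by (simp add: rep_def Let_def)
    qed
    then show ?thesis using q C(2)[OF j] by (simp add: rep_def Let_def)
  qed
  have rep_play: "rep L (xs @ ys) (play C ys q)"
    if L: "\<And>u v. L (u + v) = L u + L v" "\<And>c v. L (scl c v) = c * L v" and q: "rep L xs q" and ys: "\<forall>j\<in>set ys. j \<le> n"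
    for L xs q ys
    using q ys
  proof (induction ys arbitrary: xs q)
    case (Cons j ys)
    then have "rep L (xs @ [j]) (fire C j q)" using rep_fire[OF L, of xs q j] by simp
    then show ?case using Cons.IH[of "xs @ [j]" "fire C j q"] Cons.prems by simp
  qed simp
  have yn: "\<forall>j\<in>set y. j \<le> n" using chk by (simp add: crit_check_def)
  have i: "i \<in> I" and k: "k \<in> I" using chk by (auto simp: crit_check_def)
  \<comment> \<open>The height: its value is 1 at every affine simple root, whence the starting row
    of ones.\<close>
  define H where "H z = (\<Sum>l = 0..n. K l z)" for z
  have H: "H (u + v) = H u + H v" "H (scl c v) = c * H v" for u v :: vec and c
    by (simp_all add: H_def K_add K_scl sum.distrib sum_distrib_left)
  have H_asr: "H (asr j) = 1" if "j \<le> n" for j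
  proof -
    have "H (asr j) = (\<Sum>l = 0..n. if l = j then 1 else 0)"
      unfolding H_def by (rule sum.cong) (use that in \<open>auto simp: K_asr\<close>)
    then show ?thesis using that by simp
  qed
  have red_play: "reduced (xs @ ys)"
    if "legal_play C ys q" "rep H xs q" "reduced xs" "\<forall>j\<in>set ys. j \<le> n" for xs ys q
    using that
  proof (induction ys arbitrary: xs q)
    case (Cons j ys)
    then have j: "j \<le> n" and qj: "0 < q ! j" by auto
    have "elt xs (asr j) \<in> AR" using reduced_wrd[OF Cons.prems(3)] asr_in_AR[OF j] by (rule elt_AR)
    moreover have "0 < H (elt xs (asr j))" using Cons.prems(2) j qj by (simp add: rep_def)
    ultimately have "elt xs (asr j) \<in> P" using P_iff_functional[OF H, of "elt xs (asr j)"] H_asr by simp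
    then have "reduced (xs @ [j])" using Cons.prems(3) j by (simp add: reduced_snoc_iff)
    moreover have "rep H (xs @ [j]) (fire C j q)" using rep_fire[OF H Cons.prems(2) j] .
    ultimately show ?case using Cons.IH[of "fire C j q" "xs @ [j]"] Cons.prems by simp
  qed simp
  have "rep H [] (replicate (n + 1) 1)" using H_asr by (simp add: rep_def del: replicate_Suc)
  then have red: "reduced y" using red_play[of y "replicate (n + 1) 1" "[]"] chk by (simp add: crit_check_def)
  have Kplay: "K l (elt y (asr j)) = of_int (play C y (unit_row n l) ! j)" if "l \<le> n" "j \<le> n" for l j
  proof -
    have "rep (K l) [] (unit_row n l)"
      using that(1) by (auto simp: rep_def unit_row_def K_asr nth_append simp del: upt_Suc)
    then have "rep (K l) ([] @ y) (play C y (unit_row n l))"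
      by (rule rep_play[OF K_add K_scl _ yn])
    then show ?thesis using that(2) by (simp add: rep_def)
  qed
  define J where "J = filter (\<lambda>j. j \<noteq> i) [1..<n + 1]"
  have setJ: "set J = I - {i}" by (auto simp: J_def)
  define M where "M = plays C y (map (unit_row n) [0..<n + 1])"
  have M: "M ! l = play C y (unit_row n l)" if "l \<le> n" for l
    unfolding M_def plays_map map_map o_def using that by (subst nth_map) (auto simp del: upt_Suc)
  note c = chk[unfolded crit_check_def Let_def J_def[symmetric] M_def[symmetric]]
  have dist: "distinct (map ((!) p) J)"
    and img: "set (map ((!) p) J) = I - {k}"
    and un: "\<And>j l. j \<in> set J \<Longrightarrow> l \<le> n \<Longrightarrow> play C y (unit_row n l) ! j = (if l = p ! j then 1 else 0)"
    and neg: "play C y (unit_row n k) ! i - m ! k * play C y (unit_row n 0) ! i < 0"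
    and pos: "0 < play C y (unit_row n 0) ! i"
  proof -
    show "distinct (map ((!) p) J)" using c by blast
    have "set (map ((!) p) J) = set (filter (\<lambda>j. j \<noteq> k) [1..<n + 1])" using c by blast
    then show "set (map ((!) p) J) = I - {k}" by auto
    show "play C y (unit_row n l) ! j = (if l = p ! j then 1 else 0)" if "j \<in> set J" "l \<le> n" for j l
    proof -
      have "l \<in> set [0..<n + 1]" using that(2) by auto
      then have "M ! l ! j = (if l = p ! j then 1 else 0)" using c that(1) by blast
      then show ?thesis unfolding M[OF that(2)] .
    qed
    have kn: "k \<le> n" using k by simp
    have "M ! k ! i - m ! k * M ! 0 ! i < 0" "0 < M ! 0 ! i" using c by blast+
    then show "play C y (unit_row n k) ! i - m ! k * play C y (unit_row n 0) ! i < 0"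
      "0 < play C y (unit_row n 0) ! i"
      unfolding M[OF kn] M[OF le0] by blast+
  qed
  have bij: "bij_betw ((!) p) (I - {i}) (I - {k})"
    using dist img by (simp add: bij_betw_def distinct_map setJ)
  have "elt y (sr j) = sr (p ! j)" if j: "j \<in> I - {i}" for j
  proof -
    have pj: "p ! j \<in> I" using bij j by (auto simp: bij_betw_def)
    have "elt y (asr j) = asr (p ! j)"
    proof (rule AR_eqI)
      show "elt y (asr j) \<in> AR" "asr (p ! j) \<in> AR"
        using j pj reduced_wrd[OF red] by (auto intro!: elt_AR asr_in_AR)
      show "K l (elt y (asr j)) = K l (asr (p ! j))" if "l \<le> n" for l
        using Kplay[OF that, of j] un[of j l] that j pj by (simp add: setJ K_asr)
    qed
    then show ?thesis using asr_finite[of j] asr_finite[OF pj] j by simp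
  qed
  moreover have "cf k (elt y (sr i)) < 0" "0 < (elt y (sr i)) 0"
  proof -
    let ?z = "elt y (asr i)"
    have Kk: "K k ?z = of_int (play C y (unit_row n k) ! i)" and K0: "K 0 ?z = of_int (play C y (unit_row n 0) ! i)"
      using Kplay[of k i] Kplay[of 0 i] i k by auto
    have z0: "K 0 ?z = ?z 0" by (simp add: K_def)
    then show "0 < (elt y (sr i)) 0" using K0 pos by (simp add: asr_finite[OF i])
    have "cf k ?z = K k ?z - mk k * K 0 ?z" using k by (simp add: K_def)
    also have "\<dots> = of_int (play C y (unit_row n k) ! i - m ! k * play C y (unit_row n 0) ! i)"
      using Kk K0 m[OF k] by simp
    also have "\<dots> < 0" using neg by (subst of_int_less_0_iff)
    finally show "cf k (elt y (sr i)) < 0" by (simp add: asr_finite[OF i])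
  qed
  ultimately show ?thesis using i k red bij by (auto simp: criterion_def)
qed

end

subsection \<open>The exceptional types\<close>

text \<open>Row j of \<open>C\<close> belongs to the reflecting root: \<open>C ! j ! k\<close> is
  the coefficient of \<open>asr j\<close> subtracted when \<open>asr k\<close> is reflected in
  it.\<close>

definition ext_check :: "int list list \<Rightarrow> int list list \<Rightarrow> nat \<Rightarrow> bool" where
  "ext_check C T n \<longleftrightarrow> length C = n + 1 \<and> (\<forall>j\<in>set [0..<n + 1]. length (C ! j) = n + 1 \<and>
    (\<forall>k\<in>set [0..<n + 1]. 2 * dot (T ! k) (T ! j) = C ! j ! k * dot (T ! j) (T ! j)))"

text \<open>\<open>S\<close>, \<open>Om\<close> and \<open>rho\<close> are the simple roots, fundamental coweights and highest root up to the common
  denominators \<open>d\<close> and \<open>e\<close>; \<open>C\<close> is the Cartan matrix of the affine Weyl group and \<open>m\<close> lists the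
  coefficients of \<open>\<delta>\<close>. The word \<open>y\<^sub>i\<close> sends \<open>\<beta>\<^sub>j\<close> to the simple root with index \<open>p ! i ! j\<close>.\<close>

lemma tables_minimal_iff:
  assumes c: "datum_check n (ambient_dim X n) d S e Om rho s r"
    and sr: "\<And>j. j \<in> {1..n} \<Longrightarrow> simple_root X n j = vec_of d (S ! (j - 1))"
    and chain: "a \<in> {1..n}" "root_chain S (S ! (a - 1)) js rho"
    and ext: "ext_check C (map uminus rho # S) n"
    and marks: "\<forall>k\<in>set [0..<n]. dot rho (Om ! k) = m ! (k + 1) * (d * e)"
    and crit: "crit_all X C m n \<kappa> p [1..<n + 1]"
    and \<kappa>: "\<forall>k\<in>set [1..<n + 1]. \<exists>i\<in>set [1..<n + 1]. \<kappa> ! i = k"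
    and x: "inf_reduced X n x"
  shows "minimal_inf_reduced X n x \<longleftrightarrow>
    (\<exists>i \<in> {1..n}. \<exists>u v.
      reduced_expression X n {1..n} (u @ v)
        (longest_element X n ({1..n} - {i}) \<circ> longest_element X n {1..n}) \<and>
      inf_reduced_expression X n (periodic_word (v @ y_word X n i @ u)) x)"
proof -
  have d: "0 < d" "0 < e" and S: "length S = n" "length Om = n" "length rho = ambient_dim X n"
    and lens: "\<And>t. t \<in> set S \<Longrightarrow> length t = ambient_dim X n" "\<And>t. t \<in> set Om \<Longrightarrow> length t = ambient_dim X n"
    using c by (auto simp: datum_check_def)
  have idx: "j - 1 < n" if "j \<in> {1..n}" for j using that by auto
  have lenS: "length (S ! (j - 1)) = ambient_dim X n" if "j \<in> {1..n}" for j
    using idx[OF that] S by (intro lens nth_mem) auto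
  have lenO: "length (Om ! (j - 1)) = ambient_dim X n" if "j \<in> {1..n}" for j
    using idx[OF that] S by (intro lens nth_mem) auto
  have start: "vec_of d (S ! (a - 1)) \<in> roots X n"
    unfolding sr[OF chain(1), symmetric] by (rule roots.simple[OF chain(1)])
  have rho: "vec_of d rho \<in> roots X n"
    by (rule root_chain_root[OF chain(2) start lenS[OF chain(1)] S(1) _ sr]) (use d in auto)
  interpret root_datum X n "\<lambda>j. vec_of e (Om ! (j - 1))" "vec_of d rho" "of_int s" r
    by (rule root_datum_tables[OF c sr rho])
  \<comment> \<open>The affine simple roots without their \<delta>-part, which inner products
    ignore.\<close>
  let ?T = "map uminus rho # S"
  have T: "length (?T ! j) = ambient_dim X n \<and> (\<exists>c. asr j = vec_of d (?T ! j) + scl c delta)"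
    if "j \<le> n" for j
  proof (cases "j = 0")
    case True
    have "asr 0 = vec_of d (map uminus rho) + scl 1 delta"
      by (auto simp: asr_0 fun_eq_iff vec_apply vec_of_def)
    then show ?thesis using True S(3) by (intro conjI exI[of _ 1]) simp_all
  next
    case False
    then have j: "j \<in> {1..n}" using that by auto
    have "asr j = vec_of d (?T ! j) + scl 0 delta" using False by (simp add: asr_finite[OF j] sr[OF j])
    moreover have "length (?T ! j) = ambient_dim X n" using lenS[OF j] False by simp
    ultimately show ?thesis by blast
  qed
  have ipT: "ip (asr k) (asr j) = of_int (dot (?T ! k) (?T ! j)) / (of_int d * of_int d)" if kj: "k \<le> n" "j \<le> n" for k j
  proof -
    obtain a b where "asr k = vec_of d (?T ! k) + scl a delta" "asr j = vec_of d (?T ! j) + scl b delta"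
      using T kj by meson
    then have "ip (asr k) (asr j) = ip (vec_of d (?T ! k)) (vec_of d (?T ! j))" by simp
    then show ?thesis using inner_prod_vec_of[of "?T ! k" X n "?T ! j" d d] T kj by simp
  qed
  have C0: "length C = n + 1" "length (C ! j) = n + 1"
      "\<forall>k\<in>set [0..<n + 1]. 2 * dot (?T ! k) (?T ! j) = C ! j ! k * dot (?T ! j) (?T ! j)" if "j \<le> n" for j
  proof -
    have "j \<in> set [0..<n + 1]" using that by auto
    then show "length C = n + 1" "length (C ! j) = n + 1"
      "\<forall>k\<in>set [0..<n + 1]. 2 * dot (?T ! k) (?T ! j) = C ! j ! k * dot (?T ! j) (?T ! j)"
      using ext unfolding ext_check_def by blast+
  qed
  have C: "length C = n + 1" "\<And>j. j \<le> n \<Longrightarrow> length (C ! j) = n + 1"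
    using C0 le0 by blast+
  have C2: "2 * ip (asr k) (asr j) = of_int (C ! j ! k) * ip (asr j) (asr j)" if "j \<le> n" "k \<le> n" for j k
  proof -
    have "k \<in> set [0..<n + 1]" using that by auto
    then have "2 * dot (?T ! k) (?T ! j) = C ! j ! k * dot (?T ! j) (?T ! j)"
      using C0(3)[OF that(1)] by blast
    then have "real_of_int (2 * dot (?T ! k) (?T ! j)) = real_of_int (C ! j ! k * dot (?T ! j) (?T ! j))" by (rule arg_cong)
    then show ?thesis unfolding ipT[OF that(2,1)] ipT[OF that(1,1)] by simp
  qed
  have m: "ip (vec_of d rho) (vec_of e (Om ! (k - 1))) = of_int (m ! k)" if k: "k \<in> {1..n}" for k
  proof -
    have "dot rho (Om ! (k - 1)) = m ! (k - 1 + 1) * (d * e)" using marks idx[OF k] by simp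
    then show ?thesis unfolding inner_prod_vec_of[OF S(3) lenO[OF k]] using d k by simp
  qed
  show ?thesis
  proof (rule minimal_iff[where y = "y_word X n" and \<kappa> = "\<lambda>i. \<kappa> ! i", OF _ _ x])
    show "criterion i (y_word X n i) (\<kappa> ! i)" if "i \<in> {1..n}" for i
    proof (rule criterion_tables[OF C C2 m, where p = "p ! i"])
      have "i \<in> set [1..<n + 1]" using that by auto
      then show "crit_check C m n (y_word X n i) i (\<kappa> ! i) (p ! i)" by (rule crit_allD[OF crit])
    qed
    show "{1..n} \<subseteq> (\<lambda>i. \<kappa> ! i) ` {1..n}"
    proof
      fix k assume "k \<in> {1..n}"
      then have "k \<in> set [1..<n + 1]" by auto
      then obtain i where "i \<in> set [1..<n + 1]" "\<kappa> ! i = k" using \<kappa> by blast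
      then show "k \<in> (\<lambda>i. \<kappa> ! i) ` {1..n}" by auto
    qed
  qed
qed

text \<open>Twice the simple roots of E8; E7 and E6 take initial segments.\<close>

definition roots_E :: "int list list" where
  "roots_E =
    [[1, - 1, - 1, - 1, - 1, - 1, - 1, 1], [2, 2, 0, 0, 0, 0, 0, 0], [- 2, 2, 0, 0, 0, 0, 0, 0],
    [0, - 2, 2, 0, 0, 0, 0, 0], [0, 0, - 2, 2, 0, 0, 0, 0], [0, 0, 0, - 2, 2, 0, 0, 0], [0, 0, 0,
    0, - 2, 2, 0, 0], [0, 0, 0, 0, 0, - 2, 2, 0]]"

text \<open>Twice the fundamental coweights of E8. Initial segments stay dual to the initial simple
  roots, which is all that \<open>root_datum\<close> asks, although for E6 and E7 these vectors may
  lie outside the span of the roots.\<close>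

definition coweights_E :: "int list list" where
  "coweights_E =
    [[0, 0, 0, 0, 0, 0, 0, 4], [1, 1, 1, 1, 1, 1, 1, 5], [- 1, 1, 1, 1, 1, 1, 1, 7], [0, 0, 2, 2,
    2, 2, 2, 10], [0, 0, 0, 2, 2, 2, 2, 8], [0, 0, 0, 0, 2, 2, 2, 6], [0, 0, 0, 0, 0, 2, 2, 4],
    [0, 0, 0, 0, 0, 0, 2, 2]]"

lemma simple_root_E:
  assumes "j \<in> {1..8}"
  shows "simple_root TypeE n j = vec_of 2 (roots_E ! (j - 1))"
proof
  fix k :: nat
  have j: "j = 1 \<or> j = 2 \<or> j = 3 \<or> j = 4 \<or> j = 5 \<or> j = 6 \<or> j = 7 \<or> j = 8" using assms by auto
  have "k = 0 \<or> k = 1 \<or> k = 2 \<or> k = 3 \<or> k = 4 \<or> k = 5 \<or> k = 6 \<or> k = 7 \<or> k = 8 \<or> 9 \<le> k" by linarith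
  then show "simple_root TypeE n j k = vec_of 2 (roots_E ! (j - 1)) k"
    using j by (elim disjE) (simp_all add: roots_E_def vec_of_def vec_apply)
qed

lemma simple_root_F:
  assumes "j \<in> {1..4}"
  shows "simple_root TypeF n j = vec_of 2 ([[0, 2, - 2, 0], [0, 0, 2, - 2], [0, 0, 0, 2], [1, - 1, - 1, - 1]] ! (j - 1))"
proof
  fix k :: nat
  have j: "j = 1 \<or> j = 2 \<or> j = 3 \<or> j = 4" using assms by auto
  have "k = 0 \<or> k = 1 \<or> k = 2 \<or> k = 3 \<or> k = 4 \<or> 5 \<le> k" by linarith
  then show "simple_root TypeF n j k = vec_of 2 ([[0, 2, - 2, 0], [0, 0, 2, - 2], [0, 0, 0, 2], [1, - 1, - 1, - 1]] ! (j - 1)) k"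
    using j by (elim disjE) (simp_all add: vec_of_def vec_apply)
qed

lemma simple_root_G:
  assumes "j \<in> {1..2}"
  shows "simple_root TypeG n j = vec_of 1 ([[1, - 1, 0], [- 2, 1, 1]] ! (j - 1))"
proof
  fix k :: nat
  have j: "j = 1 \<or> j = 2" using assms by auto
  have "k = 0 \<or> k = 1 \<or> k = 2 \<or> k = 3 \<or> 4 \<le> k" by linarith
  then show "simple_root TypeG n j k = vec_of 1 ([[1, - 1, 0], [- 2, 1, 1]] ! (j - 1)) k"
    using j by (elim disjE) (simp_all add: vec_of_def vec_apply)
qed

text \<open>Here the opposition involution is nontrivial: \<kappa> exchanges 1 with 6 and 3 with 5.
  In the tables for \<kappa> and \<open>p\<close>, entry 0 is a placeholder, and so is entry i of
  row i of \<open>p\<close>.\<close>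

lemma minimal_iff_E6:
  assumes "inf_reduced TypeE 6 x"
  shows "minimal_inf_reduced TypeE 6 x \<longleftrightarrow>
    (\<exists>i \<in> {1..6}. \<exists>u v.
      reduced_expression TypeE 6 {1..6} (u @ v)
        (longest_element TypeE 6 ({1..6} - {i}) \<circ> longest_element TypeE 6 {1..6}) \<and>
      inf_reduced_expression TypeE 6 (periodic_word (v @ y_word TypeE 6 i @ u)) x)"
proof (rule tables_minimal_iff[where d = 2 and e = 2 and S = "take 6 roots_E"
    and Om = "take 6 coweights_E" and s = 2 and r = 1 and a = 1
    and rho = "[1, 1, 1, 1, 1, - 1, - 1, 1]" and m = "[1, 1, 2, 2, 3, 2, 1]" and \<kappa> = "[0, 6, 2, 5, 4, 3, 1]"
    and js = "[3, 4, 2, 5, 4, 3, 6, 5, 4, 2]"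
    and C = "[[2, 0, - 1, 0, 0, 0, 0], [0, 2, 0, - 1, 0, 0, 0], [- 1, 0, 2, 0, - 1, 0, 0], [0, - 1, 0, 2,
    - 1, 0, 0], [0, 0, - 1, - 1, 2, - 1, 0], [0, 0, 0, 0, - 1, 2, - 1], [0, 0, 0, 0, 0, - 1, 2]]"
    and p = "[[], [0, 0, 5, 2, 4, 3, 1], [0, 1, 0, 3, 4, 5, 6], [0, 6, 1, 0, 3, 4, 2], [0, 5, 2, 6, 0, 1,
    3], [0, 2, 6, 4, 5, 0, 1], [0, 6, 3, 5, 4, 2, 0]]"])
  show "simple_root TypeE 6 j = vec_of 2 (take 6 roots_E ! (j - 1))" if "j \<in> {1..6}" for j
  proof -
    have "j - 1 < 6" "j \<in> {1..8}" using that by auto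
    then show ?thesis using simple_root_E[of j] by (simp only: nth_take)
  qed
  show "(1::nat) \<in> {1..6}" by simp
  show "inf_reduced TypeE 6 x" by (rule assms)
qed code_simp+

lemma minimal_iff_E7:
  assumes "inf_reduced TypeE 7 x"
  shows "minimal_inf_reduced TypeE 7 x \<longleftrightarrow>
    (\<exists>i \<in> {1..7}. \<exists>u v.
      reduced_expression TypeE 7 {1..7} (u @ v)
        (longest_element TypeE 7 ({1..7} - {i}) \<circ> longest_element TypeE 7 {1..7}) \<and>
      inf_reduced_expression TypeE 7 (periodic_word (v @ y_word TypeE 7 i @ u)) x)"
proof (rule tables_minimal_iff[where d = 2 and e = 2 and S = "take 7 roots_E"
    and Om = "take 7 coweights_E" and s = 2 and r = 1 and a = 1
    and rho = "[0, 0, 0, 0, 0, 0, - 2, 2]" and m = "[1, 2, 2, 3, 4, 3, 2, 1]" and \<kappa> = "[0, 1, 2, 3, 4, 5, 6, 7]"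
    and js = "[3, 4, 2, 5, 4, 3, 6, 5, 4, 2, 7, 6, 5, 4, 3, 1]"
    and C = "[[2, - 1, 0, 0, 0, 0, 0, 0], [- 1, 2, 0, - 1, 0, 0, 0, 0], [0, 0, 2, 0, - 1, 0, 0, 0], [0,
    - 1, 0, 2, - 1, 0, 0, 0], [0, 0, - 1, - 1, 2, - 1, 0, 0], [0, 0, 0, 0, - 1, 2, - 1, 0], [0, 0,
    0, 0, 0, - 1, 2, - 1], [0, 0, 0, 0, 0, 0, - 1, 2]]"
    and p = "[[], [0, 0, 2, 3, 4, 5, 6, 7], [0, 7, 0, 6, 5, 4, 3, 1], [0, 1, 7, 0, 6, 5, 4, 2], [0, 3, 2,
    1, 0, 7, 6, 5], [0, 2, 1, 4, 3, 0, 7, 6], [0, 1, 5, 3, 4, 2, 0, 7], [0, 6, 2, 5, 4, 3, 1, 0]]"])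
  show "simple_root TypeE 7 j = vec_of 2 (take 7 roots_E ! (j - 1))" if "j \<in> {1..7}" for j
  proof -
    have "j - 1 < 7" "j \<in> {1..8}" using that by auto
    then show ?thesis using simple_root_E[of j] by (simp only: nth_take)
  qed
  show "(1::nat) \<in> {1..7}" by simp
  show "inf_reduced TypeE 7 x" by (rule assms)
qed code_simp+

lemma minimal_iff_E8:
  assumes "inf_reduced TypeE 8 x"
  shows "minimal_inf_reduced TypeE 8 x \<longleftrightarrow>
    (\<exists>i \<in> {1..8}. \<exists>u v.
      reduced_expression TypeE 8 {1..8} (u @ v)
        (longest_element TypeE 8 ({1..8} - {i}) \<circ> longest_element TypeE 8 {1..8}) \<and>
      inf_reduced_expression TypeE 8 (periodic_word (v @ y_word TypeE 8 i @ u)) x)"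
proof (rule tables_minimal_iff[where d = 2 and e = 2 and S = "take 8 roots_E"
    and Om = "take 8 coweights_E" and s = 2 and r = 1 and a = 1
    and rho = "[0, 0, 0, 0, 0, 0, 2, 2]" and m = "[1, 2, 3, 4, 6, 5, 4, 3, 2]" and \<kappa> = "[0, 1, 2, 3, 4, 5, 6, 7, 8]"
    and js = "[3, 4, 2, 5, 4, 3, 6, 5, 4, 2, 7, 6, 5, 4, 3, 1, 8, 7, 6, 5, 4, 2, 3, 4, 5, 6, 7, 8]"
    and C = "[[2, 0, 0, 0, 0, 0, 0, 0, - 1], [0, 2, 0, - 1, 0, 0, 0, 0, 0], [0, 0, 2, 0, - 1, 0, 0, 0, 0],
    [0, - 1, 0, 2, - 1, 0, 0, 0, 0], [0, 0, - 1, - 1, 2, - 1, 0, 0, 0], [0, 0, 0, 0, - 1, 2, - 1,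
    0, 0], [0, 0, 0, 0, 0, - 1, 2, - 1, 0], [0, 0, 0, 0, 0, 0, - 1, 2, - 1], [- 1, 0, 0, 0, 0, 0,
    0, - 1, 2]]"
    and p = "[[], [0, 0, 3, 2, 4, 5, 6, 7, 8], [0, 8, 0, 7, 6, 5, 4, 3, 1], [0, 1, 8, 0, 7, 6, 5, 4, 2],
    [0, 3, 2, 1, 0, 8, 7, 6, 5], [0, 2, 1, 4, 3, 0, 8, 7, 6], [0, 1, 5, 3, 4, 2, 0, 8, 7], [0, 6,
    2, 5, 4, 3, 1, 0, 8], [0, 1, 2, 3, 4, 5, 6, 7, 0]]"])
  show "simple_root TypeE 8 j = vec_of 2 (take 8 roots_E ! (j - 1))" if "j \<in> {1..8}" for j
  proof -
    have "j - 1 < 8" "j \<in> {1..8}" using that by auto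
    then show ?thesis using simple_root_E[of j] by (simp only: nth_take)
  qed
  show "(1::nat) \<in> {1..8}" by simp
  show "inf_reduced TypeE 8 x" by (rule assms)
qed code_simp+

lemma minimal_iff_F4:
  assumes "inf_reduced TypeF 4 x"
  shows "minimal_inf_reduced TypeF 4 x \<longleftrightarrow>
    (\<exists>i \<in> {1..4}. \<exists>u v.
      reduced_expression TypeF 4 {1..4} (u @ v)
        (longest_element TypeF 4 ({1..4} - {i}) \<circ> longest_element TypeF 4 {1..4}) \<and>
      inf_reduced_expression TypeF 4 (periodic_word (v @ y_word TypeF 4 i @ u)) x)"
proof (rule tables_minimal_iff[where d = 2 and e = 1 and S = "[[0, 2, - 2, 0], [0, 0, 2, - 2], [0, 0, 0, 2], [1, - 1, - 1, - 1]]"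
    and Om = "[[1, 1, 0, 0], [2, 1, 1, 0], [3, 1, 1, 1], [2, 0, 0, 0]]" and s = 1 and r = 2 and a = 1
    and rho = "[2, 2, 0, 0]" and m = "[1, 2, 3, 4, 2]" and \<kappa> = "[0, 1, 2, 3, 4]"
    and js = "[2, 3, 2, 4, 3, 2, 1]"
    and C = "[[2, - 1, 0, 0, 0], [- 1, 2, - 1, 0, 0], [0, - 1, 2, - 1, 0], [0, 0, - 2, 2, - 1], [0, 0, 0,
    - 1, 2]]"
    and p = "[[], [0, 0, 2, 3, 4], [0, 1, 0, 4, 3], [0, 2, 1, 0, 4], [0, 1, 2, 3, 0]]"])
  show "simple_root TypeF 4 j = vec_of 2 ([[0, 2, - 2, 0], [0, 0, 2, - 2], [0, 0, 0, 2], [1, - 1, - 1, - 1]] ! (j - 1))" if "j \<in> {1..4}" for j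
    using that by (rule simple_root_F)
  show "(1::nat) \<in> {1..4}" by simp
  show "inf_reduced TypeF 4 x" by (rule assms)
qed code_simp+

text \<open>Reflections preserve length, so the chain to the long root \<open>rho\<close> must start
  at the long simple root, number 2.\<close>

lemma minimal_iff_G2:
  assumes "inf_reduced TypeG 2 x"
  shows "minimal_inf_reduced TypeG 2 x \<longleftrightarrow>
    (\<exists>i \<in> {1..2}. \<exists>u v.
      reduced_expression TypeG 2 {1..2} (u @ v)
        (longest_element TypeG 2 ({1..2} - {i}) \<circ> longest_element TypeG 2 {1..2}) \<and>
      inf_reduced_expression TypeG 2 (periodic_word (v @ y_word TypeG 2 i @ u)) x)"
proof (rule tables_minimal_iff[where d = 1 and e = 3 and S = "[[1, - 1, 0], [- 2, 1, 1]]"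
    and Om = "[[0, - 3, 3], [- 1, - 1, 2]]" and s = 2 and r = 3 and a = 2
    and rho = "[- 1, - 1, 2]" and m = "[1, 3, 2]" and \<kappa> = "[0, 1, 2]"
    and js = "[1, 2]"
    and C = "[[2, 0, - 1], [0, 2, - 3], [- 1, - 1, 2]]"
    and p = "[[], [0, 0, 2], [0, 1, 0]]"])
  show "simple_root TypeG 2 j = vec_of 1 ([[1, - 1, 0], [- 2, 1, 1]] ! (j - 1))" if "j \<in> {1..2}" for j
    using that by (rule simple_root_G)
  show "(2::nat) \<in> {1..2}" by simp
  show "inf_reduced TypeG 2 x" by (rule assms)
qed code_simp+

section \<open>The classical types\<close>

text \<open>Coordinate 0 is included, in contrast to \<open>inner_prod\<close>, so that functionals
  can see \<delta>.\<close>

definition pairing :: "nat \<Rightarrow> vec \<Rightarrow> vec \<Rightarrow> real" where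
  "pairing n x v = (\<Sum>k = 0..n. x k * v k)"

lemma pairing_add: "pairing n x (u + v) = pairing n x u + pairing n x v"
  and pairing_diff: "pairing n x (u - v) = pairing n x u - pairing n x v"
  and pairing_scl: "pairing n x (scl c u) = c * pairing n x u" for u v :: vec
  by (simp_all add: pairing_def vec_apply algebra_simps sum.distrib sum_subtractf sum_distrib_left)

lemma pairing_eps: "j \<le> n \<Longrightarrow> pairing n x (eps j) = x j"
proof -
  assume j: "j \<le> n"
  have "pairing n x (eps j) = (\<Sum>k = 0..n. if k = j then x j else 0)"
    unfolding pairing_def by (rule sum.cong) (auto simp: eps_apply)
  then show ?thesis using j by simp
qed

lemma pairing_eps_left: "j \<le> n \<Longrightarrow> pairing n (eps j) v = v j"
  using pairing_eps[of j n v] by (simp add: pairing_def mult.commute)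

lemma pairing_upd: "j \<le> n \<Longrightarrow> pairing n (x(j := a)) v = pairing n x v + (a - x j) * v j"
  unfolding pairing_def by (simp add: sum.remove[of _ j] algebra_simps)

lemma inner_prod_eps: "j \<in> {1..ambient_dim X n} \<Longrightarrow> inner_prod X n v (eps j) = v j"
proof -
  assume j: "j \<in> {1..ambient_dim X n}"
  have "inner_prod X n v (eps j) = (\<Sum>k = 1..ambient_dim X n. if k = j then v j else 0)"
    unfolding inner_prod_def by (rule sum.cong) (auto simp: eps_apply)
  then show ?thesis using j by simp
qed

section \<open>Recursions for the words of the classical types\<close>

lemma up_snoc: "a \<le> Suc b \<Longrightarrow> up a (Suc b) = up a b @ [Suc b]"
  by (simp add: up_def)

lemma up_empty: "up (Suc b) b = []"
  by (simp add: up_def)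

lemma down_Cons: "b \<le> Suc a \<Longrightarrow> down (Suc a) b = Suc a # down a b"
  by (simp add: down_def)

lemma down_empty: "down a (Suc a) = []"
  by (simp add: down_def)

lemma up_split: "a \<le> n \<Longrightarrow> 1 \<le> n \<Longrightarrow> up a n = up a (n - 1) @ [n]"
  using up_snoc[of a "n - 1"] by simp

lemma B_word_Suc: "B_word (Suc M) = B_word M @ [2 * M + 2, 2 * M + 1, 2 * M + 3, 2 * M + 2]"
  by (simp add: B_word_def)

lemma Bs0_prod_Suc: "Bs0_prod (Suc M) = B_word (Suc M) @ [0] @ Bs0_prod M"
  by (simp add: Bs0_prod_def)

lemma s0B_prod_Suc: "s0B_prod (Suc M) = [0] @ B_word (Suc M) @ s0B_prod M"
  by (simp add: s0B_prod_def)

text \<open>Brings the tail of the odd words of type B into the form used for type D and for even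
  i.\<close>

lemma s0B_prod_conv: "s0B_prod M @ [0] = [0] @ Bs0_prod M"
  by (induction M) (simp_all add: s0B_prod_Suc Bs0_prod_Suc s0B_prod_def[of 0] Bs0_prod_def[of 0])

lemma wpow_Suc: "wpow w (Suc l) = wpow w l @ w"
  using concat_append[of "replicate l w" "[w]"] replicate_append_same[of l w] by (simp add: wpow_def)

lemma wpow_0: "wpow w 0 = []"
  by (simp add: wpow_def)

text \<open>Moves the leading 0 of the type D words into the repeated block, so that both types
  share one argument for odd i.\<close>

lemma wpow_conj: "a @ wpow (w @ a) l = wpow (a @ w) l @ a"
  by (induction l) (simp_all add: wpow_0 wpow_Suc flip: append_assoc)

definition pairs_down :: "nat \<Rightarrow> nat \<Rightarrow> nat list" where
  "pairs_down a b = concat (map (\<lambda>l. [l, l + 1]) (down a b))"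

lemma pairs_down_Cons: "b \<le> Suc a \<Longrightarrow> pairs_down (Suc a) b = [Suc a, Suc (Suc a)] @ pairs_down a b"
  by (simp add: pairs_down_def down_Cons)

lemma pairs_down_empty: "pairs_down a (Suc a) = []"
  by (simp add: pairs_down_def down_empty)

text \<open>A linear functional \<open>\<phi>\<close> on \<open>V'\<close> is a sequence \<open>x\<close> with \<open>x 0 = \<phi> \<delta>\<close> and
  \<open>x k = \<phi> (eps k)\<close>. Composing \<open>\<phi>\<close> with a simple reflection is \<open>act\<close>, and \<open>val\<close> is the value
  of \<open>\<phi>\<close> at a simple root.\<close>

definition act :: "series \<Rightarrow> nat \<Rightarrow> nat \<Rightarrow> vec \<Rightarrow> vec" where
  "act X n j x =
    (if j = 0 then (if X = TypeC then x(1 := x 0 - x 1) else x(1 := x 0 - x 2, 2 := x 0 - x 1))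
     else if j < n then x(j := x (j + 1), j + 1 := x j)
     else if X = TypeD then x(n - 1 := - x n, n := - x (n - 1))
     else x(n := - x n))"

definition val :: "series \<Rightarrow> nat \<Rightarrow> nat \<Rightarrow> vec \<Rightarrow> real" where
  "val X n j x =
    (if j = 0 then (if X = TypeC then x 0 - 2 * x 1 else x 0 - x 1 - x 2)
     else if j < n then x j - x (j + 1)
     else if X = TypeD then x (n - 1) + x n
     else if X = TypeC then 2 * x n
     else x n)"

fun run :: "series \<Rightarrow> nat \<Rightarrow> vec \<Rightarrow> nat list \<Rightarrow> vec" where
  "run X n x [] = x"
| "run X n x (j # w) = run X n (act X n j x) w"

fun legal :: "series \<Rightarrow> nat \<Rightarrow> vec \<Rightarrow> nat list \<Rightarrow> bool" where
  "legal X n x [] = True"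
| "legal X n x (j # w) \<longleftrightarrow> j \<le> n \<and> 0 < val X n j x \<and> legal X n (act X n j x) w"

lemma run_append: "run X n x (u @ v) = run X n (run X n x u) v"
  by (induction u arbitrary: x) auto

lemma legal_append: "legal X n x (u @ v) \<longleftrightarrow> legal X n x u \<and> legal X n (run X n x u) v"
  by (induction u arbitrary: x) auto

lemma act_swap: "1 \<le> j \<Longrightarrow> j < n \<Longrightarrow> act X n j x = x(j := x (j + 1), j + 1 := x j)"
  and val_swap: "1 \<le> j \<Longrightarrow> j < n \<Longrightarrow> val X n j x = x j - x (j + 1)"
  by (simp_all add: act_def val_def)

text \<open>The halves are the two spin coweights of type D, and in type C the effect of the long
  root 2 \<epsilon>_n.\<close>

definition classical_om :: "series \<Rightarrow> nat \<Rightarrow> nat \<Rightarrow> vec" where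
  "classical_om X n j = (\<lambda>k. if k = 0 \<or> n < k then 0
    else if X = TypeD \<and> n \<le> j + 1 then (if k = n \<and> j = n - 1 then - 1 / 2 else 1 / 2)
    else if k \<le> j then (if X = TypeC \<and> j = n then 1 / 2 else 1) else 0)"

section \<open>Classical root data and linear functionals in coordinates\<close>

locale classical = root_datum X n om rho s r
  for X :: series and n :: nat and om rho s r +
  assumes n2: "2 \<le> n"
    and om_eq: "om = classical_om X n"
    and type: "(X = TypeB \<and> rho = eps 1 + eps 2) \<or> (X = TypeC \<and> rho = scl 2 (eps 1)) \<or>
      (X = TypeD \<and> rho = eps 1 + eps 2)"
begin

lemma om_0: "om j 0 = 0"
  by (simp add: om_eq classical_om_def)

lemma dim: "ambient_dim X n = n"
  using type by auto

lemma ip_eps: "j \<in> I \<Longrightarrow> ip v (eps j) = v j"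
  by (rule inner_prod_eps) (simp add: dim)

lemma ip_eps': "1 \<le> j \<Longrightarrow> j \<le> n \<Longrightarrow> ip v (eps j) = v j"
  by (rule ip_eps) simp

lemma sr_eq: "j \<in> I \<Longrightarrow> sr j =
  (if j < n then eps j - eps (j + 1)
   else if X = TypeB then eps n else if X = TypeC then scl 2 (eps n) else eps (n - 1) + eps n)"
  using type by auto

lemma pairing_asr: "j \<le> n \<Longrightarrow> pairing n x (asr j) = val X n j x"
proof (cases "j = 0")
  case True
  have "pairing n x (asr 0) = pairing n x delta - pairing n x rho" by (simp add: asr_0 pairing_diff)
  then show ?thesis using True type n2
    by (auto simp: delta_def pairing_add pairing_scl pairing_eps val_def)
next
  case False
  assume "j \<le> n"
  then have j: "j \<in> I" using False by auto
  show ?thesis using type n2 j unfolding asr_finite[OF j] sr_eq[OF j]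
    by (auto simp: pairing_add pairing_diff pairing_scl pairing_eps val_def)
qed

text \<open>The right side is the pairing of x with the reflection of v, so \<open>act\<close> is
  the transpose of the simple reflection.\<close>

lemma pairing_act:
  assumes j: "j \<le> n"
  shows "pairing n (act X n j x) v = pairing n x v - 2 * ip v (asr j) / ip (asr j) (asr j) * val X n j x"
proof (cases "j = 0")
  case True
  have ipv: "ip v (asr 0) = - ip v rho" and ipr: "ip (asr 0) (asr 0) = ip rho rho" by (simp_all add: asr_0)
  show ?thesis
  proof (cases "X = TypeC")
    case C: True
    then have rho: "rho = scl 2 (eps 1)" using type by auto
    have "ip v rho = 2 * v 1" "ip rho rho = 4" using n2 by (simp_all add: rho ip_eps' eps_apply)
    then have q: "2 * ip v (asr 0) / ip (asr 0) (asr 0) = - v 1" by (simp add: ipv ipr)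
    show ?thesis using C n2 unfolding True q
      by (simp add: act_def val_def pairing_upd algebra_simps)
  next
    case False
    then have rho: "rho = eps 1 + eps 2" using type by auto
    have "ip v rho = v 1 + v 2" "ip rho rho = 2" using n2 by (simp_all add: rho ip_eps' eps_apply)
    then have q: "2 * ip v (asr 0) / ip (asr 0) (asr 0) = - (v 1 + v 2)" by (simp add: ipv ipr)
    show ?thesis using False n2 unfolding True q
      by (simp add: act_def val_def pairing_upd algebra_simps)
  qed
next
  case False
  then have jI: "j \<in> I" using j by auto
  show ?thesis
  proof (cases "j < n")
    case True
    have "ip v (sr j) = v j - v (j + 1)" "ip (sr j) (sr j) = 2"
      using True jI by (simp_all add: sr_eq[OF jI] ip_eps' eps_apply)
    then have q: "2 * ip v (sr j) / ip (sr j) (sr j) = v j - v (j + 1)" by simp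
    show ?thesis using True False j unfolding asr_finite[OF jI] q
      by (simp add: act_swap val_swap pairing_upd algebra_simps)
  next
    case nj: False
    then have jn: "j = n" using j by simp
    from type show ?thesis
    proof (elim disjE conjE)
      assume X: "X = TypeB"
      have sr: "sr j = eps n" using sr_eq[OF jI] nj X by simp
      have "ip v (sr j) = v n" "ip (sr j) (sr j) = 1" using n2 by (simp_all add: sr ip_eps' eps_apply)
      then have q: "2 * ip v (sr j) / ip (sr j) (sr j) = 2 * v n" by simp
      show ?thesis using X jn n2 unfolding asr_finite[OF jI] q
        by (simp add: act_def val_def pairing_upd algebra_simps)
    next
      assume X: "X = TypeC"
      have sr: "sr j = scl 2 (eps n)" using sr_eq[OF jI] nj X by simp
      have "ip v (sr j) = 2 * v n" "ip (sr j) (sr j) = 4" using n2 by (simp_all add: sr ip_eps' eps_apply)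
      then have q: "2 * ip v (sr j) / ip (sr j) (sr j) = v n" by simp
      show ?thesis using X jn n2 unfolding asr_finite[OF jI] q
        by (simp add: act_def val_def pairing_upd algebra_simps)
    next
      assume X: "X = TypeD"
      have sr: "sr j = eps (n - 1) + eps n" using sr_eq[OF jI] nj X by simp
      have "ip v (sr j) = v (n - 1) + v n" "ip (sr j) (sr j) = 2"
        using n2 by (simp_all add: sr ip_eps' eps_apply)
      then have q: "2 * ip v (sr j) / ip (sr j) (sr j) = v (n - 1) + v n" by simp
      have "n \<noteq> n - 1" using n2 by simp
      then show ?thesis using X jn n2 unfolding asr_finite[OF jI] q
        by (simp add: act_def val_def pairing_upd algebra_simps)
    qed
  qed
qed

lemma pairing_run: "wrd w \<Longrightarrow> pairing n x (elt w v) = pairing n (run X n x w) v"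
proof (induction w arbitrary: x)
  case (Cons j w)
  then have j: "j \<le> n" by auto
  have "pairing n x (elt (j # w) v) = pairing n (act X n j x) (elt w v)"
    by (simp add: elt_Cons simple_refl_expand pairing_diff pairing_scl pairing_act[OF j] pairing_asr[OF j])
  then show ?case using Cons by simp
qed simp

text \<open>The value tested at each letter is that of the functional x at the root which must be
  positive for the word to stay reduced.\<close>

lemma legal_reduced:
  assumes pos: "\<And>j. j \<le> n \<Longrightarrow> 0 < val X n j x"
  shows "reduced u \<Longrightarrow> legal X n (run X n x u) w \<Longrightarrow> reduced (u @ w)"
proof (induction w arbitrary: u)
  case (Cons j w)
  then have j: "j \<le> n" and v: "0 < val X n j (run X n x u)" by auto
  have wu: "wrd u" using Cons.prems(1) by (rule reduced_wrd)
  have "0 < pairing n x (elt u (asr j))"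
    using v by (simp add: pairing_run[OF wu] pairing_asr[OF j])
  then have "elt u (asr j) \<in> P"
    using P_iff_functional[of "pairing n x", OF pairing_add pairing_scl _ elt_AR[OF wu asr_in_AR[OF j]]]
      pos pairing_asr by simp
  then have "reduced (u @ [j])" using Cons.prems(1) j by (simp add: reduced_snoc_iff)
  moreover have "legal X n (run X n x (u @ [j])) w" using Cons.prems(2) by (simp add: run_append)
  ultimately show ?case using Cons.IH[of "u @ [j]"] by simp
qed simp

lemma root_coord_eqI:
  assumes "u \<in> AR" "v \<in> AR" "\<And>x. pairing n x u = pairing n x v"
  shows "u = v"
proof
  fix k
  show "u k = v k"
  proof (cases "k \<le> n")
    case True
    then show ?thesis using assms(3)[of "eps k"] by (simp add: pairing_eps_left)
  next
    case False
    have "z k = 0" if z: "z \<in> AR" for z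
    proof -
      obtain \<alpha> m where "\<alpha> \<in> R" "z = \<alpha> + scl (real_of_int m) delta" using z by (auto simp: AR_def)
      then show ?thesis using spn_support[OF root_in_spn, of \<alpha> k] False by (simp add: dim vec_apply)
    qed
    from this[OF assms(1)] this[OF assms(2)] show ?thesis by simp
  qed
qed

text \<open>Four kinds of functional are run through the word: \<open>x0\<close> certifies
  reducedness, an arbitrary x identifies the images of simple roots, and \<open>om k\<close> and
  \<open>eps 0\<close> give the two signs required of the image of \<open>sr i\<close>.\<close>

lemma criterion_classical:
  assumes ik: "i \<in> I" "k \<in> I" and pos: "\<And>j. j \<le> n \<Longrightarrow> 0 < val X n j x0" and y: "legal X n x0 y"
    and p: "bij_betw p (I - {i}) (I - {k})"
    and val: "\<And>j x. j \<in> I - {i} \<Longrightarrow> val X n j (run X n x y) = val X n (p j) x"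
    and neg: "val X n i (run X n (om k) y) < 0" and d: "0 < val X n i (run X n (eps 0) y)"
  shows "criterion i y k"
proof -
  have red: "reduced y" using legal_reduced[OF pos, where u = "[]" and w = y] y by simp
  have wy: "wrd y" using red by (rule reduced_wrd)
  have pair: "pairing n x (elt y (sr j)) = val X n j (run X n x y)" if "j \<in> I" for x j
    using that pairing_run[OF wy] pairing_asr[of j] by (simp add: asr_finite[OF that])
  have "elt y (sr j) = sr (p j)" if j: "j \<in> I - {i}" for j
  proof (rule root_coord_eqI)
    have jI: "j \<in> I" and pj: "p j \<in> I" using p j by (auto simp: bij_betw_def)
    show "elt y (sr j) \<in> AR" "sr (p j) \<in> AR"
      using elt_AR[OF wy root_in_AR[OF roots.simple[OF jI]]] root_in_AR[OF roots.simple[OF pj]] by auto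
    show "pairing n x (elt y (sr j)) = pairing n x (sr (p j))" for x
      using pair[OF jI] val[OF j] pairing_asr[of "p j"] pj by (simp add: asr_finite[OF pj])
  qed
  moreover have "ip v (om k) = pairing n (om k) v" for v
    by (simp add: inner_prod_def dim pairing_def sum.atLeast_Suc_atMost[of 0 n] om_0 mult.commute)
  then have "cf k (elt y (sr i)) < 0" using neg pair[OF ik(1)] by simp
  moreover have "0 < (elt y (sr i)) 0"
    using d pair[OF ik(1), of "eps 0"] by (simp add: pairing_eps_left)
  ultimately show ?thesis using ik red p by (auto simp: criterion_def)
qed

end

subsection \<open>Moves\<close>

lemma run_up:
  "1 \<le> a \<Longrightarrow> a \<le> b + 1 \<Longrightarrow> b < n \<Longrightarrow>
    run X n x (up a b) = (\<lambda>k. if a \<le> k \<and> k \<le> b then x (k + 1) else if k = b + 1 then x a else x k)"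
proof (induction b)
  case 0
  then have "a = Suc 0" by simp
  then show ?case using up_empty[of 0] by (auto simp: fun_eq_iff)
next
  case (Suc b)
  show ?case
  proof (cases "a = Suc (Suc b)")
    case True
    then show ?thesis by (auto simp: up_empty fun_eq_iff)
  next
    case False
    then have "a \<le> b + 1" using Suc by simp
    then show ?thesis using Suc by (auto simp: up_snoc run_append act_swap fun_eq_iff)
  qed
qed

text \<open>The entry at place a travels right and must exceed each entry it passes.\<close>

lemma legal_up:
  "1 \<le> a \<Longrightarrow> a \<le> b + 1 \<Longrightarrow> b < n \<Longrightarrow> (\<And>k. a < k \<Longrightarrow> k \<le> b + 1 \<Longrightarrow> x k < x a) \<Longrightarrow> legal X n x (up a b)"
proof (induction b)
  case 0
  then have "a = Suc 0" by simp
  then show ?case using up_empty[of 0] by simp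
next
  case (Suc b)
  show ?case
  proof (cases "a = Suc (Suc b)")
    case True
    then show ?thesis by (simp add: up_empty)
  next
    case False
    then have "a \<le> b + 1" using Suc by simp
    then show ?thesis using Suc by (simp add: up_snoc legal_append val_swap run_up)
  qed
qed

lemma run_down:
  "1 \<le> b \<Longrightarrow> b \<le> a + 1 \<Longrightarrow> a < n \<Longrightarrow>
    run X n x (down a b) = (\<lambda>k. if k = b then x (a + 1) else if b < k \<and> k \<le> a + 1 then x (k - 1) else x k)"
proof (induction a arbitrary: x)
  case 0
  then have "b = Suc 0" by simp
  then show ?case using down_empty[of 0] by (auto simp: fun_eq_iff)
next
  case (Suc a)
  show ?case
  proof (cases "b = Suc (Suc a)")
    case True
    then show ?thesis by (auto simp: down_empty fun_eq_iff)
  next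
    case False
    then have "b \<le> a + 1" using Suc by simp
    then show ?thesis using Suc by (auto simp: down_Cons act_swap fun_eq_iff)
  qed
qed

text \<open>The entry at place a + 1 travels left and must be smaller than each entry it
  passes.\<close>

lemma legal_down:
  "1 \<le> b \<Longrightarrow> b \<le> a + 1 \<Longrightarrow> a < n \<Longrightarrow> (\<And>k. b \<le> k \<Longrightarrow> k \<le> a \<Longrightarrow> x (a + 1) < x k) \<Longrightarrow> legal X n x (down a b)"
proof (induction a arbitrary: x)
  case 0
  then have "b = Suc 0" by simp
  then show ?case using down_empty[of 0] by simp
next
  case (Suc a)
  show ?case
  proof (cases "b = Suc (Suc a)")
    case True
    then show ?thesis by (simp add: down_empty)
  next
    case False
    then have b: "b \<le> a + 1" using Suc by simp
    have "legal X n (act X n (Suc a) x) (down a b)"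
      using Suc.prems b by (intro Suc.IH) (auto simp: act_swap)
    then show ?thesis using Suc.prems b by (simp add: down_Cons val_swap)
  qed
qed

lemma run_pairs_down:
  "1 \<le> b \<Longrightarrow> b \<le> a + 1 \<Longrightarrow> a + 1 < n \<Longrightarrow> run X n x (pairs_down a b) =
    (\<lambda>k. if k = b then x (a + 1) else if k = b + 1 then x (a + 2)
      else if b + 2 \<le> k \<and> k \<le> a + 2 then x (k - 2) else x k)"
proof (induction a arbitrary: x)
  case 0
  then have "b = Suc 0" by simp
  then show ?case using pairs_down_empty[of 0] by (auto simp: fun_eq_iff numeral_2_eq_2)
next
  case (Suc a)
  show ?case
  proof (cases "b = Suc (Suc a)")
    case True
    then show ?thesis by (auto simp: pairs_down_empty fun_eq_iff)
  next
    case False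
    then have "b \<le> a + 1" using Suc by simp
    then show ?thesis using Suc by (auto simp: pairs_down_Cons act_swap fun_eq_iff numeral_2_eq_2)
  qed
qed

text \<open>The pair at places a + 1 and a + 2 travels left, keeping its order.\<close>

lemma legal_pairs_down:
  "1 \<le> b \<Longrightarrow> b \<le> a + 1 \<Longrightarrow> a + 1 < n \<Longrightarrow>
    (\<And>k. b \<le> k \<Longrightarrow> k \<le> a \<Longrightarrow> x (a + 1) < x k \<and> x (a + 2) < x k) \<Longrightarrow> legal X n x (pairs_down a b)"
proof (induction a arbitrary: x)
  case 0
  then have "b = Suc 0" by simp
  then show ?case using pairs_down_empty[of 0] by simp
next
  case (Suc a)
  show ?case
  proof (cases "b = Suc (Suc a)")
    case True
    then show ?thesis by (simp add: pairs_down_empty)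
  next
    case False
    then have b: "b \<le> a + 1" using Suc by simp
    have "legal X n (act X n (Suc (Suc a)) (act X n (Suc a) x)) (pairs_down a b)"
      using Suc.prems b by (intro Suc.IH) (auto simp: act_swap)
    then show ?thesis using Suc.prems b by (simp add: pairs_down_Cons val_swap act_swap)
  qed
qed

text \<open>Each factor of the word moves the pair formed by the original first two entries two
  places to the right.\<close>

lemma run_B_word:
  "2 * M + 2 \<le> n \<Longrightarrow> run X n x (B_word M) =
    (\<lambda>k. if 1 \<le> k \<and> k \<le> 2 * M then x (k + 2) else if k = 2 * M + 1 then x 1
      else if k = 2 * M + 2 then x 2 else x k)"
proof (induction M)
  case 0
  then show ?case by (auto simp: B_word_def fun_eq_iff numeral_2_eq_2)
next
  case (Suc M)
  let ?y = "\<lambda>k. if 1 \<le> k \<and> k \<le> 2 * M then x (k + 2) else if k = 2 * M + 1 then x 1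
      else if k = 2 * M + 2 then x 2 else x k"
  have "run X n x (B_word (Suc M)) = run X n ?y [2 * M + 2, 2 * M + 1, 2 * M + 3, 2 * M + 2]"
    using Suc by (simp add: B_word_Suc run_append)
  also have "\<dots> = (\<lambda>k. if 1 \<le> k \<and> k \<le> 2 * Suc M then x (k + 2) else if k = 2 * Suc M + 1 then x 1
      else if k = 2 * Suc M + 2 then x 2 else x k)"
    using Suc.prems by (intro ext) (simp add: act_swap, simp add: numeral_eq_Suc)
  finally show ?case .
qed

lemma legal_B_word:
  "2 * M + 2 \<le> n \<Longrightarrow> (\<And>k. 3 \<le> k \<Longrightarrow> k \<le> 2 * M + 2 \<Longrightarrow> x k < x 1 \<and> x k < x 2) \<Longrightarrow> legal X n x (B_word M)"
proof (induction M)
  case 0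
  then show ?case by (simp add: B_word_def)
next
  case (Suc M)
  then show ?case by (simp add: B_word_Suc legal_append run_B_word act_swap val_swap)
qed

text \<open>The letter 0 replaces the first two entries by \<open>x 0 - x 2\<close> and
  \<open>x 0 - x 1\<close>, the following block carries them to the end, and the shorter word treats
  what has moved to the front.\<close>

lemma run_reversal:
  assumes "X \<noteq> TypeC"
  shows "2 * M + 2 \<le> n \<Longrightarrow> run X n x ([0] @ Bs0_prod M) =
    (\<lambda>k. if 1 \<le> k \<and> k \<le> 2 * M + 2 then x 0 - x (2 * M + 3 - k) else x k)"
proof (induction M arbitrary: x)
  case 0
  have "k = 1 \<or> k = 2" if "1 \<le> k" "k \<le> 2" for k :: nat using that by linarith
  then show ?case using assms by (auto simp: Bs0_prod_def act_def fun_eq_iff)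
next
  case (Suc M)
  define y where "y = run X n x ([0] @ B_word (Suc M))"
  have y: "y = (\<lambda>k. if 1 \<le> k \<and> k \<le> 2 * Suc M then x (k + 2)
      else if k = 2 * Suc M + 1 then x 0 - x 2 else if k = 2 * Suc M + 2 then x 0 - x 1 else x k)"
    unfolding y_def using Suc.prems assms by (intro ext) (simp add: run_B_word act_def)
  have "run X n x ([0] @ Bs0_prod (Suc M)) = run X n y ([0] @ Bs0_prod M)"
    by (simp only: y_def Bs0_prod_Suc run_append append_assoc)
  also have "\<dots> = (\<lambda>k. if 1 \<le> k \<and> k \<le> 2 * M + 2 then y 0 - y (2 * M + 3 - k) else y k)"
    using Suc by (intro Suc.IH) simp
  also have "\<dots> = (\<lambda>k. if 1 \<le> k \<and> k \<le> 2 * Suc M + 2 then x 0 - x (2 * Suc M + 3 - k) else x k)"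
  proof
    fix k
    consider "k = 0" | "1 \<le> k" "k \<le> 2 * M + 2" | "k = 2 * M + 3" | "k = 2 * M + 4" | "2 * M + 5 \<le> k" by linarith
    then show "(if 1 \<le> k \<and> k \<le> 2 * M + 2 then y 0 - y (2 * M + 3 - k) else y k) =
      (if 1 \<le> k \<and> k \<le> 2 * Suc M + 2 then x 0 - x (2 * Suc M + 3 - k) else x k)"
    proof cases
      case 2
      define j where "j = 2 * M + 3 - k"
      have j: "1 \<le> j" "j \<le> 2 * M + 2" "2 * Suc M + 3 - k = j + 2" using 2 by (auto simp: j_def)
      then have "y j = x (j + 2)" "y 0 = x 0" by (simp_all add: y)
      then show ?thesis using 2 j by (simp add: j_def[symmetric])
    next
      case 3
      then have "2 * Suc M + 3 - k = 2" "y k = x 0 - x 2" by (auto simp: y)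
      then show ?thesis using 3 by simp
    next
      case 4
      then have "2 * Suc M + 3 - k = 1" "y k = x 0 - x 1" by (auto simp: y)
      then show ?thesis using 4 by simp
    qed (auto simp: y)
  qed
  finally show ?case .
qed

lemma legal_reversal:
  assumes "X \<noteq> TypeC"
  shows "2 * M + 2 \<le> n \<Longrightarrow> (\<And>a b. 1 \<le> a \<Longrightarrow> a < b \<Longrightarrow> b \<le> 2 * M + 2 \<Longrightarrow> x b < x a) \<Longrightarrow>
    x 1 + x 2 < x 0 \<Longrightarrow> legal X n x ([0] @ Bs0_prod M)"
proof (induction M arbitrary: x)
  case 0
  then show ?case using assms by (simp add: Bs0_prod_def val_def)
next
  case (Suc M)
  define y where "y = run X n x ([0] @ B_word (Suc M))"
  have y: "y = (\<lambda>k. if 1 \<le> k \<and> k \<le> 2 * Suc M then x (k + 2)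
      else if k = 2 * Suc M + 1 then x 0 - x 2 else if k = 2 * Suc M + 2 then x 0 - x 1 else x k)"
    unfolding y_def using Suc.prems assms by (intro ext) (simp add: run_B_word act_def)
  have dec: "x b < x a" if "1 \<le> a" "a < b" "b \<le> 2 * Suc M + 2" for a b using Suc.prems(2)[OF that] .
  have "legal X n (act X n 0 x) (B_word (Suc M))"
  proof (rule legal_B_word[OF Suc.prems(1)])
    fix k assume k: "3 \<le> k" "k \<le> 2 * Suc M + 2"
    then have "x k < x 1" "x k < x 2" using dec[of 1 k] dec[of 2 k] by auto
    then show "act X n 0 x k < act X n 0 x 1 \<and> act X n 0 x k < act X n 0 x 2"
      using Suc.prems(3) k assms by (auto simp: act_def)
  qed
  moreover have "legal X n y ([0] @ Bs0_prod M)"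
  proof (rule Suc.IH)
    show "2 * M + 2 \<le> n" using Suc.prems by simp
    show "y b < y a" if "1 \<le> a" "a < b" "b \<le> 2 * M + 2" for a b
      using dec[of "a + 2" "b + 2"] that by (simp add: y)
    have "x 3 < x 1" "x 4 < x 2" using dec[of 1 3] dec[of 2 4] by auto
    then show "y 1 + y 2 < y 0" using Suc.prems(3) by (simp add: y numeral_eq_Suc)
  qed
  ultimately have "legal X n x ([0] @ B_word (Suc M) @ [0] @ Bs0_prod M)"
    using Suc.prems(3) assms by (simp add: legal_append run_append val_def y_def)
  then show ?case by (simp add: Bs0_prod_Suc)
qed

text \<open>Carries entry a to the end, changes its sign there and brings it back to place i. In
  type D the letter n negates two entries, so the last coordinate changes sign as well.\<close>

definition cycle :: "series \<Rightarrow> nat \<Rightarrow> nat \<Rightarrow> nat \<Rightarrow> nat list" where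
  "cycle X n a i = up a n @ down (if X = TypeD then n - 2 else n - 1) i"

lemma run_up_n:
  assumes "1 \<le> a" "a \<le> (if X = TypeD then n - 1 else n)" "2 \<le> n" "m = (if X = TypeD then n - 2 else n - 1)"
  shows "run X n x (up a n) k = (if a \<le> k \<and> k \<le> m then x (k + 1) else if k = m + 1 then - x a
      else if k = n \<and> X = TypeD then - x n else x k)"
proof -
  have an: "a \<le> n - 1 + 1" "n - 1 < n" "a \<le> n" using assms by (auto split: if_splits)
  have u: "run X n x (up a n) = act X n n (\<lambda>k. if a \<le> k \<and> k \<le> n - 1 then x (k + 1)
      else if k = n - 1 + 1 then x a else x k)"
    using run_up[OF assms(1) an(1,2), of X x] up_split[of a n] an assms by (simp add: run_append)
  show ?thesis
  proof (cases "X = TypeD")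
    case True
    then have n: "n = m + 2" "a \<le> m + 1" using assms by auto
    then have "act X n n z = z(m + 1 := - z (m + 2), m + 2 := - z (m + 1))" for z
      using True by (simp add: act_def)
    then show ?thesis using True n unfolding u by auto
  next
    case False
    then have n: "n = m + 1" "a \<le> m + 1" using assms by auto
    then have "act X n n z = z(m + 1 := - z (m + 1))" for z
      using False by (simp add: act_def)
    then show ?thesis using False n unfolding u by auto
  qed
qed

lemma run_cycle:
  assumes "1 \<le> a" "a \<le> i" "i \<le> (if X = TypeD then n - 1 else n)" "2 \<le> n"
  shows "run X n x (cycle X n a i) = (\<lambda>k. if a \<le> k \<and> k < i then x (k + 1) else if k = i then - x a
    else if k = n \<and> X = TypeD then - x n else x k)"
proof -
  define m where "m = (if X = TypeD then n - 2 else n - 1)"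
  have m: "i \<le> m + 1" "m < n" "1 \<le> i" using assms by (auto simp: m_def split: if_splits)
  have E: "run X n x (cycle X n a i) = (\<lambda>k. if k = i then run X n x (up a n) (m + 1)
      else if i < k \<and> k \<le> m + 1 then run X n x (up a n) (k - 1) else run X n x (up a n) k)"
    by (simp only: cycle_def m_def[symmetric] run_append run_down[OF m(3,1,2)])
  have U: "run X n x (up a n) k = (if a \<le> k \<and> k \<le> m then x (k + 1) else if k = m + 1 then - x a
      else if k = n \<and> X = TypeD then - x n else x k)" for k
    using assms by (intro run_up_n m_def) auto
  have run: "run X n x (cycle X n a i) k = (let f = \<lambda>k. if a \<le> k \<and> k \<le> m then x (k + 1)
      else if k = m + 1 then - x a else if k = n \<and> X = TypeD then - x n else x k in
      if k = i then f (m + 1) else if i < k \<and> k \<le> m + 1 then f (k - 1) else f k)" for k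
    by (unfold E U Let_def) (rule refl)
  show ?thesis
  proof
    fix k
    have nm: "n = (if X = TypeD then m + 2 else m + 1)" using assms by (auto simp: m_def split: if_splits)
    consider "k < a" | "a \<le> k" "k < i" | "k = i" | "i < k" "k \<le> m + 1" | "m + 1 < k" "i < k" by linarith
    then show "run X n x (cycle X n a i) k = (if a \<le> k \<and> k < i then x (k + 1) else if k = i then - x a
      else if k = n \<and> X = TypeD then - x n else x k)"
    proof cases
      case 4
      then have "\<not> k - 1 = m + 1" "a \<le> k - 1" "k - 1 \<le> m" "k - 1 + 1 = k" "k \<noteq> i" "\<not> k < i"
        "\<not> (k = n \<and> X = TypeD)" using assms(2) nm by auto
      then show ?thesis using 4 unfolding run Let_def by auto
    qed (unfold run Let_def, use assms(1,2) m nm in \<open>auto split: if_splits\<close>)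
  qed
qed

text \<open>The three inequalities serve the way out, the sign change and the way back. In type D
  the sign change needs \<open>x a + x n\<close> positive, which is the last inequality at
  n.\<close>

lemma legal_cycle:
  assumes "1 \<le> a" "a \<le> i" "i \<le> (if X = TypeD then n - 1 else n)" "2 \<le> n"
    and lt: "\<And>k. a < k \<Longrightarrow> k \<le> n \<Longrightarrow> x k < x a" and pos: "0 < x a"
    and gt: "\<And>k. i < k \<Longrightarrow> k \<le> n \<Longrightarrow> - x a < x k"
  shows "legal X n x (cycle X n a i)"
proof -
  have an: "a \<le> n - 1 + 1" "n - 1 < n" "a \<le> n" using assms by (auto split: if_splits)
  have run: "run X n x (up a (n - 1)) = (\<lambda>k. if a \<le> k \<and> k \<le> n - 1 then x (k + 1)
      else if k = n - 1 + 1 then x a else x k)"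
    using run_up[OF assms(1) an(1,2)] .
  have "legal X n x (up a (n - 1))" using assms an by (intro legal_up) auto
  moreover have "0 < val X n n (run X n x (up a (n - 1)))"
  proof (cases "X = TypeD")
    case True
    then have "i < n" using assms by auto
    then have "- x a < x n" "a \<le> n - 1" "\<not> n \<le> n - 1" using gt[of n] assms by auto
    then show ?thesis using True assms(4) unfolding run by (simp add: val_def)
  next
    case False
    have "\<not> n \<le> n - 1" using assms(4) by simp
    then show ?thesis using False assms(4) pos unfolding run by (simp add: val_def)
  qed
  ultimately have up: "legal X n x (up a n)" using up_split[of a n] an assms by (simp add: legal_append)
  define m where "m = (if X = TypeD then n - 2 else n - 1)"
  have m: "i \<le> m + 1" "m < n" "1 \<le> i" using assms(1-4) by (auto simp: m_def split: if_splits)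
  have U: "run X n x (up a n) k = (if a \<le> k \<and> k \<le> m then x (k + 1) else if k = m + 1 then - x a
      else if k = n \<and> X = TypeD then - x n else x k)" for k
    using assms(1-4) by (intro run_up_n m_def) auto
  have "legal X n (run X n x (up a n)) (down m i)"
  proof (rule legal_down[OF m(3,1,2)])
    fix k assume k: "i \<le> k" "k \<le> m"
    then have "run X n x (up a n) k = x (k + 1)" "- x a < x (k + 1)"
      using assms(2) m(2) gt[of "k + 1"] by (simp_all add: U)
    then show "run X n x (up a n) (m + 1) < run X n x (up a n) k" using m by (simp add: U)
  qed
  then show ?thesis using up by (simp add: cycle_def legal_append m_def)
qed

subsection \<open>Shifts\<close>

text \<open>The effect of the block that is repeated \<open>(i - 1) div 2\<close> times in \<open>y\<^sub>i\<close> for odd \<open>i\<close>.\<close>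

definition shift :: "nat \<Rightarrow> vec \<Rightarrow> vec" where
  "shift i x = (\<lambda>k. if 1 \<le> k \<and> k + 2 \<le> i then x (k + 2) else if k = i - 1 then x 1 - x 0
    else if k = i then x 2 - x 0 else x k)"

text \<open>One block rotates the first i entries by two places and lowers those that wrap around by
  \<open>x 0\<close>. The bound on l ensures that no entry wraps around twice.\<close>

lemma run_wpow_shift:
  assumes "\<And>x. run X n x w = shift i x"
  shows "2 * l + 1 \<le> i \<Longrightarrow> 3 \<le> i \<Longrightarrow> run X n x (wpow w l) =
    (\<lambda>k. if 1 \<le> k \<and> k \<le> i then (if k + 2 * l \<le> i then x (k + 2 * l) else x (k + 2 * l - i) - x 0) else x k)"
proof (induction l)
  case 0
  then show ?case by (auto simp: wpow_0 fun_eq_iff)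
next
  case (Suc l)
  let ?y = "\<lambda>k. if 1 \<le> k \<and> k \<le> i then (if k + 2 * l \<le> i then x (k + 2 * l) else x (k + 2 * l - i) - x 0) else x k"
  have "run X n x (wpow w (Suc l)) = shift i ?y"
    using Suc assms by (simp add: wpow_Suc run_append)
  also have "\<dots> = (\<lambda>k. if 1 \<le> k \<and> k \<le> i then (if k + 2 * Suc l \<le> i then x (k + 2 * Suc l)
      else x (k + 2 * Suc l - i) - x 0) else x k)"
  proof
    fix k
    consider "k = 0" | "1 \<le> k" "k + 2 \<le> i" | "k = i - 1" | "k = i" | "i < k" using Suc.prems by linarith
    then show "shift i ?y k = (if 1 \<le> k \<and> k \<le> i then (if k + 2 * Suc l \<le> i then x (k + 2 * Suc l)
      else x (k + 2 * Suc l - i) - x 0) else x k)"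
    proof cases
      case 3
      then have "shift i ?y k = ?y 1 - ?y 0" unfolding shift_def using Suc.prems by auto
      moreover have "1 \<le> k" "k \<le> i" "\<not> k + 2 * Suc l \<le> i" "k + 2 * Suc l - i = 1 + 2 * l" "1 + 2 * l \<le> i" "1 \<le> i"
        using 3 Suc.prems by auto
      ultimately show ?thesis by simp
    next
      case 4
      then have "shift i ?y k = ?y 2 - ?y 0" unfolding shift_def using Suc.prems by auto
      moreover have "1 \<le> k" "k \<le> i" "\<not> k + 2 * Suc l \<le> i" "k + 2 * Suc l - i = 2 + 2 * l" "2 + 2 * l \<le> i" "2 \<le> i"
        using 4 Suc.prems by auto
      ultimately show ?thesis by simp
    qed (use Suc.prems in \<open>auto simp: shift_def\<close>)
  qed
  finally show ?case .
qed

text \<open>An invariant of \<open>shift\<close> under which each block is legal.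
  \<open>x 1 - x i < x 0\<close> places the wrapped entry \<open>x 1 - x 0\<close> below
  \<open>x i\<close>, so the sequence stays decreasing; the bound on the tail lets entries pass
  through it in both directions.\<close>

definition shiftable :: "nat \<Rightarrow> nat \<Rightarrow> vec \<Rightarrow> bool" where
  "shiftable n i x \<longleftrightarrow> (\<forall>a b. 1 \<le> a \<longrightarrow> a < b \<longrightarrow> b \<le> i \<longrightarrow> x b < x a) \<and> x 1 + x 2 < x 0 \<and> x 1 < x 0 \<and>
    x 1 - x i < x 0 \<and> (\<forall>k. i < k \<longrightarrow> k \<le> n \<longrightarrow> \<bar>x k\<bar> < x 0 - x 1)"

lemma shiftable_shift:
  assumes s: "shiftable n i x" and i: "3 \<le> i"
  shows "shiftable n i (shift i x)"
proof -
  have dec: "x b < x a" if "1 \<le> a" "a < b" "b \<le> i" for a b using s that by (simp add: shiftable_def)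
  have h: "x 1 + x 2 < x 0" "x 1 < x 0" "x 1 - x i < x 0" "\<And>k. i < k \<Longrightarrow> k \<le> n \<Longrightarrow> \<bar>x k\<bar> < x 0 - x 1"
    using s by (auto simp: shiftable_def)
  have 21: "x 2 < x 1" and 31: "x 3 < x 1" and 32: "x 3 < x 2" using dec[of 1 2] dec[of 1 3] dec[of 2 3] i by auto
  have le: "x i \<le> x k" if "1 \<le> k" "k \<le> i" for k using dec[of k i] that by (cases "k = i") auto
  have S0: "shift i x 0 = x 0" "shift i x 1 = x 3" "shift i x i = x 2 - x 0" "shift i x (i - 1) = x 1 - x 0"
    using i by (auto simp: shift_def numeral_3_eq_3)
  have S2: "shift i x 2 = (if i = 3 then x 1 - x 0 else x 4)" using i by (auto simp: shift_def)
  show ?thesis unfolding shiftable_def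
  proof (intro conjI allI impI)
    fix a b assume ab: "1 \<le> a" "a < b" "b \<le> i"
    consider "b + 2 \<le> i" | "b = i - 1" | "b = i" "a = i - 1" | "b = i" "a + 2 \<le> i" using ab i by linarith
    then show "shift i x b < shift i x a"
    proof cases
      case 1
      then show ?thesis using dec[of "a + 2" "b + 2"] ab by (simp add: shift_def)
    next
      case 2
      then have a2: "a + 2 \<le> i" using ab by linarith
      then have "shift i x a = x (a + 2)" using ab by (simp add: shift_def)
      moreover have "x i \<le> x (a + 2)" using le[OF _ a2] by simp
      ultimately show ?thesis using 2 h(3) S0 by simp
    next
      case 3
      then show ?thesis using S0 21 by simp
    next
      case 4
      then have "shift i x a = x (a + 2)" using ab by (simp add: shift_def)
      then show ?thesis using 4 le[of "a + 2"] ab h(3) S0 21 by simp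
    qed
  next
    have "x 4 < x 2" if "i \<noteq> 3" using dec[of 2 4] i that by simp
    then show "shift i x 1 + shift i x 2 < shift i x 0" using S0 S2 h 31 32 by auto
  next
    show "shift i x 1 < shift i x 0" "shift i x 1 - shift i x i < shift i x 0" using S0 h 31 32 by auto
  next
    fix k assume k: "i < k" "k \<le> n"
    moreover have "k \<noteq> i - 1" "\<not> k + 2 \<le> i" "k \<noteq> i" using k by auto
    ultimately have "shift i x k = x k" by (simp add: shift_def)
    then show "\<bar>shift i x k\<bar> < shift i x 0 - shift i x 1" using h(4)[OF k] 31 S0 by simp
  qed
qed

lemma legal_wpow_shift:
  assumes run: "\<And>x. run X n x w = shift i x" and leg: "\<And>x. shiftable n i x \<Longrightarrow> legal X n x w"
    and s: "shiftable n i x" and i: "3 \<le> i"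
  shows "legal X n x (wpow w l) \<and> shiftable n i (run X n x (wpow w l))"
proof (induction l)
  case 0
  then show ?case using s by (simp add: wpow_0)
next
  case (Suc l)
  then show ?case using leg shiftable_shift[OF _ i] by (simp add: wpow_Suc legal_append run_append run)
qed

subsection \<open>Types B, C and D\<close>

text \<open>A functional positive on the affine simple roots, from which legality is checked.\<close>

definition base :: "nat \<Rightarrow> vec" where
  "base n = (\<lambda>k. if k = 0 then 2 * real n + 1 else real n + 1 - real k)"

lemma val_base: "2 \<le> n \<Longrightarrow> j \<le> n \<Longrightarrow> 0 < val X n j (base n)"
  by (auto simp: val_def base_def)

lemma shiftable_base: "2 \<le> i \<Longrightarrow> i \<le> n \<Longrightarrow> shiftable n i (base n)"
  by (auto simp: shiftable_def base_def)

text \<open>The effect of a whole word \<open>y\<^sub>i\<close>; the translation is by \<open>c (\<epsilon>\<^sub>1 + \<dots> + \<epsilon>\<^sub>i)\<close> up to sign.\<close>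

definition final :: "series \<Rightarrow> nat \<Rightarrow> nat \<Rightarrow> nat \<Rightarrow> vec \<Rightarrow> vec" where
  "final X n c i x = (\<lambda>k. if 1 \<le> k \<and> k \<le> i then c * x 0 - x (i + 1 - k)
    else if k = n \<and> X = TypeD \<and> c = 2 then - x n else x k)"

context classical
begin

text \<open>The hypotheses of \<open>criterion_classical\<close> as one predicate, so that they can
  be transported along the diagram automorphism of type D.\<close>

definition crit_data :: "vec \<Rightarrow> nat \<Rightarrow> nat list \<Rightarrow> nat \<Rightarrow> (nat \<Rightarrow> nat) \<Rightarrow> bool" where
  "crit_data x0 i y k p \<longleftrightarrow> i \<in> I \<and> k \<in> I \<and> (\<forall>j\<le>n. 0 < val X n j x0) \<and> legal X n x0 y \<and>
    bij_betw p (I - {i}) (I - {k}) \<and>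
    (\<forall>j\<in>I - {i}. \<forall>x. val X n j (run X n x y) = val X n (p j) x) \<and>
    val X n i (run X n (om k) y) < 0 \<and> 0 < val X n i (run X n (eps 0) y)"

lemma crit_data_criterion: "crit_data x0 i y k p \<Longrightarrow> criterion i y k"
  unfolding crit_data_def by (rule criterion_classical[where ?x0.0 = x0 and p = p]) blast+

text \<open>Reversing the first i entries sends node j < i to i - j and fixes the later ones, except
  that a sign change of the last coordinate in type D exchanges the nodes n - 1 and n.\<close>

lemma crit_data_final:
  assumes i: "i \<in> I" and c: "1 \<le> c" and D: "X = TypeD \<Longrightarrow> i + 2 \<le> n"
    and y: "legal X n (base n) y" and run: "\<And>x. run X n x y = final X n c i x"
  shows "criterion i y i"
proof -
  \<comment> \<open>In the middle case \<open>2 * n - 1 - j\<close> exchanges n - 1 and n.\<close>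
  define p where "p j = (if j < i then i - j else if X = TypeD \<and> c = 2 \<and> n \<le> j + 1 then 2 * n - 1 - j else j)" for j
  have i1: "1 \<le> i" "i \<le> n" using i by auto
  have pI: "p j \<in> I - {i}" "p (p j) = j" if "j \<in> I - {i}" for j
    using that i1 D by (auto simp: p_def)
  have "bij_betw p (I - {i}) (I - {i})"
    by (rule bij_betw_byWitness[where f' = p]) (use pI in blast)+
  moreover have "val X n j (run X n x y) = val X n (p j) x" if j: "j \<in> I - {i}" for j x
  proof -
    have j': "1 \<le> j" "j \<le> n" "j \<noteq> i" using j by auto
    show ?thesis
    proof (cases "j < i")
      case True
      then have "i + 1 - (j + 1) = i - j" "i + 1 - j = i - j + 1" "i - j < n" "1 \<le> i - j" "j < n" using i1 j' by auto
      then show ?thesis using True j' i1 unfolding run by (simp add: final_def p_def val_swap)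
    next
      case False
      then have ij: "i < j" using j' by simp
      show ?thesis
      proof (cases "X = TypeD")
        case True
        then have n: "i < n - 1" using D by auto
        consider "j < n - 1" | "j = n - 1" | "j = n" using j' by linarith
        then show ?thesis
        proof cases
          case 1
          then have "j + 1 \<noteq> n" "j \<noteq> n" "j < n" "\<not> n \<le> j + 1" by auto
          then show ?thesis using ij j' True unfolding run by (simp add: final_def p_def val_swap)
        next
          case 2
          then have "j + 1 = n" "2 * n - 1 - j = n" "j \<noteq> n" "j < n" "1 \<le> j" using ij by auto
          then show ?thesis using ij j' True 2 unfolding run by (auto simp: final_def p_def val_def)
        next
          case 3
          then have "2 * n - 1 - j = n - 1" "n - 1 + 1 = n" "n - 1 \<noteq> 0" "n - 1 \<noteq> n" "n \<noteq> 0" "n - 1 < n" using n by auto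
          then show ?thesis using ij j' n True 3 unfolding run by (auto simp: final_def p_def val_def)
        qed
      next
        case False
        then show ?thesis using ij j' unfolding run by (auto simp: final_def p_def val_def)
      qed
    qed
  qed
  moreover have "val X n i (run X n (om i) y) < 0"
    using D i1 type unfolding run by (auto simp: final_def val_def om_eq classical_om_def)
  moreover have "0 < val X n i (run X n (eps 0) y)"
    using D i1 c type unfolding run by (auto simp: final_def val_def eps_apply)
  ultimately have "crit_data (base n) i y i p"
    using i y val_base[OF n2] by (auto simp: crit_data_def)
  then show ?thesis by (rule crit_data_criterion)
qed

text \<open>The block added for l + 1 brings entry l + 1 to the front and replaces it by its
  difference from \<open>x 0\<close>, so the reversal builds up one entry at a time.\<close>

lemma criterion_C:
  assumes X: "X = TypeC" and i: "i \<in> I"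
  shows "criterion i (y_C i) i"
proof -
  have y_Suc: "y_C (Suc l) = y_C l @ down l 1 @ [0]" for l
  proof -
    have "[0..<l + 1] = 0 # [1..<l + 1]" using upt_conv_Cons[of 0 "l + 1"] by (simp del: upt_Suc)
    then have "down l 0 = down l 1 @ [0]" by (simp add: down_def del: upt_Suc)
    then show ?thesis by (simp add: y_C_def)
  qed
  have run: "run X n x (y_C l) = final X n 1 l x" if "l \<le> n" for l x
    using that
  proof (induction l)
    case 0
    then show ?case by (auto simp: y_C_def final_def fun_eq_iff)
  next
    case (Suc l)
    have "run X n x (y_C (Suc l)) = act X n 0 (run X n (final X n 1 l x) (down l 1))"
      using Suc by (simp add: y_Suc run_append)
    also have "\<dots> = final X n 1 (Suc l) x"
    proof
      fix k
      consider "k = 0" | "k = 1" | "2 \<le> k" "k \<le> l + 1" | "l + 1 < k" by linarith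
      then show "act X n 0 (run X n (final X n 1 l x) (down l 1)) k = final X n 1 (Suc l) x k"
      proof cases
        case 3
        then have "1 \<le> k - 1" "k - 1 \<le> l" "l + 1 - (k - 1) = Suc l + 1 - k" by auto
        then show ?thesis using 3 Suc.prems X by (simp add: act_def run_down final_def)
      qed (use Suc.prems X in \<open>auto simp: act_def run_down final_def\<close>)
    qed
    finally show ?case .
  qed
  have "legal X n (base n) (y_C l)" if "l \<le> n" for l
    using that
  proof (induction l)
    case 0
    then show ?case by (simp add: y_C_def)
  next
    case (Suc l)
    have l: "1 \<le> l + 1" "l < n" using Suc.prems by auto
    have "legal X n (final X n 1 l (base n)) (down l 1)"
      using l by (intro legal_down) (auto simp: final_def base_def of_nat_diff)
    moreover have "0 < val X n 0 (run X n (final X n 1 l (base n)) (down l 1))"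
      using l X by (simp add: run_down val_def final_def base_def)
    ultimately show ?case using Suc by (simp add: y_Suc legal_append run_append run)
  qed
  then show ?thesis using i X run by (intro crit_data_final[of i 1]) auto
qed

text \<open>The first 0 puts \<open>x 0 - x 1\<close> at place 2, the cycle negates it, and the last
  0 returns it to place 1 as \<open>2 * x 0 - x 1\<close>, restoring \<open>x 2\<close>.\<close>

lemma criterion_one:
  assumes X: "X \<noteq> TypeC" and D: "X = TypeD \<Longrightarrow> 3 \<le> n"
  shows "criterion 1 ([0] @ cycle X n 2 2 @ [0]) 1"
proof -
  have i: "1 \<le> (2::nat)" "2 \<le> (2::nat)" "2 \<le> (if X = TypeD then n - 1 else n)" using D n2 by auto
  have run: "run X n x ([0] @ cycle X n 2 2 @ [0]) = final X n 2 1 x" for x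
  proof
    fix k :: nat
    have n: "n \<noteq> 0" "n \<noteq> 1" "X = TypeD \<Longrightarrow> n \<noteq> 2" using n2 D by auto
    consider "k = 0" | "k = 1" | "k = 2" | "3 \<le> k" by linarith
    then show "run X n x ([0] @ cycle X n 2 2 @ [0]) k = final X n 2 1 x k"
      using X n by cases (auto simp: run_append run_cycle[OF i n2] act_def final_def)
  qed
  have "legal X n (act X n 0 (base n)) (cycle X n 2 2)"
    using X by (intro legal_cycle[OF i n2]) (auto simp: act_def base_def)
  moreover have "0 < val X n 0 (run X n (act X n 0 (base n)) (cycle X n 2 2))"
    using X n2 by (simp add: run_cycle[OF i n2] val_def act_def base_def)
  ultimately have "legal X n (base n) ([0] @ cycle X n 2 2 @ [0])"
    using val_base[OF n2, of 0 X] by (simp add: legal_append)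
  then show ?thesis using run n2 D by (intro crit_data_final[of 1 2]) auto
qed

lemma criterion_even:
  assumes X: "X \<noteq> TypeC" and i: "even i" "2 \<le> i" "i \<le> n" and D: "X = TypeD \<Longrightarrow> i + 2 \<le> n"
  shows "criterion i ([0] @ Bs0_prod ((i - 2) div 2)) i"
proof -
  define M where "M = (i - 2) div 2"
  have M: "i = 2 * M + 2" using i by (auto simp: M_def elim!: evenE)
  have Mn: "2 * M + 2 \<le> n" using M i by simp
  have "run X n x ([0] @ Bs0_prod M) = final X n 1 i x" for x
    unfolding run_reversal[OF X Mn] final_def M by (auto simp: fun_eq_iff numeral_3_eq_3)
  moreover have "legal X n (base n) ([0] @ Bs0_prod M)"
    using Mn by (intro legal_reversal[OF X Mn]) (auto simp: base_def)
  ultimately show ?thesis using i D unfolding M_def[symmetric]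
    by (intro crit_data_final[of i 1]) auto
qed

text \<open>The reversal treats an even number of entries, so one of the i entries must be dealt
  with beforehand. The powers of \<open>Z\<close> and the block \<open>?t\<close> produce
  \<open>x 2 - x 0\<close>, ..., \<open>x i - x 0\<close>, \<open>2 * x 0 - x 1\<close>, and the
  reversal of the first i - 1 of these gives \<open>final\<close> with c = 2.\<close>

lemma criterion_odd:
  assumes X: "X \<noteq> TypeC" and i: "odd i" "3 \<le> i" "i \<le> n" and D: "X = TypeD \<Longrightarrow> i + 2 \<le> n"
    and Z: "\<And>x. run X n x Z = shift i x" "\<And>x. shiftable n i x \<Longrightarrow> legal X n x Z"
  shows "criterion i (wpow Z ((i - 1) div 2) @ [0] @ cycle X n 2 i @ up 1 (i - 1) @ [0] @ Bs0_prod ((i - 3) div 2)) i"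
proof -
  define m where "m = (i - 3) div 2"
  have im: "i = 2 * m + 3" using i by (auto simp: m_def elim!: oddE)
  have m1: "(i - 1) div 2 = m + 1" using im by simp
  have M: "2 * m + 2 \<le> n" using im i by simp
  have ci: "1 \<le> (2::nat)" "2 \<le> i" "i \<le> (if X = TypeD then n - 1 else n)" using i D by auto
  have ui: "1 \<le> (1::nat)" "1 \<le> i - 1 + 1" "i - 1 < n" using i by auto
  let ?t = "[0] @ cycle X n 2 i @ up 1 (i - 1)"
  have t: "run X n z ?t = (\<lambda>k. if 1 \<le> k \<and> k + 2 \<le> i then z (k + 2) else if k = i - 1 then z 1 - z 0
      else if k = i then z 0 - z 2 else if k = n \<and> X = TypeD then - z n else z k)" for z
  proof
    fix k
    define b where "b = z(1 := z 0 - z 2, 2 := z 0 - z 1)"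
    have a: "act X n 0 z = b" using X by (simp add: act_def b_def)
    define C where "C = (\<lambda>k. if 2 \<le> k \<and> k < i then b (k + 1) else if k = i then - b 2
      else if k = n \<and> X = TypeD then - b n else b k)"
    have t: "run X n z ?t = (\<lambda>k. if 1 \<le> k \<and> k \<le> i - 1 then C (k + 1) else if k = i - 1 + 1 then C 1 else C k)"
      by (simp only: run_append run_up[OF ui] run_cycle[OF ci n2] run.simps a C_def)
    have n1: "n \<noteq> 1" "n \<noteq> 2" "n \<noteq> 0" "i \<noteq> 0" "i \<noteq> 1" "i \<noteq> 2" using i by auto
    consider "k = 0" | "1 \<le> k" "k + 2 \<le> i" | "k = i - 1" | "k = i" | "i < k" using i by linarith
    then show "run X n z ?t k = (if 1 \<le> k \<and> k + 2 \<le> i then z (k + 2) else if k = i - 1 then z 1 - z 0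
      else if k = i then z 0 - z 2 else if k = n \<and> X = TypeD then - z n else z k)"
    proof cases
      case 1
      then have "k \<noteq> i - 1" "k \<noteq> i - 1 + 1" using i by auto
      then show ?thesis using 1 n1 unfolding t by (auto simp: C_def b_def)
    next
      case 2
      then have "2 \<le> k + 1" "k + 1 < i" "k \<le> i - 1" by auto
      then have "C (k + 1) = z (k + 2)" by (simp add: C_def b_def)
      then show ?thesis using 2 unfolding t by auto
    next
      case 3
      then have k: "1 \<le> k" "k \<le> i - 1" "k + 1 = i" "\<not> k + 2 \<le> i" using i by auto
      have "C i = z 1 - z 0" by (simp add: C_def b_def)
      then show ?thesis using k 3 unfolding t by simp
    next
      case 4
      then have k: "\<not> k \<le> i - 1" "k = i - 1 + 1" "\<not> k + 2 \<le> i" "k \<noteq> i - 1" using i by auto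
      have "C 1 = z 0 - z 2" using n1 by (simp add: C_def b_def)
      then show ?thesis using k 4 unfolding t by simp
    next
      case 5
      then have k: "\<not> k \<le> i - 1" "k \<noteq> i - 1 + 1" "\<not> k + 2 \<le> i" "k \<noteq> i - 1" "k \<noteq> i" "k \<noteq> 1" "k \<noteq> 2" "\<not> k < i"
        using i by auto
      have "C k = (if k = n \<and> X = TypeD then - z n else z k)" using k n1 by (simp add: C_def b_def)
      then show ?thesis using k unfolding t by simp
    qed
  qed
  let ?y = "wpow Z ((i - 1) div 2) @ ?t @ [0] @ Bs0_prod m"
  have l1: "2 * (m + 1) + 1 \<le> i" using im by simp
  note pow = run_wpow_shift[OF Z(1) l1 i(2)]
  \<comment> \<open>Rotating i entries left by 2 (m + 1) = i - 1 places is rotating them right by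
    one.\<close>
  have pow': "run X n x (wpow Z (m + 1)) = (\<lambda>k. if k = 1 then x i else if 2 \<le> k \<and> k \<le> i then x (k - 1) - x 0 else x k)" for x
  proof
    fix k
    consider "k = 0" | "k = 1" | "2 \<le> k" "k \<le> i" | "i < k" by linarith
    then show "run X n x (wpow Z (m + 1)) k = (if k = 1 then x i else if 2 \<le> k \<and> k \<le> i then x (k - 1) - x 0 else x k)"
    proof cases
      case 3
      then have "\<not> k + 2 * (m + 1) \<le> i" "k + 2 * (m + 1) - i = k - 1" "1 \<le> k" using im by auto
      then show ?thesis using 3 unfolding pow by simp
    next
      case 2
      then have "1 \<le> k" "k \<le> i" "k + 2 * (m + 1) = i" using im by auto
      then show ?thesis using 2 unfolding pow by simp
    qed (unfold pow, use im in auto)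
  qed
  have run: "run X n x ?y = final X n 2 i x" for x
  proof
    fix k
    define z where "z = run X n x (wpow Z (m + 1))"
    define w where "w = run X n z ?t"
    have "run X n x ?y = run X n w ([0] @ Bs0_prod m)"
      by (simp only: run_append m1 z_def w_def)
    then have y: "run X n x ?y k = (if 1 \<le> k \<and> k \<le> 2 * m + 2 then w 0 - w (2 * m + 3 - k) else w k)"
      using run_reversal[OF X M, of w] by simp
    have z: "z 0 = x 0" "z 1 = x i" "z 2 = x 1 - x 0" "\<And>l. i < l \<Longrightarrow> z l = x l"
      "\<And>l. 2 \<le> l \<Longrightarrow> l \<le> i \<Longrightarrow> z l = x (l - 1) - x 0"
      using i unfolding z_def pow' by auto
    have w: "w l = (if 1 \<le> l \<and> l + 2 \<le> i then z (l + 2) else if l = i - 1 then z 1 - z 0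
      else if l = i then z 0 - z 2 else if l = n \<and> X = TypeD then - z n else z l)" for l
      by (simp only: w_def t)
    have w0: "w 0 = x 0" using i n2 z by (simp add: w)
    consider "k = 0" | "k = 1" | "2 \<le> k" "k \<le> 2 * m + 2" | "k = i" | "i < k" using im by linarith
    then show "run X n x ?y k = final X n 2 i x k"
    proof cases
      case 1
      then show ?thesis using i n2 w0 unfolding y final_def by auto
    next
      case 2
      then have "2 * m + 3 - k = i - 1" using im by simp
      moreover have "w (i - 1) = x i - x 0" using i z by (simp add: w)
      ultimately show ?thesis using 2 w0 i unfolding y final_def by simp
    next
      case 3
      define l where "l = 2 * m + 3 - k"
      have l: "1 \<le> l" "l + 2 \<le> i" "l + 2 - 1 = i + 1 - k" "k \<le> i" "1 \<le> k" using 3 im by (auto simp: l_def)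
      then have "w l = x (i + 1 - k) - x 0" using z(5)[of "l + 2"] by (simp add: w)
      then show ?thesis using 3 w0 l unfolding y final_def by (simp add: l_def[symmetric])
    next
      case 4
      then have "\<not> k \<le> 2 * m + 2" "\<not> k + 2 \<le> i" "k \<noteq> i - 1" "i + 1 - k = 1" using im by auto
      then show ?thesis using 4 i z unfolding y final_def w by simp
    next
      case 5
      then have "\<not> k \<le> 2 * m + 2" "\<not> k + 2 \<le> i" "k \<noteq> i - 1" using im by auto
      then show ?thesis using 5 i z unfolding y final_def w by auto
    qed
  qed
  define z where "z = run X n (base n) (wpow Z (m + 1))"
  have legz: "legal X n (base n) (wpow Z (m + 1))" "shiftable n i z"
    using legal_wpow_shift[OF Z shiftable_base i(2), of "m + 1"] i by (auto simp: z_def)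
  have dec: "z b < z a" if "1 \<le> a" "a < b" "b \<le> i" for a b using legz(2) that by (simp add: shiftable_def)
  have h: "z 1 + z 2 < z 0" "z 1 < z 0" "z 1 - z i < z 0" "\<And>k. i < k \<Longrightarrow> k \<le> n \<Longrightarrow> \<bar>z k\<bar> < z 0 - z 1"
    using legz(2) by (auto simp: shiftable_def)
  have 21: "z 2 < z 1" and 31: "z 3 < z 1" and 32: "z 3 < z 2" using dec[of 1 2] dec[of 1 3] dec[of 2 3] i by auto
  have z0: "0 < z 0" using h(3) dec[of 1 i] i by simp
  have lt3: "z k < z 0 - z 1" if "3 \<le> k" "k \<le> n" for k
  proof (cases "k \<le> i")
    case True
    then have "z k < z 2" using dec[of 2 k] that by simp
    then show ?thesis using h(1) by simp
  next
    case False
    then show ?thesis using h(4)[of k] that by simp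
  qed
  have a: "act X n 0 z = z(1 := z 0 - z 2, 2 := z 0 - z 1)" using X by (simp add: act_def)
  have v0: "0 < val X n 0 z" using X h(1) by (simp add: val_def)
  have lc: "legal X n (act X n 0 z) (cycle X n 2 i)"
  proof (rule legal_cycle[OF ci n2])
    show "act X n 0 z k < act X n 0 z 2" if "2 < k" "k \<le> n" for k using lt3[of k] that by (simp add: a)
    show "0 < act X n 0 z 2" using h(2) by (simp add: a)
    show "- act X n 0 z 2 < act X n 0 z k" if "i < k" "k \<le> n" for k using h(4)[OF that] that i by (simp add: a)
  qed
  have lu: "legal X n (run X n (act X n 0 z) (cycle X n 2 i)) (up 1 (i - 1))"
  proof (rule legal_up[OF ui])
    fix k assume k: "1 < k" "k \<le> i - 1 + 1"
    have D': "X = TypeD \<Longrightarrow> i < n" using D by fastforce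
    have 1: "run X n (act X n 0 z) (cycle X n 2 i) 1 = z 0 - z 2"
      using i n2 by (simp add: run_cycle[OF ci n2] a)
    show "run X n (act X n 0 z) (cycle X n 2 i) k < run X n (act X n 0 z) (cycle X n 2 i) 1"
    proof (cases "k = i")
      case True
      then have "run X n (act X n 0 z) (cycle X n 2 i) k = z 1 - z 0" using i by (simp add: run_cycle[OF ci n2] a)
      then show ?thesis using 1 h(2) 21 by simp
    next
      case False
      then have k': "2 \<le> k" "k < i" using k i by auto
      then have "run X n (act X n 0 z) (cycle X n 2 i) k = z (k + 1)" by (simp add: run_cycle[OF ci n2] a)
      then show ?thesis using 1 lt3[of "k + 1"] 21 k' i by simp
    qed
  qed
  have lr: "legal X n (run X n z ?t) ([0] @ Bs0_prod m)"
  proof (rule legal_reversal[OF X M])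
    fix c b assume cb: "1 \<le> c" "c < b" "b \<le> 2 * m + 2"
    then have c: "1 \<le> c \<and> c + 2 \<le> i" using im by auto
    show "run X n z ?t b < run X n z ?t c"
    proof (cases "b + 2 \<le> i")
      case True
      then show ?thesis using dec[of "c + 2" "b + 2"] c cb unfolding t by simp
    next
      case False
      then have b: "b = i - 1" "\<not> b + 2 \<le> i" using cb im by auto
      have "z i \<le> z (c + 2)" using dec[of "c + 2" i] c by (cases "c + 2 = i") auto
      then show ?thesis using b c h(3) unfolding t by simp
    qed
  next
    have t0: "run X n z ?t 0 = z 0" and t1: "run X n z ?t 1 = z 3" using i n2 unfolding t by (auto simp: numeral_3_eq_3)
    have t2: "run X n z ?t 2 = (if i = 3 then z 1 - z 0 else z 4)" using i(2) im unfolding t by auto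
    have "i \<noteq> 3 \<Longrightarrow> z 4 < z 2" using dec[of 2 4] i by simp
    then show "run X n z ?t 1 + run X n z ?t 2 < run X n z ?t 0"
      unfolding t0 t1 t2 using 31 32 h z0 by auto
  qed
  have "legal X n z (?t @ [0] @ Bs0_prod m)"
    using v0 lc lu lr by (simp add: legal_append run_append)
  then have "legal X n (base n) (wpow Z (m + 1) @ ?t @ [0] @ Bs0_prod m)"
    using legz(1) unfolding legal_append[of X n "base n" "wpow Z (m + 1)"] z_def by blast
  then have "legal X n (base n) ?y" by (simp only: m1)
  then have "criterion i ?y i" using run i D by (intro crit_data_final[of i 2]) auto
  then show ?thesis by (simp add: m_def)
qed

lemma shiftable_bounds:
  assumes s: "shiftable n i x" and i: "3 \<le> i"
  shows "x 1 + x 2 < x 0" "x 1 < x 0" "x 2 < x 1" "x 1 - x i < x 0" "0 < x 0"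
    "\<And>k. 3 \<le> k \<Longrightarrow> k \<le> n \<Longrightarrow> x k < x 0 - x 1"
    "\<And>k. i < k \<Longrightarrow> k \<le> n \<Longrightarrow> - (x 0 - x 1) < x k"
proof -
  have dec: "x b < x a" if "1 \<le> a" "a < b" "b \<le> i" for a b using s that by (simp add: shiftable_def)
  show h: "x 1 + x 2 < x 0" "x 1 < x 0" "x 1 - x i < x 0" using s by (auto simp: shiftable_def)
  have a: "\<bar>x k\<bar> < x 0 - x 1" if "i < k" "k \<le> n" for k using s that by (auto simp: shiftable_def)
  show "x 2 < x 1" "0 < x 0" using dec[of 1 2] dec[of 1 i] i h by auto
  show "x k < x 0 - x 1" if "3 \<le> k" "k \<le> n" for k
    using that dec[of 2 k] h(1) a[of k] by (cases "k \<le> i") auto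
  show "- (x 0 - x 1) < x k" if "i < k" "k \<le> n" for k using a[OF that] by simp
qed

text \<open>After the letter 0 the two cycles carry \<open>x 0 - x 1\<close> and then
  \<open>x 0 - x 2\<close> to place i with changed sign, the second pushing the first to place i -
  1.\<close>

lemma shift_B:
  assumes X: "X = TypeB" and i: "3 \<le> i" "i \<le> n"
  defines "Z \<equiv> [0] @ cycle X n 2 i @ cycle X n 1 i"
  shows "run X n x Z = shift i x" "shiftable n i x \<Longrightarrow> legal X n x Z"
proof -
  have c2: "1 \<le> (2::nat)" "2 \<le> i" "i \<le> (if X = TypeD then n - 1 else n)"
    and c1: "1 \<le> (1::nat)" "1 \<le> i" "i \<le> (if X = TypeD then n - 1 else n)" using i X by auto
  define b where "b = x(1 := x 0 - x 2, 2 := x 0 - x 1)"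
  have a: "act X n 0 x = b" using X by (simp add: act_def b_def)
  define C where "C = (\<lambda>k. if 2 \<le> k \<and> k < i then b (k + 1) else if k = i then - b 2
    else if k = n \<and> X = TypeD then - b n else b k)"
  have run2: "run X n b (cycle X n 2 i) = C" unfolding C_def by (rule run_cycle[OF c2 n2])
  have C: "C 1 = x 0 - x 2" "C i = x 1 - x 0" "\<And>k. 2 \<le> k \<Longrightarrow> k < i \<Longrightarrow> C k = x (k + 1)"
    "\<And>k. i < k \<Longrightarrow> C k = x k" "C 0 = x 0"
    using i X by (auto simp: C_def b_def)
  have "run X n x Z = (\<lambda>k. if 1 \<le> k \<and> k < i then C (k + 1) else if k = i then - C 1
    else if k = n \<and> X = TypeD then - C n else C k)"
    unfolding Z_def run_append run.simps a run2 by (rule run_cycle[OF c1 n2])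
  also have "\<dots> = shift i x"
  proof
    fix k
    consider "k = 0" | "1 \<le> k" "k + 2 \<le> i" | "k + 1 = i" | "k = i" | "i < k" by linarith
    then show "(if 1 \<le> k \<and> k < i then C (k + 1) else if k = i then - C 1
      else if k = n \<and> X = TypeD then - C n else C k) = shift i x k"
    proof cases
      case 1
      then show ?thesis using i X C by (auto simp: shift_def)
    next
      case 2
      then show ?thesis using C(3)[of "k + 1"] by (simp add: shift_def)
    next
      case 3
      then have "1 \<le> k" "k < i" "\<not> k + 2 \<le> i" "k = i - 1" using i by auto
      then show ?thesis using 3 C(2) by (simp add: shift_def)
    next
      case 4
      then have "\<not> k + 2 \<le> i" "k \<noteq> i - 1" using i by auto
      then show ?thesis using 4 C(1) by (simp add: shift_def)
    next
      case 5
      then have "\<not> k + 2 \<le> i" "k \<noteq> i - 1" by auto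
      then show ?thesis using 5 C(4)[OF 5] X by (simp add: shift_def)
    qed
  qed
  finally show "run X n x Z = shift i x" .
  assume s: "shiftable n i x"
  note h = shiftable_bounds[OF s i(1)]
  have "0 < val X n 0 x" using X h(1) by (simp add: val_def)
  moreover have "legal X n b (cycle X n 2 i)"
  proof (rule legal_cycle[OF c2 n2])
    show "b k < b 2" if "2 < k" "k \<le> n" for k using h(6)[of k] that by (simp add: b_def)
    show "0 < b 2" using h(2) by (simp add: b_def)
    show "- b 2 < b k" if "i < k" "k \<le> n" for k using h(7)[OF that] that i by (simp add: b_def)
  qed
  moreover have "legal X n C (cycle X n 1 i)"
  proof (rule legal_cycle[OF c1 n2])
    show "C k < C 1" if k: "1 < k" "k \<le> n" for k
    proof -
      consider "k < i" | "k = i" | "i < k" by linarith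
      then show ?thesis
      proof cases
        case 1
        then show ?thesis using C k h(6)[of "k + 1"] h(3) i by simp
      next
        case 2
        then show ?thesis using C h(1,5) by simp
      next
        case 3
        then show ?thesis using C k h(6)[of k] h(3) i by simp
      qed
    qed
    show "0 < C 1" using C h(2,3) by simp
    show "- C 1 < C k" if "i < k" "k \<le> n" for k using C h(7)[OF that] h(3) that by simp
  qed
  ultimately show "legal X n x Z" by (simp add: Z_def legal_append run_append a run2)
qed

text \<open>As in type B, but both cycles run to place n - 1 so that their sign changes of the last
  coordinate cancel; the new pair is then carried left to the places i - 1 and i.\<close>

lemma shift_D:
  assumes X: "X = TypeD" and i: "3 \<le> i" "i + 2 \<le> n"
  defines "Z \<equiv> [0] @ cycle X n 2 (n - 1) @ cycle X n 1 (n - 1) @ pairs_down (n - 3) (i - 1)"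
  shows "run X n x Z = shift i x" "shiftable n i x \<Longrightarrow> legal X n x Z"
proof -
  obtain m where m: "n = m + 3" using i by (metis add.commute le_Suc_ex add_leD1 le_trans)
  have n: "n - 1 = m + 2" "n - 3 = m" "i \<le> m + 1" using m i by auto
  have c2: "1 \<le> (2::nat)" "2 \<le> m + 2" "m + 2 \<le> (if X = TypeD then n - 1 else n)"
    and c1: "1 \<le> (1::nat)" "1 \<le> m + 2" "m + 2 \<le> (if X = TypeD then n - 1 else n)" using i X m by auto
  have pd: "1 \<le> i - 1" "i - 1 \<le> m + 1" "m + 1 < n" using i n m by auto
  define b where "b = x(1 := x 0 - x 2, 2 := x 0 - x 1)"
  have a: "act X n 0 x = b" using X by (simp add: act_def b_def)
  define C where "C = (\<lambda>k. if 2 \<le> k \<and> k < m + 2 then b (k + 1) else if k = m + 2 then - b 2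
    else if k = n \<and> X = TypeD then - b n else b k)"
  have run2: "run X n b (cycle X n 2 (m + 2)) = C" unfolding C_def by (rule run_cycle[OF c2 n2])
  have C: "C 0 = x 0" "C 1 = x 0 - x 2" "\<And>k. 2 \<le> k \<Longrightarrow> k \<le> m + 1 \<Longrightarrow> C k = x (k + 1)"
    "C (m + 2) = x 1 - x 0" "C (m + 3) = - x (m + 3)" "\<And>k. m + 3 < k \<Longrightarrow> C k = x k"
    using i X n m by (auto simp: C_def b_def)
  define E where "E = (\<lambda>k. if 1 \<le> k \<and> k < m + 2 then C (k + 1) else if k = m + 2 then - C 1
    else if k = n \<and> X = TypeD then - C n else C k)"
  have run1: "run X n C (cycle X n 1 (m + 2)) = E" unfolding E_def by (rule run_cycle[OF c1 n2])
  have E: "E 0 = x 0" "\<And>k. 1 \<le> k \<Longrightarrow> k \<le> m \<Longrightarrow> E k = x (k + 2)" "E (m + 1) = x 1 - x 0"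
    "E (m + 2) = x 2 - x 0" "\<And>k. m + 3 \<le> k \<Longrightarrow> E k = x k"
  proof -
    show "E 0 = x 0" using C(1) X m by (simp add: E_def)
    show "E k = x (k + 2)" if "1 \<le> k" "k \<le> m" for k using C(3)[of "k + 1"] that by (simp add: E_def)
    show "E (m + 1) = x 1 - x 0" using C(4) by (simp add: E_def)
    show "E (m + 2) = x 2 - x 0" using C(2) by (simp add: E_def)
    show "E k = x k" if "m + 3 \<le> k" for k using C(5) C(6)[of k] that X m by (auto simp: E_def)
  qed
  have runZ: "run X n x Z = run X n E (pairs_down m (i - 1))"
    unfolding Z_def n run_append run.simps a run2 run1 by (rule refl)
  show "run X n x Z = shift i x"
    unfolding runZ run_pairs_down[OF pd]
  proof
    fix k
    consider "k = 0" | "1 \<le> k" "k + 2 \<le> i" | "k + 1 = i" | "k = i" | "i < k" "k \<le> m + 2" | "m + 3 \<le> k"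
      by linarith
    then show "(if k = i - 1 then E (m + 1) else if k = i - 1 + 1 then E (m + 2)
      else if i - 1 + 2 \<le> k \<and> k \<le> m + 2 then E (k - 2) else E k) = shift i x k"
    proof cases
      case 1
      then have "k \<noteq> i - 1" "k \<noteq> i - 1 + 1" "\<not> i - 1 + 2 \<le> k" "k \<noteq> i" using i by auto
      then show ?thesis using 1 E(1) by (simp add: shift_def)
    next
      case 2
      then have "k \<noteq> i - 1" "k \<noteq> i - 1 + 1" "\<not> i - 1 + 2 \<le> k" "k \<le> m" using n by auto
      then show ?thesis using 2 E(2)[of k] by (simp add: shift_def)
    next
      case 3
      then have "k = i - 1" "\<not> k + 2 \<le> i" using i by auto
      then show ?thesis using E(3) by (simp add: shift_def)
    next
      case 4
      then have "k \<noteq> i - 1" "k = i - 1 + 1" "\<not> k + 2 \<le> i" using i by auto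
      then show ?thesis using 4 E(4) by (simp add: shift_def)
    next
      case 5
      then have k: "k \<noteq> i - 1" "k \<noteq> i - 1 + 1" "\<not> k + 2 \<le> i" "i - 1 + 2 \<le> k" "k \<noteq> i"
        "1 \<le> k - 2" "k - 2 \<le> m" "k - 2 + 2 = k" using i by auto
      have "E (k - 2) = x k" using E(2)[OF k(6,7)] k(8) by simp
      then show ?thesis using k 5 by (simp add: shift_def)
    next
      case 6
      then have k: "k \<noteq> i - 1" "k \<noteq> i - 1 + 1" "\<not> k + 2 \<le> i" "\<not> k \<le> m + 2" "k \<noteq> i" using n by auto
      then show ?thesis using E(5)[OF 6] by (simp add: shift_def)
    qed
  qed
  assume s: "shiftable n i x"
  note h = shiftable_bounds[OF s i(1)]
  have "0 < val X n 0 x" using X h(1) by (simp add: val_def)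
  moreover have "legal X n b (cycle X n 2 (m + 2))"
  proof (rule legal_cycle[OF c2 n2])
    show "b k < b 2" if "2 < k" "k \<le> n" for k using h(6)[of k] that by (simp add: b_def)
    show "0 < b 2" using h(2) by (simp add: b_def)
    show "- b 2 < b k" if "m + 2 < k" "k \<le> n" for k using h(7)[of k] that n by (simp add: b_def)
  qed
  moreover have "legal X n C (cycle X n 1 (m + 2))"
  proof (rule legal_cycle[OF c1 n2])
    show "C k < C 1" if k: "1 < k" "k \<le> n" for k
    proof -
      consider "k \<le> m + 1" | "k = m + 2" | "k = m + 3" using k m by linarith
      then show ?thesis
      proof cases
        case 1
        then show ?thesis using C k h(6)[of "k + 1"] h(3) m by simp
      next
        case 2
        then show ?thesis using C h(1,5) by simp
      next
        case 3
        have "- x (m + 3) < x 0 - x 1" using h(7)[of "m + 3"] n m by simp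
        then show ?thesis using C(2,5) h(3) unfolding 3 by simp
      qed
    qed
    show "0 < C 1" using C h(2,3) by simp
    show "- C 1 < C k" if "m + 2 < k" "k \<le> n" for k
    proof -
      have "k = m + 3" using that m by simp
      moreover have "x (m + 3) < x 0 - x 1" using h(6)[of "m + 3"] m by simp
      ultimately show ?thesis using C(2,5) h(3) by simp
    qed
  qed
  moreover have "legal X n E (pairs_down m (i - 1))"
  proof (rule legal_pairs_down[OF pd])
    fix k assume k: "i - 1 \<le> k" "k \<le> m"
    then have "E k = x (k + 2)" using E(2)[of k] i by simp
    moreover have "- (x 0 - x 1) < x (k + 2)" using h(7)[of "k + 2"] k m i by simp
    ultimately show "E (m + 1) < E k \<and> E (m + 2) < E k" using E(3,4) h(3) by simp
  qed
  ultimately show "legal X n x Z" 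
    unfolding Z_def n legal_append run_append legal.simps run.simps a run2 run1 by simp
qed

end

section \<open>The diagram automorphism of type D and the last two nodes\<close>

definition swap_last :: "nat \<Rightarrow> nat \<Rightarrow> nat" where
  "swap_last n j = (if j = n - 1 then n else if j = n then n - 1 else j)"

definition negate_last :: "nat \<Rightarrow> vec \<Rightarrow> vec" where
  "negate_last n x = x(n := - x n)"

lemma negate_last_twice [simp]: "negate_last n (negate_last n x) = x"
  by (simp add: negate_last_def)

lemma map_swap_last_id: "(\<And>j. j \<in> set w \<Longrightarrow> j + 2 \<le> n) \<Longrightarrow> map (swap_last n) w = w"
  by (rule map_idI) (force simp: swap_last_def)

lemma map_wpow: "map f (wpow w l) = wpow (map f w) l"
  by (induction l) (simp_all add: wpow_0 wpow_Suc)

lemma set_B_word: "j \<in> set (B_word M) \<Longrightarrow> j \<le> 2 * M + 1"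
  by (induction M) (auto simp: B_word_Suc B_word_def[of 0])

lemma set_Bs0_prod: "j \<in> set (Bs0_prod M) \<Longrightarrow> j \<le> 2 * M + 1"
proof (induction M)
  case (Suc M)
  then show ?case using set_B_word[of j "Suc M"] by (auto simp: Bs0_prod_Suc)
qed (simp add: Bs0_prod_def)

lemma set_up: "set (up a b) = {a..b}"
  by (auto simp: up_def)

text \<open>Changing the sign of the last coordinate exchanges \<epsilon>_(n-1) - \<epsilon>_n with
  \<epsilon>_(n-1) + \<epsilon>_n and fixes the other affine simple roots.\<close>

lemma swap_last_act:
  assumes n: "4 \<le> n" and j: "j \<le> n"
  shows "act TypeD n (swap_last n j) (negate_last n x) = negate_last n (act TypeD n j x)"
    "val TypeD n (swap_last n j) (negate_last n x) = val TypeD n j x"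
proof -
  obtain l where l: "n = Suc l" "3 \<le> l" using n by (cases n) auto
  consider "j = 0" | "1 \<le> j" "j < l" | "j = l" | "j = Suc l" using j l by linarith
  then have "act TypeD n (swap_last n j) (negate_last n x) = negate_last n (act TypeD n j x) \<and>
    val TypeD n (swap_last n j) (negate_last n x) = val TypeD n j x"
  proof cases
    case 1
    then show ?thesis using l by (auto simp: swap_last_def negate_last_def act_def val_def fun_eq_iff)
  next
    case 2
    then show ?thesis using l by (auto simp: swap_last_def negate_last_def act_def val_def fun_eq_iff)
  next
    case 3
    then show ?thesis using l by (auto simp: swap_last_def negate_last_def act_def val_def fun_eq_iff)
  next
    case 4
    then show ?thesis using l by (auto simp: swap_last_def negate_last_def act_def val_def fun_eq_iff)
  qed
  then show "act TypeD n (swap_last n j) (negate_last n x) = negate_last n (act TypeD n j x)"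
    "val TypeD n (swap_last n j) (negate_last n x) = val TypeD n j x" by blast+
qed

lemma swap_last_run:
  assumes n: "4 \<le> n" and w: "\<And>j. j \<in> set w \<Longrightarrow> j \<le> n"
  shows "run TypeD n (negate_last n x) (map (swap_last n) w) = negate_last n (run TypeD n x w) \<and>
    legal TypeD n (negate_last n x) (map (swap_last n) w) = legal TypeD n x w"
  using w
proof (induction w arbitrary: x)
  case (Cons j w)
  have j: "j \<le> n" "swap_last n j \<le> n" using Cons.prems[of j] by (auto simp: swap_last_def)
  then show ?case using Cons by (simp add: swap_last_act[OF n j(1)])
qed simp

context classical
begin

text \<open>Of the two words for the nodes n - 1 and n only one has to be analysed; conjugating with
  the automorphism gives the other.\<close>

lemma crit_data_swap:
  assumes X: "X = TypeD" and n: "4 \<le> n" and c: "crit_data x0 i y n p" and y: "\<And>j. j \<in> set y \<Longrightarrow> j \<le> n"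
  shows "criterion (swap_last n i) (map (swap_last n) y) (n - 1)"
proof -
  let ?t = "swap_last n" and ?n = "negate_last n"
  have tt: "?t (?t j) = j" for j using n by (auto simp: swap_last_def)
  have tI: "?t j \<in> I" if "j \<in> I" for j using that n by (auto simp: swap_last_def)
  have tn: "?t j \<le> n" if "j \<le> n" for j using that by (auto simp: swap_last_def)
  note c' = c[unfolded crit_data_def]
  have i: "i \<in> I" and p: "bij_betw p (I - {i}) (I - {n})" using c' by blast+
  have act: "val X n (?t j) (?n z) = val X n j z" if "j \<le> n" for j z
    using swap_last_act(2)[OF n that] X by simp
  have run: "run X n (?n z) (map ?t y) = ?n (run X n z y)" for z using swap_last_run[OF n y] X by simp
  have "bij_betw ?t (I - {?t i}) (I - {i})" "bij_betw ?t (I - {n}) (I - {n - 1})"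
  proof -
    have *: "bij_betw ?t (I - {?t j}) (I - {j})" if "j \<in> I" for j
    proof (rule bij_betw_byWitness[where f' = ?t])
      have sub: "?t ` (I - {?t l}) \<subseteq> I - {l}" for l
      proof (rule image_subsetI)
        fix a assume a: "a \<in> I - {?t l}"
        then have "?t a \<in> I" using tI by blast
        moreover have "?t a \<noteq> l" using a tt[of a] by auto
        ultimately show "?t a \<in> I - {l}" by blast
      qed
      show "?t ` (I - {?t j}) \<subseteq> I - {j}" by (rule sub)
      show "?t ` (I - {j}) \<subseteq> I - {?t j}" using sub[of "?t j"] by (simp only: tt)
    qed (use tt in blast)+
    show "bij_betw ?t (I - {?t i}) (I - {i})" using *[OF i] .
    show "bij_betw ?t (I - {n}) (I - {n - 1})" using *[of "n - 1"] n by (simp add: swap_last_def)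
  qed
  then have bij: "bij_betw (?t \<circ> p \<circ> ?t) (I - {?t i}) (I - {n - 1})"
    using p by (metis bij_betw_trans)
  have "crit_data (?n x0) (?t i) (map ?t y) (n - 1) (?t \<circ> p \<circ> ?t)"
    unfolding crit_data_def
  proof (intro conjI allI ballI impI bij)
    show "?t i \<in> I" using tI i .
    show "n - 1 \<in> I" using n by simp
    show "0 < val X n j (?n x0)" if "j \<le> n" for j
    proof -
      have "0 < val X n (?t j) x0" using c' tn[OF that] by blast
      then show ?thesis using act[OF tn[OF that], of x0] by (simp add: tt)
    qed
    show "legal X n (?n x0) (map ?t y)" using c' swap_last_run[OF n y] X by blast
    show "val X n j (run X n x (map ?t y)) = val X n ((?t \<circ> p \<circ> ?t) j) x" if j: "j \<in> I - {?t i}" for j x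
    proof -
      have tj: "?t j \<in> I - {i}" using j tI tt by auto
      have pj: "p (?t j) \<in> I" using p tj by (auto simp: bij_betw_def)
      have "run X n x (map ?t y) = ?n (run X n (?n x) y)" using run[of "?n x"] by simp
      then have "val X n j (run X n x (map ?t y)) = val X n (?t j) (run X n (?n x) y)"
        using act[of "?t j" "run X n (?n x) y"] tj by (simp add: tt)
      also have "\<dots> = val X n (p (?t j)) (?n x)" using c' tj by blast
      also have "\<dots> = val X n (?t (p (?t j))) x" using act[of "p (?t j)" "?n x"] pj by simp
      finally show ?thesis by simp
    qed
    have "om (n - 1) = ?n (om n)"
      using n X by (auto simp: om_eq classical_om_def negate_last_def fun_eq_iff)
    then show "val X n (?t i) (run X n (om (n - 1)) (map ?t y)) < 0"
      using c' run act i by simp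
    have "eps 0 = ?n (eps 0)" using n by (auto simp: eps_apply negate_last_def fun_eq_iff)
    then have "run X n (eps 0) (map ?t y) = ?n (run X n (eps 0) y)" using run by metis
    then show "0 < val X n (?t i) (run X n (eps 0) (map ?t y))" using c' act i by simp
  qed
  then show ?thesis by (rule crit_data_criterion)
qed

text \<open>The two ascending runs carry the first two entries to the end, as a block of the
  reversal would, so the word reverses all n entries.\<close>

lemma crit_data_D_even:
  assumes X: "X = TypeD" and n: "even n" "4 \<le> n"
  shows "crit_data (base n) n ([0] @ up 2 (n - 1) @ up 1 (n - 2) @ [0] @ Bs0_prod ((n - 4) div 2)) n (\<lambda>j. n - j)"
proof -
  define M where "M = (n - 4) div 2"
  have nM: "n = 2 * M + 4" using n by (auto simp: M_def elim!: evenE)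
  have XC: "X \<noteq> TypeC" using X by simp
  have n': "n - 1 = 2 * M + 3" "n - 2 = 2 * M + 2" "2 * M + 2 \<le> n" using nM by auto
  have u2: "1 \<le> (2::nat)" "2 \<le> 2 * M + 3 + 1" "2 * M + 3 < n" and u1: "1 \<le> (1::nat)" "1 \<le> 2 * M + 2 + 1" "2 * M + 2 < n"
    using nM by auto
  let ?w = "[0] @ up 2 (n - 1) @ up 1 (n - 2)"
  define b where "b x = x(1 := x 0 - x 2, 2 := x 0 - x 1)" for x :: vec
  define C where "C x = (\<lambda>k. if 2 \<le> k \<and> k \<le> 2 * M + 3 then b x (k + 1) else if k = 2 * M + 3 + 1 then b x 2 else b x k)" for x
  have a: "act X n 0 x = b x" for x using X by (simp add: act_def b_def)
  have run2: "run X n (b x) (up 2 (n - 1)) = C x" for x unfolding C_def n' by (rule run_up[OF u2])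
  have w: "run X n x ?w = (\<lambda>k. if 1 \<le> k \<and> k \<le> 2 * M + 2 then C x (k + 1) else if k = 2 * M + 2 + 1 then C x 1 else C x k)" for x
    unfolding run_append run.simps a run2 unfolding n' by (rule run_up[OF u1])
  have W: "run X n x ?w 0 = x 0" "\<And>k. 1 \<le> k \<Longrightarrow> k \<le> 2 * M + 2 \<Longrightarrow> run X n x ?w k = x (k + 2)"
      "run X n x ?w (2 * M + 3) = x 0 - x 2" "run X n x ?w (2 * M + 4) = x 0 - x 1"
      "\<And>k. n < k \<Longrightarrow> run X n x ?w k = x k" for x
    using nM unfolding w by (auto simp: C_def b_def)
  have run: "run X n x (?w @ [0] @ Bs0_prod M) = (\<lambda>k. if 1 \<le> k \<and> k \<le> n then x 0 - x (n + 1 - k) else x k)" for x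
  proof
    fix k
    have y: "run X n x (?w @ [0] @ Bs0_prod M) = (\<lambda>k. if 1 \<le> k \<and> k \<le> 2 * M + 2
        then run X n x ?w 0 - run X n x ?w (2 * M + 3 - k) else run X n x ?w k)"
      unfolding run_append[of X n x ?w] by (rule run_reversal[OF XC n'(3)])
    consider "k = 0" | "1 \<le> k" "k \<le> 2 * M + 2" | "k = 2 * M + 3" | "k = 2 * M + 4" | "n < k" using nM by linarith
    then show "run X n x (?w @ [0] @ Bs0_prod M) k = (if 1 \<le> k \<and> k \<le> n then x 0 - x (n + 1 - k) else x k)"
    proof cases
      case 2
      then have "1 \<le> 2 * M + 3 - k" "2 * M + 3 - k \<le> 2 * M + 2" "2 * M + 3 - k + 2 = n + 1 - k" "k \<le> n" using nM by auto
      then show ?thesis using 2 W(2)[of "2 * M + 3 - k" x] W(1) unfolding y by simp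
    next
      case 3
      then have "n + 1 - k = 2" "k \<le> n" "\<not> k \<le> 2 * M + 2" "1 \<le> k" using nM by auto
      then show ?thesis using 3 W(3) unfolding y by simp
    next
      case 4
      then have "n + 1 - k = 1" "k \<le> n" "\<not> k \<le> 2 * M + 2" "1 \<le> k" using nM by auto
      then show ?thesis using 4 W(4) unfolding y by simp
    next
      case 5
      then show ?thesis using W(5)[OF 5] nM unfolding y by simp
    qed (unfold y, use W in simp)
  qed
  have leg: "legal X n (base n) (?w @ [0] @ Bs0_prod M)"
  proof -
    have "0 < val X n 0 (base n)" using val_base[OF n2] by simp
    moreover have "legal X n (b (base n)) (up 2 (n - 1))"
      unfolding n' by (rule legal_up[OF u2]) (auto simp: b_def base_def)
    moreover have "legal X n (C (base n)) (up 1 (n - 2))"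
      unfolding n' by (rule legal_up[OF u1]) (use nM in \<open>auto simp: C_def b_def base_def\<close>)
    moreover have "legal X n (run X n (base n) ?w) ([0] @ Bs0_prod M)"
      by (rule legal_reversal[OF XC n'(3)]) (use W nM in \<open>auto simp: base_def\<close>)
    ultimately show ?thesis
      unfolding legal_append run_append legal.simps run.simps a run2 by simp
  qed
  have "bij_betw (\<lambda>j. n - j) (I - {n}) (I - {n})"
    by (rule bij_betw_byWitness[where f' = "\<lambda>j. n - j"]) auto
  moreover have "val X n j (run X n x (?w @ [0] @ Bs0_prod M)) = val X n (n - j) x" if j: "j \<in> I - {n}" for j x
  proof -
    have "j < n" "1 \<le> j" "1 \<le> n - j" "n - j < n" "n + 1 - j = n - j + 1" "n + 1 - (j + 1) = n - j" using j by auto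
    then show ?thesis unfolding run by (simp add: val_swap)
  qed
  moreover have "n + 1 - (n - 1) = 2" "n + 1 - n = 1" "n - 1 \<noteq> n" "1 \<le> n - 1" "n - 1 \<le> n" using n by auto
  then have "val X n n z' = z 0 - z 2 + (z 0 - z 1)" if "z' = run X n z (?w @ [0] @ Bs0_prod M)" for z z'
    using X n unfolding that run by (simp add: val_def)
  then have "val X n n (run X n (om n) (?w @ [0] @ Bs0_prod M)) < 0"
    "0 < val X n n (run X n (eps 0) (?w @ [0] @ Bs0_prod M))"
    using X n by (simp_all add: om_eq classical_om_def eps_apply)
  ultimately have "crit_data (base n) n (?w @ [0] @ Bs0_prod M) n (\<lambda>j. n - j)"
    using leg val_base[OF n2] n by (simp add: crit_data_def)
  then show ?thesis by (simp add: M_def)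
qed

text \<open>The ascending runs leave \<open>x 0 - x 2\<close> and \<open>x 0 - x 1\<close> at the
  end, and the letter n exchanges and negates them: this is the shift with i = n.\<close>

lemma shift_D_full:
  assumes X: "X = TypeD" and n: "4 \<le> n"
  defines "V \<equiv> [0] @ up 2 (n - 1) @ up 1 (n - 2) @ [n]"
  shows "run X n x V = shift n x" "shiftable n n x \<Longrightarrow> legal X n x V"
proof -
  obtain m where m: "n = m + 4" using n by (metis add.commute le_Suc_ex)
  have n': "n - 1 = m + 3" "n - 2 = m + 2" using m by auto
  have u2: "1 \<le> (2::nat)" "2 \<le> m + 3 + 1" "m + 3 < n" and u1: "1 \<le> (1::nat)" "1 \<le> m + 2 + 1" "m + 2 < n"
    using m by auto
  define b where "b = x(1 := x 0 - x 2, 2 := x 0 - x 1)"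
  define C where "C = (\<lambda>k. if 2 \<le> k \<and> k \<le> m + 3 then b (k + 1) else if k = m + 3 + 1 then b 2 else b k)"
  define E where "E = (\<lambda>k. if 1 \<le> k \<and> k \<le> m + 2 then C (k + 1) else if k = m + 2 + 1 then C 1 else C k)"
  have a: "act X n 0 x = b" using X by (simp add: act_def b_def)
  have run2: "run X n b (up 2 (n - 1)) = C" unfolding C_def n' by (rule run_up[OF u2])
  have run1: "run X n C (up 1 (n - 2)) = E" unfolding E_def n' by (rule run_up[OF u1])
  have E: "E 0 = x 0" "\<And>k. 1 \<le> k \<Longrightarrow> k \<le> m + 2 \<Longrightarrow> E k = x (k + 2)" "E (m + 3) = x 0 - x 2"
    "E (m + 4) = x 0 - x 1" "\<And>k. m + 4 < k \<Longrightarrow> E k = x k"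
    unfolding E_def C_def b_def by auto
  have "run X n x V = act X n n E"
    unfolding V_def run_append run.simps a run2 run1 by (rule refl)
  also have "\<dots> = E(n - 1 := - E n, n := - E (n - 1))" using X n by (simp add: act_def)
  also have "\<dots> = E(m + 3 := - E (m + 4), m + 4 := - E (m + 3))" by (simp only: n'(1), simp only: m)
  also have "\<dots> = shift n x"
  proof
    fix k
    consider "k = 0" | "1 \<le> k" "k \<le> m + 2" | "k = m + 3" | "k = m + 4" | "m + 4 < k" by linarith
    then show "(E(m + 3 := - E (m + 4), m + 4 := - E (m + 3))) k = shift n x k"
      using E(2)[of k] E(5)[of k] by cases (simp_all add: shift_def m E)
  qed
  finally show "run X n x V = shift n x" .
  assume s: "shiftable n n x"
  have n3: "3 \<le> n" using n by simp
  note h = shiftable_bounds[OF s n3]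
  have "0 < val X n 0 x" using X h(1) by (simp add: val_def)
  moreover have "legal X n b (up 2 (n - 1))"
    unfolding n'
  proof (rule legal_up[OF u2])
    show "b k < b 2" if "2 < k" "k \<le> m + 3 + 1" for k using h(6)[of k] that m by (simp add: b_def)
  qed
  moreover have "legal X n C (up 1 (n - 2))"
    unfolding n'
  proof (rule legal_up[OF u1])
    show "C k < C 1" if "1 < k" "k \<le> m + 2 + 1" for k
      using h(6)[of "k + 1"] h(3) that m by (simp add: C_def b_def)
  qed
  moreover have "0 < val X n n E"
  proof -
    have "E (n - 1) = x 0 - x 2" unfolding n'(1) by (rule E(3))
    moreover have "E n = x 0 - x 1" unfolding m by (rule E(4))
    ultimately show ?thesis using X n h(1-3,5) by (simp add: val_def)
  qed
  ultimately show "legal X n x V" 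
    unfolding V_def legal_append run_append legal.simps run.simps a run2 run1 by simp
qed

text \<open>The exponent exceeds the range of \<open>run_wpow_shift\<close> by one, so the last
  block is applied separately and wraps \<open>x 1\<close> around a second time. The result
  \<open>x 2 - x 0\<close>, ..., \<open>x n - x 0\<close>, \<open>x 1 - 2 * x 0\<close> has its
  first n - 1 entries reversed. Node n then goes to node 1, which leaves i = n - 1.\<close>

lemma crit_data_D_odd:
  assumes X: "X = TypeD" and n: "odd n" "5 \<le> n"
  shows "crit_data (base n) (n - 1)
    (wpow ([0] @ up 2 (n - 1) @ up 1 (n - 2) @ [n]) ((n + 1) div 2) @ [0] @ Bs0_prod ((n - 3) div 2)) n
    (\<lambda>j. if j = n then 1 else n - j)"
proof -
  define M where "M = (n - 3) div 2"
  have nM: "n = 2 * M + 3" using n by (auto simp: M_def elim!: oddE)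
  have XC: "X \<noteq> TypeC" using X by simp
  have M: "2 * M + 2 \<le> n" "(n + 1) div 2 = Suc (M + 1)" "2 * (M + 1) + 1 \<le> n" and n3: "3 \<le> n" using nM by auto
  have n4: "4 \<le> n" using n by simp
  let ?V = "[0] @ up 2 (n - 1) @ up 1 (n - 2) @ [n]"
  note V = shift_D_full[OF X n4]
  let ?s = "\<lambda>x. run X n x (wpow ?V ((n + 1) div 2))"
  let ?y = "wpow ?V ((n + 1) div 2) @ [0] @ Bs0_prod M"
  have sx: "?s x k = (if k = n then x 1 - 2 * x 0 else if 1 \<le> k \<and> k < n then x (k + 1) - x 0 else x k)" for x k
  proof -
    define z where "z = run X n x (wpow ?V (M + 1))"
    have z: "z = (\<lambda>k. if 1 \<le> k \<and> k \<le> n then (if k + 2 * (M + 1) \<le> n then x (k + 2 * (M + 1))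
        else x (k + 2 * (M + 1) - n) - x 0) else x k)"
      unfolding z_def by (rule run_wpow_shift[OF V(1) M(3) n3])
    have zz: "z 0 = x 0" "z 1 = x n" "\<And>k. 2 \<le> k \<Longrightarrow> k \<le> n \<Longrightarrow> z k = x (k - 1) - x 0" "\<And>k. n < k \<Longrightarrow> z k = x k"
    proof -
      show "z 0 = x 0" "\<And>k. n < k \<Longrightarrow> z k = x k" using nM by (auto simp: z)
      have "1 + 2 * (M + 1) = n" "1 \<le> n" using nM by auto
      then show "z 1 = x n" unfolding z by simp
      fix k assume "2 \<le> k" "k \<le> n"
      then have "\<not> k + 2 * (M + 1) \<le> n" "k + 2 * (M + 1) - n = k - 1" "1 \<le> k" using nM by auto
      then show "z k = x (k - 1) - x 0" using \<open>k \<le> n\<close> by (simp add: z)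
    qed
    have s: "?s x = shift n z" 
      by (simp only: M(2) wpow_Suc run_append[of X n x "wpow ?V (M + 1)" ?V] V(1) z_def)
    consider "k = 0" | "1 \<le> k" "k + 2 \<le> n" | "k + 1 = n" | "k = n" | "n < k" by linarith
    then show ?thesis
    proof cases
      case 2
      then show ?thesis using zz(3)[of "k + 2"] unfolding s by (simp add: shift_def)
    next
      case 3
      then have "\<not> k + 2 \<le> n" "k = n - 1" by auto
      then have "?s x k = x n - x 0" using zz(1,2) unfolding s shift_def by simp
      moreover have "k \<noteq> n" "1 \<le> k" "k < n" using 3 n by auto
      ultimately show ?thesis using 3 by simp
    next
      case 4
      then have "\<not> k + 2 \<le> n" "k \<noteq> n - 1" using n by auto
      then show ?thesis using zz(1) zz(3)[of 2] 4 n unfolding s by (simp add: shift_def)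
    next
      case 5
      then have "\<not> k + 2 \<le> n" "k \<noteq> n - 1" "k \<noteq> n" by auto
      then show ?thesis using zz(4)[OF 5] 5 unfolding s by (simp add: shift_def)
    qed (unfold s, use n zz(1) in \<open>auto simp: shift_def\<close>)
  qed
  have run: "run X n x ?y k = (if 1 \<le> k \<and> k < n then 2 * x 0 - x (n + 1 - k) else if k = n then x 1 - 2 * x 0 else x k)" for x k
  proof -
    have y: "run X n x ?y = (\<lambda>k. if 1 \<le> k \<and> k \<le> 2 * M + 2 then ?s x 0 - ?s x (2 * M + 3 - k) else ?s x k)"
      unfolding run_append[of X n x "wpow ?V ((n + 1) div 2)"] by (rule run_reversal[OF XC M(1)])
    show ?thesis
    proof (cases "1 \<le> k \<and> k < n")
      case True
      then have k: "k \<le> 2 * M + 2" "2 * M + 3 - k \<noteq> n" "1 \<le> 2 * M + 3 - k" "2 * M + 3 - k < n"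
        "2 * M + 3 - k + 1 = n + 1 - k" using nM by auto
      have "?s x (2 * M + 3 - k) = x (n + 1 - k) - x 0" using k by (simp only: sx if_False simp_thms if_True)
      moreover have "?s x 0 = x 0" using n by (simp only: sx) simp
      ultimately show ?thesis using True k(1) unfolding y by simp
    next
      case False
      then have "\<not> (1 \<le> k \<and> k \<le> 2 * M + 2)" using nM by auto
      then show ?thesis using False unfolding y by (simp only: if_False sx)
    qed
  qed
  have leg: "legal X n (base n) ?y"
  proof -
    have "legal X n (base n) (wpow ?V ((n + 1) div 2))"
      using legal_wpow_shift[OF V shiftable_base n3] n by simp
    moreover have "legal X n (?s (base n)) ([0] @ Bs0_prod M)"
    proof (rule legal_reversal[OF XC M(1)])
      fix a b assume ab: "1 \<le> a" "a < b" "b \<le> 2 * M + 2"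
      then have "a \<noteq> n" "b \<noteq> n" "a < n" "b < n" "1 \<le> b" using nM by auto
      then have "?s (base n) a = base n (a + 1) - base n 0" "?s (base n) b = base n (b + 1) - base n 0"
        using ab by (simp_all only: sx if_False if_True simp_thms)
      then show "?s (base n) b < ?s (base n) a" using ab by (simp add: base_def)
    next
      have "0 \<noteq> n" "1 \<noteq> n" "2 \<noteq> n" "1 < n" "2 < n" "1 \<le> (1::nat)" "1 \<le> (2::nat)" using n by auto
      then have "?s (base n) 1 = base n 2 - base n 0" "?s (base n) 2 = base n 3 - base n 0" "?s (base n) 0 = base n 0"
        unfolding sx by (simp_all add: numeral_3_eq_3 numeral_2_eq_2)
      then show "?s (base n) 1 + ?s (base n) 2 < ?s (base n) 0" by (simp add: base_def)
    qed
    ultimately show ?thesis by (simp only: legal_append simp_thms)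
  qed
  let ?p = "\<lambda>j. if j = n then 1 else n - j"
  have "bij_betw ?p (I - {n - 1}) (I - {n})"
    by (rule bij_betw_byWitness[where f' = "\<lambda>j. if j = 1 then n else n - j"]) (use n in \<open>auto split: if_splits\<close>)
  moreover have "val X n j (run X n x ?y) = val X n (?p j) x" if j: "j \<in> I - {n - 1}" for j x
  proof (cases "j = n")
    case True
    have "1 \<le> n - 1" "n - 1 < n" "n + 1 - (n - 1) = 2" "\<not> n < n" "1 < n" "n \<noteq> 0" using n by auto
    have "val X n n z = z (n - 1) + z n" for z using X n by (simp add: val_def)
    then have "val X n j (run X n x ?y) = run X n x ?y (n - 1) + run X n x ?y n" using True by simp
    also have "\<dots> = x 1 - x 2"
      using \<open>1 \<le> n - 1\<close> \<open>n - 1 < n\<close> \<open>n + 1 - (n - 1) = 2\<close> \<open>\<not> n < n\<close> \<open>n \<noteq> 0\<close>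
      by (simp only: run if_True if_False simp_thms)
    also have "\<dots> = val X n (?p j) x" using True \<open>1 < n\<close> by (simp add: val_def numeral_2_eq_2)
    finally show ?thesis .
  next
    case False
    then have "1 \<le> j" "j < n" "j + 1 < n" "1 \<le> n - j" "n - j < n" "n + 1 - j = n - j + 1" "n + 1 - (j + 1) = n - j"
      using j by auto
    then show ?thesis using False unfolding run by (simp add: val_swap)
  qed
  moreover have "1 \<le> n - 1" "n - 1 < n" "n + 1 - (n - 1) = 2" "n - 1 + 1 = n" using n by auto
  then have "val X n (n - 1) (run X n z ?y) = 2 * z 0 - z 2 - (z 1 - 2 * z 0)" for z
    by (simp only: val_swap run) simp
  then have "val X n (n - 1) (run X n (om n) ?y) < 0" "0 < val X n (n - 1) (run X n (eps 0) ?y)"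
    using X n by (simp_all add: om_eq classical_om_def eps_apply)
  ultimately have "crit_data (base n) (n - 1) ?y n ?p"
    using leg val_base[OF n2] n by (simp add: crit_data_def)
  then show ?thesis by (simp add: M_def)
qed

end

section \<open>Root data of the classical types\<close>

lemma ip_classical:
  assumes "X \<in> {TypeB, TypeC, TypeD}" "1 \<le> j" "j \<le> n"
  shows "inner_prod X n v (eps j) = v j" "inner_prod X n (eps j) v = v j"
proof -
  have "ambient_dim X n = n" using assms(1) by auto
  then show "inner_prod X n v (eps j) = v j" using inner_prod_eps[of j X n v] assms by simp
  then show "inner_prod X n (eps j) v = v j" by (simp add: inner_prod_def mult.commute)
qed

lemma simple_root_classical:
  assumes "X \<in> {TypeB, TypeC, TypeD}"
  shows "j < n \<Longrightarrow> simple_root X n j = eps j - eps (j + 1)"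
    "simple_root X n n = (if X = TypeB then eps n else if X = TypeC then scl 2 (eps n) else eps (n - 1) + eps n)"
  using assms by auto

text \<open>Descends from the end of the diagram: \<epsilon>_(n-1) + \<epsilon>_n is simple in type
  D and one reflection away from a simple root in type B, and two reflections lower both indices by
  one.\<close>

lemma sum_root_classical:
  assumes X: "X \<in> {TypeB, TypeD}" and n: "2 \<le> n" and j: "1 \<le> j" "j < n"
  shows "eps j + eps (j + 1) \<in> roots X n"
proof -
  interpret weyl_words X n .
  have X': "X \<in> {TypeB, TypeC, TypeD}" using X by auto
  note ipe = ip_classical[OF X']
  note sr = simple_root_classical[OF X']
  have dec: "eps (n - Suc l) + eps (n - l) \<in> roots X n" if "Suc l < n" for l
    using that
  proof (induction l)
    case 0
    have n1: "1 \<le> n - 1" "n - 1 < n" "n - 1 + 1 = n" "1 \<le> n" "n - 1 \<le> n" "n \<noteq> n - 1" using n by auto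
    show ?case
    proof (cases "X = TypeD")
      case True
      then show ?thesis using sr(2)[of n] roots.simple[of n n X] n1 by simp
    next
      case False
      then have srn: "sr n = eps n" using sr(2)[of n] X by auto
      have sr1: "sr (n - 1) = eps (n - 1) - eps n" using sr(1)[of "n - 1" n] n1 by simp
      have "reflection X n (sr n) (sr (n - 1)) \<in> roots X n"
        using n1 by (intro roots.reflect roots.simple) auto
      moreover have "ip (sr (n - 1)) (sr n) = - 1" "ip (sr n) (sr n) = 1"
        unfolding srn sr1 using n1 by (simp_all add: ipe eps_apply)
      then have "reflection X n (sr n) (sr (n - 1)) = sr (n - 1) + scl 2 (sr n)"
        by (simp add: reflection_def fun_eq_iff vec_apply)
      then have "reflection X n (sr n) (sr (n - 1)) = eps (n - 1) + eps n"
        unfolding srn sr1 by (simp add: fun_eq_iff vec_apply)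
      ultimately show ?thesis by simp
    qed
  next
    case (Suc l)
    define j where "j = n - Suc (Suc l)"
    have j: "1 \<le> j" "j + 2 \<le> n" "n - Suc l = j + 1" "n - l = j + 2" using Suc.prems by (auto simp: j_def)
    have IH: "eps (j + 1) + eps (j + 2) \<in> roots X n" using Suc j by simp
    have srj: "sr j = eps j - eps (j + 1)" "sr (j + 1) = eps (j + 1) - eps (j + 2)"
      using sr(1)[of j n] sr(1)[of "j + 1" n] j by simp_all
    have "reflection X n (sr j) (eps (j + 1) + eps (j + 2)) = eps j + eps (j + 2)"
    proof -
      have "ip (eps (j + 1) + eps (j + 2)) (sr j) = - 1" "ip (sr j) (sr j) = 2"
        using j by (simp_all add: srj ipe eps_apply)
      then show ?thesis by (simp add: reflection_def srj)
    qed
    then have R: "eps j + eps (j + 2) \<in> roots X n" using roots.reflect[OF IH, of j] j by simp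
    have "reflection X n (sr (j + 1)) (eps j + eps (j + 2)) = eps j + eps (j + 1)"
    proof -
      have "ip (eps j + eps (j + 2)) (sr (j + 1)) = - 1" "ip (sr (j + 1)) (sr (j + 1)) = 2"
        using j by (simp_all add: srj(2)[simplified] ipe eps_apply)
      then show ?thesis unfolding reflection_def srj(2) by (simp add: fun_eq_iff vec_apply)
    qed
    then have "eps j + eps (j + 1) \<in> roots X n" using roots.reflect[OF R, of "j + 1"] j by simp
    then show ?case using j by (simp add: j_def[symmetric])
  qed
  have "Suc (n - j - 1) < n" "n - Suc (n - j - 1) = j" "n - (n - j - 1) = j + 1" using j by auto
  then show ?thesis using dec[of "n - j - 1"] by simp
qed

lemma long_root_C:
  assumes n: "2 \<le> n" and j: "1 \<le> j" "j \<le> n"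
  shows "scl 2 (eps j) \<in> roots TypeC n"
proof -
  interpret weyl_words TypeC n .
  have X: "TypeC \<in> {TypeB, TypeC, TypeD}" by simp
  note ipe = ip_classical[OF X]
  have dec: "scl 2 (eps (n - l)) \<in> roots TypeC n" if "l < n" for l
    using that
  proof (induction l)
    case 0
    then show ?case using roots.simple[of n n TypeC] by simp
  next
    case (Suc l)
    define j where "j = n - Suc l"
    have j: "1 \<le> j" "j < n" "n - l = j + 1" using Suc.prems by (auto simp: j_def)
    have IH: "scl 2 (eps (j + 1)) \<in> roots TypeC n" using Suc j by simp
    have srj: "sr j = eps j - eps (j + 1)" using j by simp
    have "ip (scl 2 (eps (j + 1))) (sr j) = - 2" "ip (sr j) (sr j) = 2"
      unfolding srj using j by (simp_all add: ipe eps_apply)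
    then have "reflection TypeC n (sr j) (scl 2 (eps (j + 1))) = scl 2 (eps j)"
      unfolding reflection_def srj by (simp add: fun_eq_iff vec_apply)
    then show ?case using roots.reflect[OF IH, of j] j by (simp add: j_def[symmetric])
  qed
  show ?thesis using dec[of "n - j"] j by simp
qed

lemma classical_datum:
  assumes X: "X \<in> {TypeB, TypeC, TypeD}" and n: "2 \<le> n" "X = TypeD \<Longrightarrow> 4 \<le> n"
  shows "classical X n (classical_om X n) (if X = TypeC then scl 2 (eps 1) else eps 1 + eps 2)
    (if X = TypeB then 1 else 2) (if X = TypeD then 1 else 2)"
proof -
  interpret weyl_words X n .
  note ipe = ip_classical[OF X]
  note sr = simple_root_classical[OF X]
  have dim: "ambient_dim X n = n" using X by auto
  \<comment> \<open>Writing n as a successor lets comparisons with n - 1 be decided by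
    simplification.\<close>
  define nn where "nn = n - 1"
  have nn: "n = Suc nn" "1 \<le> nn" using n by (auto simp: nn_def)
  let ?rho = "if X = TypeC then scl 2 (eps 1) else eps 1 + eps 2"
  have ipv: "ip (sr j) v = (if j < n then v j - v (j + 1) else if X = TypeB then v n else if X = TypeC then 2 * v n
      else v (n - 1) + v n)" if j: "j \<in> I" for j v
  proof (cases "j < n")
    case True
    then show ?thesis using j by (simp add: sr(1) ipe)
  next
    case False
    then have "j = n" using j by simp
    have "ip (if b then eps n else if c then scl 2 (eps n) else eps (n - 1) + eps n) v =
        (if b then v n else if c then 2 * v n else v (n - 1) + v n)" for b c
      using n by (simp add: ipe)
    then show ?thesis using \<open>j = n\<close> by (simp add: sr(2))
  qed
  have sr_eval: "sr j k = (if j < n then (if k = j then 1 else 0) - (if k = j + 1 then 1 else 0)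
      else if X = TypeB then (if k = n then 1 else 0) else if X = TypeC then (if k = n then 2 else 0)
      else (if k = n - 1 then 1 else 0) + (if k = n then 1 else 0))" if "j \<in> I" for j k
  proof (cases "j < n")
    case True
    then show ?thesis by (simp add: sr(1) vec_apply)
  next
    case False
    then have "j = n" using that by simp
    then show ?thesis by (simp add: sr(2) vec_apply)
  qed
  have rho_eval: "?rho k = (if X = TypeC then (if k = 1 then 2 else 0) else (if k = 1 \<or> k = 2 then 1 else 0))" for k
    by (auto simp: vec_apply)
  have "ip (if b then scl 2 (eps 1) else eps 1 + eps 2) v = (if b then 2 * v 1 else v 1 + v 2)" for v b
    using n by (simp add: ipe)
  then have ip_rho: "ip ?rho v = (if X = TypeC then 2 * v 1 else v 1 + v 2)" for v .
  have ip_self: "ip (sr j) (sr j) = (if j < n then 2 else if X = TypeB then 1 else if X = TypeC then 4 else 2)"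
    if "j \<in> I" for j
    using that n unfolding ipv[OF that] sr_eval[OF that] by (auto simp: nn)
  \<comment> \<open>The second part excludes - 1 against the last root of type C, whose norm is 4,
    where it would break integrality.\<close>
  have ip_sr: "ip (sr i) (sr j) \<in> {0, -1, - 2}" "ip (sr i) (sr j) \<noteq> - 1 \<or> j < n \<or> X \<noteq> TypeC"
    if ij: "i \<in> I" "j \<in> I" "i \<noteq> j" for i j
    using that n unfolding ipv[OF ij(1)] sr_eval[OF ij(2)] by (auto simp: nn)
  show ?thesis
  proof
    show "1 \<le> n" "2 \<le> n" using n by auto
    show "sr j k = 0" if "j \<in> I" "k \<notin> {1..ambient_dim X n}" for j k
      using that n unfolding dim sr_eval[OF that(1)] by auto
    show "ip (sr i) (classical_om X n j) = (if i = j then 1 else 0)" if "i \<in> I" "j \<in> I" for i j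
      using that n X unfolding ipv[OF that(1)] by (auto simp: classical_om_def nn split: if_splits)
    show "\<exists>z::int. 2 * ip (sr i) (sr j) = z * ip (sr j) (sr j)" if ij: "i \<in> I" "j \<in> I" for i j
    proof (cases "i = j")
      case True
      then show ?thesis by (intro exI[of _ 2]) simp
    next
      case False
      note v = ip_sr[OF ij False]
      have "ip (sr j) (sr j) \<in> {1, 2} \<or> ip (sr j) (sr j) = 4 \<and> ip (sr i) (sr j) \<noteq> - 1"
        using ip_self[OF ij(2)] v(2) by auto
      then consider "ip (sr j) (sr j) = 1" | "ip (sr j) (sr j) = 2"
        | "ip (sr j) (sr j) = 4" "ip (sr i) (sr j) = 0 \<or> ip (sr i) (sr j) = - 2" using v(1) by auto
      then show ?thesis
      proof cases
        case 1
        then show ?thesis using v(1) by (auto intro: exI[of _ 0] exI[of _ "-2"] exI[of _ "-4"])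
      next
        case 2
        then show ?thesis using v(1) by (auto intro: exI[of _ 0] exI[of _ "-1"] exI[of _ "-2"])
      next
        case 3
        then show ?thesis by (auto intro: exI[of _ 0] exI[of _ "-1"])
      qed
    qed
    show "ip (sr i) (sr j) \<le> 0" if "i \<in> I" "j \<in> I" "i \<noteq> j" for i j
      using ip_sr(1)[OF that] by auto
    show "ip (sr j) (sr j) \<in> {if X = TypeB then 1 else 2, real (if X = TypeD then 1 else 2) * (if X = TypeB then 1 else 2)}"
      if "j \<in> I" for j
      using X unfolding ip_self[OF that] by auto
    show "0 < (if X = TypeB then 1 else 2 :: real)" "(if X = TypeD then 1 else 2 :: nat) \<in> {1, 2, 3}" by auto
    show "?rho \<in> R"
      using long_root_C[OF n(1), of 1] sum_root_classical[of X n 1] X n by (auto simp: numeral_2_eq_2)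
    show "0 \<le> ip ?rho (sr j)" if "j \<in> I" for j
      using that n X unfolding ip_rho sr_eval[OF that] by auto
    show "ip ?rho ?rho = real (if X = TypeD then 1 else 2) * (if X = TypeB then 1 else 2)"
      using X unfolding ip_rho rho_eval by auto
    show "0 < ip ?rho (classical_om X n j)" if "j \<in> I" for j
      using that n X unfolding ip_rho by (auto simp: classical_om_def)
    show "classical_om X n = classical_om X n" by (rule refl)
    show "(X = TypeB \<and> ?rho = eps 1 + eps 2) \<or> (X = TypeC \<and> ?rho = scl 2 (eps 1)) \<or> (X = TypeD \<and> ?rho = eps 1 + eps 2)"
      using X by auto
  qed
qed

section \<open>The words of types B and D, and the theorem\<close>

context classical
begin

lemma criterion_B:
  assumes X: "X = TypeB" and i: "i \<in> I"
  shows "criterion i (y_B n i) i"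
proof -
  have XC: "X \<noteq> TypeC" using X by simp
  have cyc: "cycle X n a j = up a n @ down (n - 1) j" for a j using X by (simp add: cycle_def)
  consider "i = 1" | "even i" "i \<noteq> 1" | "odd i" "3 \<le> i" using i by (cases "even i"; cases "i = 1") (auto elim!: oddE)
  then show ?thesis
  proof cases
    case 1
    have "X = TypeD \<Longrightarrow> 3 \<le> n" using X by simp
    then show ?thesis using criterion_one[OF XC] 1 by (simp add: y_B_def cyc)
  next
    case 2
    then have "2 \<le> i" using i by (auto elim!: evenE)
    then show ?thesis using criterion_even[OF XC 2(1)] 2 i X by (simp add: y_B_def)
  next
    case 3
    have le: "i \<le> n" using i by simp
    note Z = shift_B[OF X 3(2) le]
    have w: "y_B n i = wpow ([0] @ cycle X n 2 i @ cycle X n 1 i) ((i - 1) div 2) @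
        [0] @ cycle X n 2 i @ up 1 (i - 1) @ [0] @ Bs0_prod ((i - 3) div 2)"
      using 3 s0B_prod_conv[of "(i - 3) div 2"] by (simp add: y_B_def cyc)
    show ?thesis unfolding w using X by (intro criterion_odd[OF XC 3 le _ Z]) auto
  qed
qed

text \<open>For n even the word \<open>y_n\<close> is analysed directly and \<open>y_(n-1)\<close>
  follows by the automorphism; for n odd it is the other way round, and the coweight belongs to the
  opposite one of the last two nodes.\<close>

lemma criterion_D:
  assumes X: "X = TypeD" and n: "4 \<le> n" and i: "i \<in> I"
  shows "criterion i (y_D n i) (if odd n then swap_last n i else i)"
proof -
  have XC: "X \<noteq> TypeC" using X by simp
  have cyc: "cycle X n a j = up a n @ down (n - 2) j" for a j using X by (simp add: cycle_def)
  have cycn: "cycle X n a (n - 1) = up a n" for a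
  proof -
    have "n - 1 = Suc (n - 2)" using n by simp
    then show ?thesis by (simp add: cyc down_empty)
  qed
  have n1: "n - 1 \<noteq> 1" "n \<noteq> 1" "\<not> n - 1 \<le> n - 2" "\<not> n \<le> n - 2" "n \<noteq> n - 1" "Suc (n - 2) = n - 1" using n by auto
  consider (small) "i \<le> n - 2" | (last1) "i = n - 1" | (last) "i = n" using i by fastforce
  then show ?thesis
  proof cases
    case small
    then have i2: "i + 2 \<le> n" using n by simp
    then have k: "(if odd n then swap_last n i else i) = i" by (auto simp: swap_last_def)
    consider "i = 1" | "even i" "i \<noteq> 1" | "odd i" "3 \<le> i" using i by (cases "even i"; cases "i = 1") (auto elim!: oddE)
    then have "criterion i (y_D n i) i"
    proof cases
      case 1
      then show ?thesis using criterion_one[OF XC] n by (simp add: y_D_def cyc)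
    next
      case 2
      then have "2 \<le> i" using i by (auto elim!: evenE)
      then show ?thesis using criterion_even[OF XC 2(1)] 2 i2 small by (simp add: y_D_def)
    next
      case 3
      have le: "i \<le> n" using i by simp
      note Z = shift_D[OF X 3(2) i2]
      have w: "y_D n i = wpow ([0] @ cycle X n 2 (n - 1) @ cycle X n 1 (n - 1) @ pairs_down (n - 3) (i - 1)) ((i - 1) div 2) @
          [0] @ cycle X n 2 i @ up 1 (i - 1) @ [0] @ Bs0_prod ((i - 3) div 2)"
      proof -
        have "y_D n i = ([0] @ wpow ((up 2 n @ up 1 n @ pairs_down (n - 3) (i - 1)) @ [0]) ((i - 1) div 2)) @
            (cycle X n 2 i @ up 1 (i - 1) @ [0]) @ Bs0_prod ((i - 3) div 2)"
          using 3 small by (simp add: y_D_def cyc pairs_down_def)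
        then show ?thesis unfolding wpow_conj cycn by simp
      qed
      show ?thesis unfolding w using i2 by (intro criterion_odd[OF XC 3 le _ Z]) auto
    qed
    then show ?thesis unfolding k .
  next
    case last1
    show ?thesis
    proof (cases "odd n")
      case True
      then have "5 \<le> n" using n by (auto elim!: oddE)
      note c = crit_data_criterion[OF crit_data_D_odd[OF X True this]]
      have "y_D n i = ([0] @ wpow ((up 2 (n - 1) @ up 1 (n - 2) @ [n]) @ [0]) ((n + 1) div 2)) @ Bs0_prod ((n - 3) div 2)"
        unfolding last1 using True n1 by (simp add: y_D_def)
      then have "y_D n i = wpow ([0] @ up 2 (n - 1) @ up 1 (n - 2) @ [n]) ((n + 1) div 2) @ [0] @ Bs0_prod ((n - 3) div 2)"
        unfolding wpow_conj by simp
      then show ?thesis using c last1 True by (simp add: swap_last_def)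
    next
      case False
      define w where "w = [0] @ up 2 (n - 1) @ up 1 (n - 2) @ [0] @ Bs0_prod ((n - 4) div 2)"
      have wn: "j \<le> n" if "j \<in> set w" for j
        using that set_Bs0_prod[of j "(n - 4) div 2"] n by (auto simp: w_def set_up)
      have "crit_data (base n) n w n (\<lambda>j. n - j)" unfolding w_def using crit_data_D_even[OF X _ n] False by simp
      then have c: "criterion (swap_last n n) (map (swap_last n) w) (n - 1)" by (rule crit_data_swap[OF X n _ wn])
      have "up 2 (n - 1) = up 2 (n - 2) @ [n - 1]" using up_snoc[of 2 "n - 2"] n n1(6) by simp
      moreover have "map (swap_last n) (up a (n - 2)) = up a (n - 2)" for a
        using n by (intro map_swap_last_id) (auto simp: set_up)
      moreover have "map (swap_last n) (Bs0_prod ((n - 4) div 2)) = Bs0_prod ((n - 4) div 2)"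
      proof (rule map_swap_last_id)
        fix j assume "j \<in> set (Bs0_prod ((n - 4) div 2))"
        then show "j + 2 \<le> n" using set_Bs0_prod[of j "(n - 4) div 2"] n by linarith
      qed
      moreover have "swap_last n 0 = 0" "swap_last n (n - 1) = n" "swap_last n n = n - 1" using n by (auto simp: swap_last_def)
      ultimately have "map (swap_last n) w = [0] @ up 2 (n - 2) @ [n] @ up 1 (n - 2) @ [0] @ Bs0_prod ((n - 4) div 2)"
        unfolding w_def by simp
      also have "\<dots> = y_D n i" unfolding last1 using False n1 by (simp add: y_D_def)
      finally show ?thesis using c False last1 \<open>swap_last n n = n - 1\<close> by simp
    qed
  next
    case last
    show ?thesis
    proof (cases "odd n")
      case True
      then have n5: "5 \<le> n" using n by (auto elim!: oddE)
      define v where "v = [0] @ up 2 (n - 1) @ up 1 (n - 2) @ [n]"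
      define w where "w = wpow v ((n + 1) div 2) @ [0] @ Bs0_prod ((n - 3) div 2)"
      have vn: "j \<le> n" if "j \<in> set v" for j using that n by (auto simp: v_def set_up)
      have "set (wpow v l) \<subseteq> set v" for l by (auto simp: wpow_def)
      then have wn: "j \<le> n" if "j \<in> set w" for j
        using that set_Bs0_prod[of j "(n - 3) div 2"] n vn by (fastforce simp: w_def)
      have "crit_data (base n) (n - 1) w n (\<lambda>j. if j = n then 1 else n - j)"
        unfolding w_def v_def by (rule crit_data_D_odd[OF X True n5])
      then have c: "criterion (swap_last n (n - 1)) (map (swap_last n) w) (n - 1)" by (rule crit_data_swap[OF X n _ wn])
      have "up 2 (n - 1) = up 2 (n - 2) @ [n - 1]" using up_snoc[of 2 "n - 2"] n n1(6) by simp
      moreover have "map (swap_last n) (up a (n - 2)) = up a (n - 2)" for a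
        using n by (intro map_swap_last_id) (auto simp: set_up)
      moreover have sw: "swap_last n 0 = 0" "swap_last n (n - 1) = n" "swap_last n n = n - 1" using n by (auto simp: swap_last_def)
      ultimately have v: "map (swap_last n) v = [0] @ up 2 (n - 2) @ [n] @ up 1 (n - 2) @ [n - 1]"
        unfolding v_def by simp
      have "map (swap_last n) (Bs0_prod ((n - 3) div 2)) = Bs0_prod ((n - 3) div 2)"
      proof (rule map_swap_last_id)
        fix j assume "j \<in> set (Bs0_prod ((n - 3) div 2))"
        then have "j \<le> 2 * ((n - 3) div 2) + 1" by (rule set_Bs0_prod)
        then show "j + 2 \<le> n" using n by linarith
      qed
      then have "map (swap_last n) w = wpow ([0] @ (up 2 (n - 2) @ [n] @ up 1 (n - 2) @ [n - 1])) ((n + 1) div 2) @ [0] @ Bs0_prod ((n - 3) div 2)"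
        using v sw by (simp add: w_def map_wpow)
      also have "\<dots> = ([0] @ wpow ((up 2 (n - 2) @ [n] @ up 1 (n - 2) @ [n - 1]) @ [0]) ((n + 1) div 2)) @ Bs0_prod ((n - 3) div 2)"
        unfolding wpow_conj by simp
      also have "\<dots> = y_D n i" unfolding last using True n1 by (simp add: y_D_def)
      finally show ?thesis using c last sw True by simp
    next
      case False
      have "up 2 (n - 1) = up 2 (n - 2) @ [n - 1]" using up_snoc[of 2 "n - 2"] n n1(6) by simp
      then have "[0] @ up 2 (n - 1) @ up 1 (n - 2) @ [0] @ Bs0_prod ((n - 4) div 2) = y_D n i"
        unfolding last using False n1 by (simp add: y_D_def)
      then show ?thesis using crit_data_criterion[OF crit_data_D_even[OF X _ n]] False last by simp
    qed
  qed
qed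

end

lemma minimal_iff_classical:
  assumes X: "X \<in> {TypeB, TypeC, TypeD}" and adm: "admissible X n" and x: "inf_reduced X n x"
  shows "minimal_inf_reduced X n x \<longleftrightarrow>
    (\<exists>i \<in> {1..n}. \<exists>u v.
      reduced_expression X n {1..n} (u @ v)
        (longest_element X n ({1..n} - {i}) \<circ> longest_element X n {1..n}) \<and>
      inf_reduced_expression X n (periodic_word (v @ y_word X n i @ u)) x)"
proof -
  have n: "2 \<le> n" "X = TypeD \<Longrightarrow> 4 \<le> n" using X adm by auto
  interpret classical X n "classical_om X n" "if X = TypeC then scl 2 (eps 1) else eps 1 + eps 2"
    "if X = TypeB then 1 else 2" "if X = TypeD then 1 else 2"
    by (rule classical_datum[OF X n])
  define \<kappa> where "\<kappa> i = (if X = TypeD \<and> odd n then swap_last n i else i)" for i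
  show ?thesis
  proof (rule minimal_iff[where \<kappa> = \<kappa>, OF _ _ x])
    show "criterion i (y_word X n i) (\<kappa> i)" if i: "i \<in> {1..n}" for i
    proof -
      consider "X = TypeB" | "X = TypeC" | "X = TypeD" using X by auto
      then show ?thesis
      proof cases
        case 1
        then have "y_word X n i = y_B n i" "\<kappa> i = i" by (simp_all add: \<kappa>_def)
        then show ?thesis using criterion_B[OF 1 i] by simp
      next
        case 2
        then have "y_word X n i = y_C i" "\<kappa> i = i" by (simp_all add: \<kappa>_def)
        then show ?thesis using criterion_C[OF 2 i] by simp
      next
        case 3
        then have "y_word X n i = y_D n i" "\<kappa> i = (if odd n then swap_last n i else i)" by (simp_all add: \<kappa>_def)
        then show ?thesis using criterion_D[OF 3 n(2)[OF 3] i] by simp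
      qed
    qed
    show "{1..n} \<subseteq> \<kappa> ` {1..n}"
    proof
      fix k assume k: "k \<in> {1..n}"
      have "\<kappa> (\<kappa> k) = k" "\<kappa> k \<in> {1..n}" using k n by (auto simp: \<kappa>_def swap_last_def)
      then show "k \<in> \<kappa> ` {1..n}" by (metis imageI)
    qed
  qed
qed

theorem theorem4p1:
  fixes X :: series and n :: nat and x :: inf_word
  assumes "admissible X n"
    and "inf_reduced X n x"
  shows "minimal_inf_reduced X n x \<longleftrightarrow>
    (\<exists>i \<in> {1..n}. \<exists>u v.
      reduced_expression X n {1..n} (u @ v)
        (longest_element X n ({1..n} - {i}) \<circ> longest_element X n {1..n}) \<and>
      inf_reduced_expression X n (periodic_word (v @ y_word X n i @ u)) x)"
proof (cases X)
  case TypeE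
  then have "n = 6 \<or> n = 7 \<or> n = 8" using assms(1) by auto
  then show ?thesis
    using minimal_iff_E6[of x] minimal_iff_E7[of x] minimal_iff_E8[of x] assms(2) unfolding TypeE by blast
next
  case TypeF
  then have "n = 4" using assms(1) by simp
  show ?thesis using minimal_iff_F4[of x] assms(2) unfolding TypeF \<open>n = 4\<close> by blast
next
  case TypeG
  then have "n = 2" using assms(1) by simp
  show ?thesis using minimal_iff_G2[of x] assms(2) unfolding TypeG \<open>n = 2\<close> by blast
qed (use minimal_iff_classical[OF _ assms] in auto)

end
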